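(* Let $n\geq 1$ and $\frac{n}{n+1}<p\leq 1$. Then a tempered distribution $f\in\mathcal{S}'(\mathbf{R}^n)$ belongs to $\dot h^{1,p}(\mathbf{R}^n)$ if and only if $f$ is (given by) a locally integrable function and there is a function $g\in L^p(\mathbf{R}^n)$ and a set $E\subset\mathbf{R}^n$ of measure zero such that $$|f(x)-f(y)|\leq|x-y|\,(g(x)+g(y))\quad\text{for all } x,y\in\mathbf{R}^n\setminus E\text{ with }|x-y|\leq 1.\quad( * )$$ Moreover, one has the equivalence of (quasi)norms $$\|f\|_{\dot h^{1,p}(\mathbf{R}^n)}\sim\inf\|g\|_{L^p(\mathbf{R}^n)},$$ where the infimum is taken over all functions $g\in L^p(\mathbf{R}^n)$ admissible in $( * )$ (for some null set $E$), and one identifies functions differing only by a constant.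
   Context: Fix $\psi\in C_0^\infty(\mathbf{R}^n)$ with $\int\psi=1$ and $\operatorname{supp}\psi\subset\{x:|x|\leq 1\}$, put $\psi_t(y)=t^{-n}\psi(y/t)$, and fix a number $\rho>0$. For $p>0$, a tempered distribution $f$ belongs to the local Hardy space $h^p(\mathbf{R}^n)$ iff $\mathcal{M}_{\psi,\rho}f(x):=\sup_{0<t\leq\rho}|f*\psi_t(x)|$ is in $L^p(\mathbf{R}^n)$; one sets $\|f\|_{h^p(\mathbf{R}^n)}:=\|\mathcal{M}_{\psi,\rho}f\|_{L^p}$ (different choices of $\psi$ and $\rho$ give the same space with equivalent (quasi)norms). A tempered distribution $f$ belongs to the homogeneous local Hardy-Sobolev space $\dot h^{1,p}(\mathbf{R}^n)$ iff its distributional derivatives satisfy $D_jf\in h^p(\mathbf{R}^n)$ for each $j=1,\dots,n$; $\|f\|_{\dot h^{1,p}(\mathbf{R}^n)}:=\sum_{j=1}^n\|D_jf\|_{h^p(\mathbf{R}^n)}$. The notation $A\sim B$ means that $C^{-1}A\leq B\leq CA$ with a constant $C\ge 1$ independent of $f$. *)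

theory Defs
  imports "HOL-Analysis.Analysis"
begin

section \<open>Test functions and Schwartz functions\<close>

definition partial_derivative :: "'n::finite \<Rightarrow> (real^'n \<Rightarrow> complex) \<Rightarrow> real^'n \<Rightarrow> complex"
  where "partial_derivative j \<phi> x = frechet_derivative \<phi> (at x) (axis j 1)"

text \<open>Lists of coordinate directions play the role of multi-indices: the partial derivative
  along \<open>js\<close> has order \<open>length js\<close>. For smooth functions the order of the entries is irrelevant.\<close>

fun iterated_partial :: "'n::finite list \<Rightarrow> (real^'n \<Rightarrow> complex) \<Rightarrow> real^'n \<Rightarrow> complex" where
  "iterated_partial [] \<phi> = \<phi>"
| "iterated_partial (j # js) \<phi> = partial_derivative j (iterated_partial js \<phi>)"

text \<open>Differentiability of all iterated partial derivatives makes all of them continuous,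
  so this is \<open>C\<close>-infinity in the usual sense.\<close>

definition smooth :: "(real^'n::finite \<Rightarrow> complex) \<Rightarrow> bool"
  where "smooth \<phi> \<longleftrightarrow> (\<forall>js x. iterated_partial js \<phi> differentiable (at x))"

definition supp :: "(real^'n::finite \<Rightarrow> complex) \<Rightarrow> (real^'n) set"
  where "supp \<phi> = closure {x. \<phi> x \<noteq> 0}"

definition test_functions :: "(real^'n::finite \<Rightarrow> complex) set"
  where "test_functions = {\<phi>. smooth \<phi> \<and> compact (supp \<phi>)}"

definition schwartz_functions :: "(real^'n::finite \<Rightarrow> complex) set"
  where "schwartz_functions = {\<phi>. smooth \<phi> \<and>
    (\<forall>k js. bounded (range (\<lambda>x. (1 + norm x) ^ k *\<^sub>R iterated_partial js \<phi> x)))}"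

text \<open>On Schwartz functions the supremum below is over a nonempty bounded set of reals.\<close>

definition schwartz_seminorm :: "nat \<Rightarrow> (real^'n::finite \<Rightarrow> complex) \<Rightarrow> real"
  where "schwartz_seminorm k \<phi> =
    (SUP (js, x) \<in> {js. length js \<le> k} \<times> UNIV. (1 + norm x) ^ k * norm (iterated_partial js \<phi> x))"

section \<open>Tempered distributions\<close>

text \<open>A distribution is represented by a functional on all functions \<open>real^'n \<Rightarrow> complex\<close>;
  only its values on Schwartz functions are meaningful.\<close>

type_synonym 'n functional = "(real^'n \<Rightarrow> complex) \<Rightarrow> complex"

text \<open>Linear functionals on the Schwartz space that are continuous for the topology
  given by the increasing family of norms \<open>schwartz_seminorm k\<close>.\<close>

definition tempered_distributions :: "'n::finite functional set"
  where "tempered_distributions = {f.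
    (\<forall>\<phi>\<in>schwartz_functions. \<forall>\<eta>\<in>schwartz_functions. f (\<lambda>x. \<phi> x + \<eta> x) = f \<phi> + f \<eta>) \<and>
    (\<forall>c. \<forall>\<phi>\<in>schwartz_functions. f (\<lambda>x. c * \<phi> x) = c * f \<phi>) \<and>
    (\<exists>C k. \<forall>\<phi>\<in>schwartz_functions. norm (f \<phi>) \<le> C * schwartz_seminorm k \<phi>)}"

definition distr_deriv :: "'n::finite \<Rightarrow> 'n functional \<Rightarrow> 'n functional"
  where "distr_deriv j f = (\<lambda>\<phi>. - f (partial_derivative j \<phi>))"

definition distr_convolution :: "'n::finite functional \<Rightarrow> (real^'n \<Rightarrow> complex) \<Rightarrow> real^'n \<Rightarrow> complex"
  where "distr_convolution f \<phi> x = f (\<lambda>y. \<phi> (x - y))"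

definition locally_integrable :: "(real^'n::finite \<Rightarrow> complex) \<Rightarrow> bool"
  where "locally_integrable u \<longleftrightarrow> (\<forall>K. compact K \<longrightarrow> u absolutely_integrable_on K)"

text \<open>The identity is required on compactly supported test functions only, since for a general
  locally integrable function the integral against a Schwartz function need not converge
  absolutely. By density this determines a tempered distribution \<open>f\<close>.\<close>

definition given_by :: "'n::finite functional \<Rightarrow> (real^'n \<Rightarrow> complex) \<Rightarrow> bool"
  where "given_by f u \<longleftrightarrow> locally_integrable u \<and>
    (\<forall>\<phi>\<in>test_functions. f \<phi> = (LINT x|lebesgue. u x * \<phi> x))"

definition differ_by_constant :: "'n::finite functional \<Rightarrow> 'n functional \<Rightarrow> bool"
  where "differ_by_constant f f' \<longleftrightarrow>
    (\<exists>c. \<forall>\<phi>\<in>schwartz_functions. f' \<phi> = f \<phi> + (LINT x|lebesgue. c * \<phi> x))"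

section \<open>Lebesgue spaces for positive exponents\<close>

text \<open>Used only for \<open>p > 0\<close>, where the power of infinity is infinity; the operation \<open>powr\<close> is not
  available on extended nonnegative reals.\<close>

definition ennreal_rpow :: "ennreal \<Rightarrow> real \<Rightarrow> ennreal"
  where "ennreal_rpow a p = (if a = top then top else ennreal (enn2real a powr p))"

definition Lp_norm :: "real \<Rightarrow> (real^'n::finite \<Rightarrow> ennreal) \<Rightarrow> ennreal"
  where "Lp_norm p h = ennreal_rpow (\<integral>\<^sup>+ x. ennreal_rpow (h x) p \<partial>lebesgue) (1 / p)"

definition Lp :: "real \<Rightarrow> (real^'n::finite \<Rightarrow> real) set"
  where "Lp p = {g. g \<in> borel_measurable lebesgue \<and> Lp_norm p (\<lambda>x. ennreal \<bar>g x\<bar>) < top}"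

section \<open>Local Hardy and Hardy-Sobolev spaces\<close>

definition dilate :: "real \<Rightarrow> (real^'n::finite \<Rightarrow> complex) \<Rightarrow> real^'n \<Rightarrow> complex"
  where "dilate t \<psi> y = (1 / t ^ CARD('n)) *\<^sub>R \<psi> ((1 / t) *\<^sub>R y)"

definition maximal_function ::
    "(real^'n::finite \<Rightarrow> complex) \<Rightarrow> real \<Rightarrow> 'n functional \<Rightarrow> real^'n \<Rightarrow> ennreal"
  where "maximal_function \<psi> \<rho> f x =
    (SUP t\<in>{0<..\<rho>}. ennreal (norm (distr_convolution f (dilate t \<psi>) x)))"

definition hardy_norm ::
    "(real^'n::finite \<Rightarrow> complex) \<Rightarrow> real \<Rightarrow> real \<Rightarrow> 'n functional \<Rightarrow> ennreal"
  where "hardy_norm \<psi> \<rho> p f = Lp_norm p (maximal_function \<psi> \<rho> f)"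

definition local_hardy :: "(real^'n::finite \<Rightarrow> complex) \<Rightarrow> real \<Rightarrow> real \<Rightarrow> 'n functional set"
  where "local_hardy \<psi> \<rho> p = {f \<in> tempered_distributions.
    maximal_function \<psi> \<rho> f \<in> borel_measurable lebesgue \<and> hardy_norm \<psi> \<rho> p f < top}"

definition local_hardy_sobolev ::
    "(real^'n::finite \<Rightarrow> complex) \<Rightarrow> real \<Rightarrow> real \<Rightarrow> 'n functional set"
  where "local_hardy_sobolev \<psi> \<rho> p =
    {f \<in> tempered_distributions. \<forall>j. distr_deriv j f \<in> local_hardy \<psi> \<rho> p}"

definition hardy_sobolev_norm ::
    "(real^'n::finite \<Rightarrow> complex) \<Rightarrow> real \<Rightarrow> real \<Rightarrow> 'n functional \<Rightarrow> ennreal"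
  where "hardy_sobolev_norm \<psi> \<rho> p f = (\<Sum>j\<in>UNIV. hardy_norm \<psi> \<rho> p (distr_deriv j f))"

section \<open>The pointwise condition\<close>

definition admissible :: "(real^'n::finite \<Rightarrow> complex) \<Rightarrow> (real^'n \<Rightarrow> real) \<Rightarrow> bool"
  where "admissible u g \<longleftrightarrow> (\<exists>E. E \<in> null_sets lebesgue \<and>
    (\<forall>x y. x \<notin> E \<longrightarrow> y \<notin> E \<longrightarrow> norm (x - y) \<le> 1 \<longrightarrow>
      norm (u x - u y) \<le> norm (x - y) * (g x + g y)))"

text \<open>The representative \<open>u\<close> of \<open>f\<close> is unique up to a null set, which \<open>admissible\<close> absorbs.
  The infimum of the empty set is infinity.\<close>

definition pointwise_norm :: "real \<Rightarrow> 'n::finite functional \<Rightarrow> ennreal"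
  where "pointwise_norm p f =
    Inf {Lp_norm p (\<lambda>x. ennreal \<bar>g x\<bar>) | g. g \<in> Lp p \<and> (\<exists>u. given_by f u \<and> admissible u g)}"

end

theory Submission
  imports Defs
begin

text \<open>For one direction, a function \<open>u\<close> with the pointwise property satisfies, for \<open>n / (n + 1) < q < p\<close>,
  the Poincare inequality bounding the mean oscillation of \<open>u\<close> on a ball of radius \<open>r\<close> by
  \<open>r\<close> times the \<open>q\<close>-average of \<open>g\<close> on the double ball. Since the derivatives of a bump have integral zero,
  the radial maximal function of \<open>D\<^sub>j u\<close> is at most \<open>C (M g\<^sup>q) powr (1 / q)\<close>, which is
  controlled in \<open>L\<^sup>p\<close> by the Hardy--Littlewood theorem.

  Conversely, put \<open>u\<^sub>t = f * \<psi>\<^sub>t\<close>. Its gradient consists of mollifications of the \<open>D\<^sub>j f\<close>, and so does its derivative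
  in \<open>t\<close>, with the kernels \<open>y\<^sub>j \<psi> y\<close> in place of \<open>\<psi>\<close>. The grand maximal function estimate bounds all of
  these nontangentially by \<open>(M H\<^sup>q) powr (1 / q)\<close>, where \<open>H\<close> is the radial maximal function of \<open>D\<^sub>j f\<close>.
  Hence the \<open>u\<^sub>t\<close> satisfy the pointwise condition uniformly in \<open>t\<close>, and so does their limit.\<close>

section \<open>Smooth functions and test functions\<close>

text \<open>The exponent \<open>q\<close> has two duties: \<open>q > n / (n + 1)\<close> makes the
  chain of shrinking balls in the Poincare inequality summable, and \<open>q < p\<close> makes the
  maximal operator bounded on the Lebesgue space of exponent \<open>p / q > 1\<close>. This is why
  real powers are taken inside and outside of \<open>maximal_op\<close>. The main obstacle is the
  grand maximal estimate. Of \<open>\<theta>\<close> only smoothness, support and integral one are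
  known, so an arbitrary test function is rebuilt from mollifications by \<open>\<theta>\<close> at
  dyadic scales, with remainders that decay fast. The resulting inequality first needs an a priori
  growth exponent, which depends on the order of the distribution and is then removed by iteration.
  Every quantity has the form \<open>F (bump x t \<phi>)\<close>. Since
  \<open>\<lambda>\<phi>. F (bump x t \<phi>)\<close> is again a distribution, the grand maximal
  estimate is needed at unit scale only. The bound \<open>\<rho>\<close> on the scales and the
  distance 1 in the pointwise condition are unrelated; \<open>hajlasz_extend\<close> reconciles them
  at the cost of a constant, by inserting intermediate points.\<close>

lemma iterated_partial_snoc:
  "iterated_partial js (partial_derivative j \<phi>) = iterated_partial (js @ [j]) \<phi>"
  by (induction js) auto

lemma iterated_partial_append:
  "iterated_partial js (iterated_partial ks \<phi>) = iterated_partial (js @ ks) \<phi>"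
  by (induction js) auto

lemma smooth_iterated_partial: "smooth \<phi> \<Longrightarrow> smooth (iterated_partial js \<phi>)"
  unfolding smooth_def iterated_partial_append by blast

lemma smooth_partial_derivative: "smooth \<phi> \<Longrightarrow> smooth (partial_derivative j \<phi>)"
  using smooth_iterated_partial[of \<phi> "[j]"] by simp

text \<open>Every iterated partial derivative of \<open>\<phi>\<close> stays in \<open>S\<close>.
  This proves smoothness of products and convolutions without a formula for their higher
  derivatives.\<close>

lemma smooth_coinduct:
  assumes "\<phi> \<in> S" and "\<And>\<alpha> x. \<alpha> \<in> S \<Longrightarrow> \<alpha> differentiable (at x)"
    and "\<And>\<alpha> j. \<alpha> \<in> S \<Longrightarrow> partial_derivative j \<alpha> \<in> S"
  shows "smooth \<phi>"
proof -
  have "iterated_partial js \<phi> \<in> S" for js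
    by (induction js) (use assms in auto)
  then show ?thesis unfolding smooth_def using assms(2) by blast
qed

lemma smooth_differentiable: "smooth \<phi> \<Longrightarrow> \<phi> differentiable (at x)"
  unfolding smooth_def by (metis iterated_partial.simps(1))

lemma sum_axis: "(\<Sum>j\<in>UNIV. h $ j *\<^sub>R axis j (1::real)) = (h :: real^'n::finite)"
  by (simp add: vec_eq_iff axis_def if_distrib[of "\<lambda>u. _ * u"] cong: if_cong)

lemma smooth_has_derivative:
  assumes "smooth \<phi>"
  shows "(\<phi> has_derivative (\<lambda>h. \<Sum>j\<in>UNIV. h $ j *\<^sub>R partial_derivative j \<phi> x)) (at x)"
proof -
  let ?D = "frechet_derivative \<phi> (at x)"
  have d: "(\<phi> has_derivative ?D) (at x)"
    using smooth_differentiable[OF assms] frechet_derivative_works by blast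
  then have lin: "linear ?D" by (rule has_derivative_linear)
  have "?D h = (\<Sum>j\<in>UNIV. h $ j *\<^sub>R partial_derivative j \<phi> x)" for h
  proof -
    have "?D h = ?D (\<Sum>j\<in>UNIV. h $ j *\<^sub>R axis j 1)" by (simp add: sum_axis)
    also have "\<dots> = (\<Sum>j\<in>UNIV. h $ j *\<^sub>R partial_derivative j \<phi> x)"
      by (simp add: linear_sum[OF lin] linear_cmul[OF lin] partial_derivative_def)
    finally show ?thesis .
  qed
  then have "?D = (\<lambda>h. \<Sum>j\<in>UNIV. h $ j *\<^sub>R partial_derivative j \<phi> x)" by blast
  then show ?thesis using d by simp
qed

lemma partial_derivative_eqI:
  assumes "(\<phi> has_derivative D) (at x)"
  shows "partial_derivative j \<phi> x = D (axis j 1)"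
  unfolding partial_derivative_def using frechet_derivative_at[OF assms] by simp

lemma smooth_continuous: "smooth \<phi> \<Longrightarrow> continuous_on S \<phi>"
  by (meson smooth_differentiable continuous_at_imp_continuous_on differentiable_imp_continuous_within)

lemma axis_component: "axis j (1::real) $ i = (if i = j then 1 else 0)"
  by (simp add: axis_def)

lemma sum_axis_scaleR:
  "(\<Sum>i\<in>UNIV. axis j (1::real) $ i *\<^sub>R f i) = (f (j::'n::finite) :: 'b::real_vector)"
  by (subst sum.remove[of _ j]) (auto simp: axis_component intro!: sum.neutral)

section \<open>Stability of smoothness under linear combinations, affine changes of variable and
  coordinate factors\<close>

lemma iterated_partial_lincomb:
  assumes "smooth \<phi>" "smooth \<eta>"
  shows "iterated_partial js (\<lambda>x. a * \<phi> x + b * \<eta> x)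
    = (\<lambda>x. a * iterated_partial js \<phi> x + b * iterated_partial js \<eta> x)"
proof (induction js)
  case (Cons j js)
  show ?case
  proof
    fix x
    let ?\<phi> = "iterated_partial js \<phi>" and ?\<eta> = "iterated_partial js \<eta>"
    have "((\<lambda>x. a * ?\<phi> x + b * ?\<eta> x) has_derivative
      (\<lambda>h. a * (\<Sum>j\<in>UNIV. h $ j *\<^sub>R partial_derivative j ?\<phi> x)
         + b * (\<Sum>j\<in>UNIV. h $ j *\<^sub>R partial_derivative j ?\<eta> x))) (at x)"
      by (intro derivative_intros smooth_has_derivative smooth_iterated_partial assms)
    from partial_derivative_eqI[OF this, of j]
    show "iterated_partial (j # js) (\<lambda>x. a * \<phi> x + b * \<eta> x) x
      = a * iterated_partial (j # js) \<phi> x + b * iterated_partial (j # js) \<eta> x"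
      by (simp add: Cons.IH sum_axis_scaleR)
  qed
qed simp

lemma smooth_lincomb:
  assumes "smooth \<phi>" "smooth \<eta>"
  shows "smooth (\<lambda>x. a * \<phi> x + b * \<eta> x)"
  unfolding smooth_def iterated_partial_lincomb[OF assms]
  using assms unfolding smooth_def by (auto intro!: derivative_intros)

lemma iterated_partial_affine:
  assumes "smooth \<phi>"
  shows "iterated_partial js (\<lambda>z. \<phi> (a *\<^sub>R (z - w)))
    = (\<lambda>z. a ^ length js *\<^sub>R iterated_partial js \<phi> (a *\<^sub>R (z - w)))"
proof (induction js)
  case (Cons j js)
  show ?case
  proof
    fix z
    let ?\<phi> = "iterated_partial js \<phi>"
    have "((\<lambda>z. ?\<phi> (a *\<^sub>R (z - w))) has_derivative
      (\<lambda>h. \<Sum>j\<in>UNIV. (a *\<^sub>R h) $ j *\<^sub>R partial_derivative j ?\<phi> (a *\<^sub>R (z - w)))) (at z)"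
      by (rule has_derivative_compose[OF _ smooth_has_derivative[OF smooth_iterated_partial[OF assms]]])
         (auto intro!: derivative_eq_intros)
    then have "((\<lambda>z. a ^ length js *\<^sub>R ?\<phi> (a *\<^sub>R (z - w))) has_derivative
      (\<lambda>h. a ^ length js *\<^sub>R (\<Sum>j\<in>UNIV. (a *\<^sub>R h) $ j *\<^sub>R partial_derivative j ?\<phi> (a *\<^sub>R (z - w))))) (at z)"
      by (rule has_derivative_scaleR_right)
    from partial_derivative_eqI[OF this, of j]
    show "iterated_partial (j # js) (\<lambda>z. \<phi> (a *\<^sub>R (z - w))) z
      = a ^ length (j # js) *\<^sub>R iterated_partial (j # js) \<phi> (a *\<^sub>R (z - w))"
      using sum_axis_scaleR[of j "\<lambda>i. a *\<^sub>R partial_derivative i ?\<phi> (a *\<^sub>R (z - w))"]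
      by (simp add: Cons.IH mult.commute)
  qed
qed simp

lemma differentiable_compose_affine:
  fixes \<phi> :: "real^'n::finite \<Rightarrow> complex"
  assumes "\<And>x. \<phi> differentiable (at x)"
  shows "(\<lambda>z. \<phi> (a *\<^sub>R (z - w))) differentiable (at z)"
  using differentiable_compose[of \<phi> "\<lambda>z. a *\<^sub>R (z - w)" z UNIV] assms
  by (auto intro!: derivative_intros)

lemma smooth_affine:
  assumes "smooth \<phi>" shows "smooth (\<lambda>z. \<phi> (a *\<^sub>R (z - w)))"
  unfolding smooth_def iterated_partial_affine[OF assms]
  using assms unfolding smooth_def
  by (auto intro!: derivative_intros differentiable_compose_affine)

lemma partial_derivative_coordinate_mult:
  assumes "smooth \<alpha>"
  shows "(\<lambda>y. y $ i *\<^sub>R \<alpha> y) differentiable (at x)"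
    and "partial_derivative j (\<lambda>y. y $ i *\<^sub>R \<alpha> y)
      = (\<lambda>x. x $ i *\<^sub>R partial_derivative j \<alpha> x + (if i = j then \<alpha> x else 0))"
proof -
  have d: "((\<lambda>y. y $ i *\<^sub>R \<alpha> y) has_derivative
    (\<lambda>h. x $ i *\<^sub>R (\<Sum>j\<in>UNIV. h $ j *\<^sub>R partial_derivative j \<alpha> x) + h $ i *\<^sub>R \<alpha> x)) (at x)" for x
    by (intro derivative_intros has_derivative_scaleR smooth_has_derivative assms
        bounded_linear.has_derivative[OF bounded_linear_vec_nth] has_derivative_ident)
  show "(\<lambda>y. y $ i *\<^sub>R \<alpha> y) differentiable (at x)" using d differentiable_def by blast
  show "partial_derivative j (\<lambda>y. y $ i *\<^sub>R \<alpha> y)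
      = (\<lambda>x. x $ i *\<^sub>R partial_derivative j \<alpha> x + (if i = j then \<alpha> x else 0))"
    by (rule ext, subst partial_derivative_eqI[OF d]) (simp only: sum_axis_scaleR, simp add: axis_component)
qed

text \<open>By the product rule a partial derivative of \<open>y $ i *\<^sub>R \<alpha> y\<close>
  has the same form plus an extra \<open>\<alpha>\<close> when the indices agree. The family with a
  free smooth summand \<open>\<beta>\<close> absorbs that term and is closed under
  differentiation.\<close>

lemma smooth_coordinate_mult:
  fixes \<phi> :: "real^'a::finite \<Rightarrow> complex"
  assumes "smooth \<phi>" shows "smooth (\<lambda>y. y $ i *\<^sub>R \<phi> y)"
proof (rule smooth_coinduct[where S = "{(\<lambda>y. y $ i *\<^sub>R \<alpha> y + \<beta> y) | \<alpha> \<beta>. smooth \<alpha> \<and> smooth \<beta>}"])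
  have z: "smooth (\<lambda>x::real^'a. 0 :: complex)" using smooth_lincomb[OF assms assms, of 0 0] by simp
  show "(\<lambda>y. y $ i *\<^sub>R \<phi> y) \<in> {(\<lambda>y. y $ i *\<^sub>R \<alpha> y + \<beta> y) | \<alpha> \<beta>. smooth \<alpha> \<and> smooth \<beta>}"
    using assms z by (intro CollectI exI[of _ \<phi>] exI[of _ "\<lambda>_. 0"]) simp
next
  fix \<gamma> :: "real^'a \<Rightarrow> complex" and x
  assume "\<gamma> \<in> {(\<lambda>y. y $ i *\<^sub>R \<alpha> y + \<beta> y) | \<alpha> \<beta>. smooth \<alpha> \<and> smooth \<beta>}"
  then obtain \<alpha> \<beta> where g: "\<gamma> = (\<lambda>y. y $ i *\<^sub>R \<alpha> y + \<beta> y)" "smooth \<alpha>" "smooth \<beta>" by auto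
  show "\<gamma> differentiable (at x)"
    unfolding g(1) by (intro derivative_intros partial_derivative_coordinate_mult g smooth_differentiable)
next
  fix \<gamma> :: "real^'a \<Rightarrow> complex" and j
  assume "\<gamma> \<in> {(\<lambda>y. y $ i *\<^sub>R \<alpha> y + \<beta> y) | \<alpha> \<beta>. smooth \<alpha> \<and> smooth \<beta>}"
  then obtain \<alpha> \<beta> where g: "\<gamma> = (\<lambda>y. y $ i *\<^sub>R \<alpha> y + \<beta> y)" "smooth \<alpha>" "smooth \<beta>" by auto
  have "partial_derivative j \<gamma> x = x $ i *\<^sub>R partial_derivative j \<alpha> x
      + ((if i = j then \<alpha> x else 0) + partial_derivative j \<beta> x)" for x
  proof -
    have "(\<gamma> has_derivative (\<lambda>h. frechet_derivative (\<lambda>y. y $ i *\<^sub>R \<alpha> y) (at x) h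
        + frechet_derivative \<beta> (at x) h)) (at x)"
      unfolding g(1)
      by (intro has_derivative_add frechet_derivative_works[THEN iffD1]
          partial_derivative_coordinate_mult g smooth_differentiable)
    from partial_derivative_eqI[OF this, of j]
    have "partial_derivative j \<gamma> x = partial_derivative j (\<lambda>y. y $ i *\<^sub>R \<alpha> y) x + partial_derivative j \<beta> x"
      by (simp add: partial_derivative_def)
    then show ?thesis by (simp add: partial_derivative_coordinate_mult(2)[OF g(2)])
  qed
  moreover have "smooth (\<lambda>x. (if i = j then \<alpha> x else 0) + partial_derivative j \<beta> x)"
    using smooth_lincomb[OF g(2) smooth_partial_derivative[OF g(3)], of "if i = j then 1 else 0" 1 j]
    by (simp add: if_distrib[of "\<lambda>u. u * _"] cong: if_cong)
  ultimately show "partial_derivative j \<gamma> \<in> {(\<lambda>y. y $ i *\<^sub>R \<alpha> y + \<beta> y) | \<alpha> \<beta>. smooth \<alpha> \<and> smooth \<beta>}"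
    using smooth_partial_derivative[OF g(2), of j]
    by (intro CollectI exI[of _ "partial_derivative j \<alpha>"]
        exI[of _ "\<lambda>x. (if i = j then \<alpha> x else 0) + partial_derivative j \<beta> x"]) auto
qed

text \<open>The radius is explicit because the constant and the order in \<open>distribution\<close>
  depend on it. A negative radius is permitted and leaves only the zero function; where a sign
  matters, radii are replaced by their maximum with 0.\<close>

definition test_in :: "real \<Rightarrow> (real^'n::finite \<Rightarrow> complex) set"
  where "test_in R = {\<phi>. smooth \<phi> \<and> (\<forall>x. norm x > R \<longrightarrow> \<phi> x = 0)}"

lemma test_in_smooth: "\<phi> \<in> test_in R \<Longrightarrow> smooth \<phi>"
  and test_in_zero: "\<phi> \<in> test_in R \<Longrightarrow> norm x > R \<Longrightarrow> \<phi> x = 0"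
  by (auto simp: test_in_def)

lemma test_in_mono: "\<phi> \<in> test_in R \<Longrightarrow> R \<le> R' \<Longrightarrow> \<phi> \<in> test_in R'"
  by (auto simp: test_in_def)

lemma test_in_test_functions:
  assumes "\<phi> \<in> test_in R" shows "\<phi> \<in> test_functions"
proof -
  have "{x. \<phi> x \<noteq> 0} \<subseteq> cball 0 R"
    using test_in_zero[OF assms] by (force simp: not_le[symmetric])
  then have "bounded {x. \<phi> x \<noteq> 0}" using bounded_cball bounded_subset by blast
  then show ?thesis
    using test_in_smooth[OF assms] by (simp add: test_functions_def supp_def compact_closure)
qed

lemma test_functions_test_in:
  assumes "\<phi> \<in> test_functions" obtains R where "R \<ge> 0" "\<phi> \<in> test_in R"
proof -
  from assms have "bounded (supp \<phi>)" "smooth \<phi>"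
    by (auto simp: test_functions_def compact_imp_bounded)
  then obtain R where R: "\<And>x. x \<in> supp \<phi> \<Longrightarrow> norm x \<le> R" unfolding bounded_iff by blast
  have "\<phi> x = 0" if "norm x > max R 0" for x
  proof (rule ccontr)
    assume "\<phi> x \<noteq> 0"
    then have "x \<in> supp \<phi>" using closure_subset[of "{x. \<phi> x \<noteq> 0}"] by (auto simp: supp_def)
    then show False using R that by force
  qed
  then have "\<phi> \<in> test_in (max R 0)" using \<open>smooth \<phi>\<close> by (auto simp: test_in_def)
  then show ?thesis using that[of "max R 0"] by auto
qed

lemma test_in_partial_derivative:
  assumes "\<phi> \<in> test_in R" shows "partial_derivative j \<phi> \<in> test_in R"
proof -
  have "partial_derivative j \<phi> x = 0" if "norm x > R" for x
  proof -
    have "((\<lambda>_. 0) has_derivative (\<lambda>_. 0)) (at x)" by simp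
    moreover have "open {y::real^'a. norm y > R}"
      by (rule open_Collect_less) (auto intro: continuous_intros)
    ultimately have "(\<phi> has_derivative (\<lambda>_. 0)) (at x)"
      by (rule has_derivative_transform_within_open) (use that assms in \<open>auto simp: test_in_def\<close>)
    from partial_derivative_eqI[OF this] show ?thesis .
  qed
  then show ?thesis using smooth_partial_derivative assms by (auto simp: test_in_def)
qed

lemma test_in_iterated_partial:
  "\<phi> \<in> test_in R \<Longrightarrow> iterated_partial js \<phi> \<in> test_in R"
  by (induction js) (auto intro: test_in_partial_derivative)

lemma test_in_lincomb:
  "\<phi> \<in> test_in R \<Longrightarrow> \<eta> \<in> test_in R \<Longrightarrow> (\<lambda>x. a * \<phi> x + b * \<eta> x) \<in> test_in R"
  by (auto simp: test_in_def intro: smooth_lincomb)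

lemma test_in_diff:
  "\<phi> \<in> test_in R \<Longrightarrow> \<eta> \<in> test_in R \<Longrightarrow> (\<lambda>x. \<phi> x - \<eta> x) \<in> test_in R"
  using test_in_lincomb[of \<phi> R \<eta> 1 "-1"] by simp

lemma test_in_cmult: "\<phi> \<in> test_in R \<Longrightarrow> (\<lambda>x. a * \<phi> x) \<in> test_in R"
  using test_in_lincomb[of \<phi> R \<phi> a 0] by simp

lemma iterated_partial_cmult:
  "smooth \<phi> \<Longrightarrow> iterated_partial js (\<lambda>x. a * \<phi> x) = (\<lambda>x. a * iterated_partial js \<phi> x)"
  using iterated_partial_lincomb[of \<phi> \<phi> js a 0] by simp

lemma iterated_partial_diff:
  "smooth \<phi> \<Longrightarrow> smooth \<eta> \<Longrightarrow> iterated_partial js (\<lambda>x. \<phi> x - \<eta> x)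
    = (\<lambda>x. iterated_partial js \<phi> x - iterated_partial js \<eta> x)"
  using iterated_partial_lincomb[of \<phi> \<eta> js 1 "-1"] by simp

lemma test_in_sum:
  fixes \<phi> :: "'i \<Rightarrow> real^'n::finite \<Rightarrow> complex"
  assumes "finite A" "\<And>i. i \<in> A \<Longrightarrow> \<phi> i \<in> test_in R"
  shows "(\<lambda>x. \<Sum>i\<in>A. \<phi> i x) \<in> test_in R
    \<and> (\<forall>js. iterated_partial js (\<lambda>x. \<Sum>i\<in>A. \<phi> i x) = (\<lambda>x. \<Sum>i\<in>A. iterated_partial js (\<phi> i) x))"
  using assms
proof (induction A)
  case empty
  have z: "iterated_partial js (\<lambda>x. 0) = (\<lambda>x. 0)" for js :: "'n list"
    by (induction js) (auto intro!: ext simp: partial_derivative_def frechet_derivative_const)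
  then show ?case by (simp add: test_in_def smooth_def)
next
  case (insert a A)
  have 1: "\<phi> a \<in> test_in R" "(\<lambda>x. \<Sum>i\<in>A. \<phi> i x) \<in> test_in R"
    using insert by auto
  show ?case
    using insert 1 test_in_lincomb[OF 1, of 1 1]
      iterated_partial_lincomb[OF 1[THEN test_in_smooth], of _ 1 1] by auto
qed

lemma test_in_coordinate_mult: "\<phi> \<in> test_in R \<Longrightarrow> (\<lambda>y. y $ i *\<^sub>R \<phi> y) \<in> test_in R"
  by (auto simp: test_in_def intro: smooth_coordinate_mult)

lemma test_in_bounded:
  assumes "\<phi> \<in> test_in R" obtains B where "B \<ge> 0" "\<And>x. norm (\<phi> x) \<le> B"
proof -
  have "compact (\<phi> ` cball 0 R)"
    by (intro compact_continuous_image smooth_continuous test_in_smooth[OF assms] compact_cball)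
  then have "bounded (\<phi> ` cball 0 R)" by (rule compact_imp_bounded)
  then obtain B where B: "\<And>x. norm x \<le> R \<Longrightarrow> norm (\<phi> x) \<le> B"
    unfolding bounded_iff by (metis imageI mem_cball_0)
  have "norm (\<phi> x) \<le> max B 0" for x
    using B[of x] test_in_zero[OF assms, of x] by (cases "norm x \<le> R") auto
  then show ?thesis using that[of "max B 0"] by auto
qed

text \<open>Stated as a bound and not as a supremum over derivatives, so that no boundedness has to
  be proved before it can be used.\<close>

definition deriv_bound :: "nat \<Rightarrow> real \<Rightarrow> (real^'n::finite \<Rightarrow> complex) \<Rightarrow> bool"
  where "deriv_bound m A \<phi> \<longleftrightarrow> (\<forall>js x. length js \<le> m \<longrightarrow> norm (iterated_partial js \<phi> x) \<le> A)"

lemma deriv_boundD: "deriv_bound m A \<phi> \<Longrightarrow> length js \<le> m \<Longrightarrow> norm (iterated_partial js \<phi> x) \<le> A"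
  by (auto simp: deriv_bound_def)

lemma deriv_bound_norm: "deriv_bound m A \<phi> \<Longrightarrow> norm (\<phi> x) \<le> A"
  using deriv_boundD[of m A \<phi> "[]"] by simp

lemma deriv_bound_nonneg: "deriv_bound m A \<phi> \<Longrightarrow> A \<ge> 0"
  using deriv_bound_norm norm_ge_zero order_trans by blast

lemma deriv_bound_ex:
  fixes \<phi> :: "real^'n::finite \<Rightarrow> complex"
  assumes "\<phi> \<in> test_in R" obtains A where "A \<ge> 0" "deriv_bound m A \<phi>"
proof -
  have "\<exists>B. \<forall>x. norm (iterated_partial js \<phi> x) \<le> B" for js
    using test_in_bounded[OF test_in_iterated_partial[OF assms]] by metis
  then obtain B where B: "\<And>js x. norm (iterated_partial js \<phi> x) \<le> B js" by metis
  have fin: "finite {js :: 'n list. length js \<le> m}"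
    using finite_lists_length_le[of "UNIV :: 'n set" m] by simp
  have Bn: "B js \<ge> 0" for js using B[of js 0] norm_ge_zero order_trans by blast
  have "norm (iterated_partial js \<phi> x) \<le> sum B {js. length js \<le> m}" if "length js \<le> m" for js x
    using order_trans[OF B[of js x] member_le_sum[of js "{js. length js \<le> m}" B]] fin that Bn by simp
  then show ?thesis using that[of "sum B {js. length js \<le> m}"] Bn
    by (auto simp: deriv_bound_def sum_nonneg)
qed

lemma deriv_bound_iterated_partial:
  "deriv_bound (m + length js) A \<phi> \<Longrightarrow> deriv_bound m A (iterated_partial js \<phi>)"
  by (auto simp: deriv_bound_def iterated_partial_append)

lemma deriv_bound_mono:
  "deriv_bound m A \<phi> \<Longrightarrow> k \<le> m \<Longrightarrow> A \<le> B \<Longrightarrow> deriv_bound k B \<phi>"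
  unfolding deriv_bound_def by (meson order_trans)

lemma onorm_partials_le:
  fixes a :: "'n::finite \<Rightarrow> complex"
  assumes "\<And>j. norm (a j) \<le> A"
  shows "onorm (\<lambda>h::real^'n. \<Sum>j\<in>UNIV. h $ j *\<^sub>R a j) \<le> real CARD('n) * A"
proof (rule onorm_le)
  fix h :: "real^'n"
  have "norm (\<Sum>j\<in>UNIV. h $ j *\<^sub>R a j) \<le> (\<Sum>j\<in>(UNIV::'n set). norm h * A)"
    by (rule sum_norm_le) (auto intro!: mult_mono assms component_le_norm_cart)
  then show "norm (\<Sum>j\<in>UNIV. h $ j *\<^sub>R a j) \<le> real CARD('n) * A * norm h" by (simp add: mult_ac)
qed

lemma smooth_lipschitz:
  fixes \<phi> :: "real^'n::finite \<Rightarrow> complex"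
  assumes "smooth \<phi>" "deriv_bound 1 A \<phi>"
  shows "norm (\<phi> x - \<phi> y) \<le> real CARD('n) * A * norm (x - y)"
proof (rule differentiable_bound[where S = UNIV])
  fix z
  show "(\<phi> has_derivative (\<lambda>h. \<Sum>j\<in>UNIV. h $ j *\<^sub>R partial_derivative j \<phi> z)) (at z within UNIV)"
    using smooth_has_derivative[OF assms(1)] by simp
  show "onorm (\<lambda>h. \<Sum>j\<in>UNIV. h $ j *\<^sub>R partial_derivative j \<phi> z) \<le> real CARD('n) * A"
    using deriv_boundD[OF assms(2), of "[_]"] by (intro onorm_partials_le) auto
qed auto

text \<open>Mean value inequality for \<open>\<phi>\<close> minus its linear part at
  \<open>x\<close>: the partial derivatives of this difference are Lipschitz and vanish at
  \<open>x\<close>. The operator norm bound is used twice, here and inside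
  \<open>smooth_lipschitz\<close>, and contributes a factor \<open>CARD('n)\<close> each
  time.\<close>

lemma smooth_taylor:
  fixes \<phi> :: "real^'n::finite \<Rightarrow> complex"
  assumes "smooth \<phi>" "deriv_bound 2 A \<phi>"
  shows "norm (\<phi> (x + h) - \<phi> x - (\<Sum>j\<in>UNIV. h $ j *\<^sub>R partial_derivative j \<phi> x))
    \<le> (real CARD('n))\<^sup>2 * A * (norm h)\<^sup>2"
proof -
  let ?z = "\<lambda>z. \<phi> z - (\<Sum>j\<in>UNIV. (z - x) $ j *\<^sub>R partial_derivative j \<phi> x)"
  have A: "A \<ge> 0" using deriv_bound_nonneg assms(2) .
  have "norm (?z (x + h) - ?z x) \<le> (real CARD('n) * (real CARD('n) * A * norm h)) * norm ((x + h) - x)"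
  proof (rule differentiable_bound[where S = "cball x (norm h)"])
    fix z assume z: "z \<in> cball x (norm h)"
    have "(?z has_derivative (\<lambda>k. (\<Sum>j\<in>UNIV. k $ j *\<^sub>R partial_derivative j \<phi> z)
        - (\<Sum>j\<in>UNIV. (k - 0) $ j *\<^sub>R partial_derivative j \<phi> x))) (at z within cball x (norm h))"
      by (intro derivative_intros has_derivative_at_withinI[OF smooth_has_derivative] assms(1)
          bounded_linear.has_derivative[OF bounded_linear_vec_nth])
    then show "(?z has_derivative (\<lambda>k. \<Sum>j\<in>UNIV. k $ j *\<^sub>R (partial_derivative j \<phi> z - partial_derivative j \<phi> x)))
        (at z within cball x (norm h))"
      by (simp add: scaleR_diff_right sum_subtractf)
    show "onorm (\<lambda>k. \<Sum>j\<in>UNIV. k $ j *\<^sub>R (partial_derivative j \<phi> z - partial_derivative j \<phi> x))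
        \<le> real CARD('n) * (real CARD('n) * A * norm h)"
    proof (rule onorm_partials_le)
      fix j
      have "deriv_bound 1 A (partial_derivative j \<phi>)"
        using deriv_bound_iterated_partial[of 1 "[j]" A \<phi>] assms(2) by (simp add: numeral_2_eq_2)
      then have "norm (partial_derivative j \<phi> z - partial_derivative j \<phi> x) \<le> real CARD('n) * A * norm (z - x)"
        by (intro smooth_lipschitz smooth_partial_derivative assms(1))
      also have "\<dots> \<le> real CARD('n) * A * norm h"
        using z A by (intro mult_left_mono) (auto simp: dist_norm norm_minus_commute)
      finally show "norm (partial_derivative j \<phi> z - partial_derivative j \<phi> x) \<le> real CARD('n) * A * norm h" .
    qed
  qed (auto simp: dist_norm)
  then show ?thesis by (simp add: power2_eq_square algebra_simps)
qed

section \<open>Convolution and mollification\<close>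

lemma nn_integral_lborel_affine:
  fixes f :: "'a::euclidean_space \<Rightarrow> ennreal"
  assumes "f \<in> borel_measurable borel" "c \<noteq> 0"
  shows "(\<integral>\<^sup>+x. f x \<partial>lborel) = ennreal (\<bar>c\<bar> ^ DIM('a)) * (\<integral>\<^sup>+x. f (t + c *\<^sub>R x) \<partial>lborel)"
proof -
  have [measurable]: "f \<in> borel_measurable borel" by fact
  show ?thesis
    by (subst lborel_affine[OF assms(2), of t])
       (simp add: nn_integral_density nn_integral_distr nn_integral_cmult)
qed

lemma integral_lborel_affine:
  fixes f :: "'a::euclidean_space \<Rightarrow> 'b::{banach, second_countable_topology}"
  assumes "f \<in> borel_measurable borel" "c \<noteq> 0"
  shows "(\<integral>x. f x \<partial>lborel) = \<bar>c\<bar> ^ DIM('a) *\<^sub>R (\<integral>x. f (t + c *\<^sub>R x) \<partial>lborel)"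
proof -
  have [measurable]: "f \<in> borel_measurable borel" by fact
  show ?thesis
    by (subst lborel_affine[OF assms(2), of t])
       (simp add: integral_density integral_distr)
qed

lemma integrable_continuous_vanishing:
  fixes f :: "'a::euclidean_space \<Rightarrow> 'b::{banach, second_countable_topology}"
  assumes "continuous_on UNIV f" "\<And>x. norm x > R \<Longrightarrow> f x = 0"
  shows "integrable lborel f"
proof -
  have "integrable lborel (\<lambda>x. indicator (cball 0 R) x *\<^sub>R f x)"
    by (rule borel_integrable_compact) (auto intro: continuous_on_subset[OF assms(1)])
  moreover have "(\<lambda>x. indicator (cball 0 R) x *\<^sub>R f x) = f"
    using assms(2) by (fastforce simp: indicator_def not_le)
  ultimately show ?thesis by simp
qed

lemma test_in_continuous: "\<phi> \<in> test_in R \<Longrightarrow> continuous_on S \<phi>"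
  by (rule smooth_continuous[OF test_in_smooth])

lemma test_in_integrable: "\<phi> \<in> test_in R \<Longrightarrow> integrable lborel \<phi>"
  by (rule integrable_continuous_vanishing[OF test_in_continuous test_in_zero])

lemma test_in_integrable_mult:
  assumes "\<phi> \<in> test_in R" "continuous_on UNIV f"
  shows "integrable lborel (\<lambda>x. \<phi> x * (f x :: complex))"
  by (rule integrable_continuous_vanishing[where R = R])
     (simp_all add: continuous_on_mult[OF test_in_continuous[OF assms(1)] assms(2)] test_in_zero[OF assms(1)])

lemma test_in_continuous_compose:
  "\<phi> \<in> test_in R \<Longrightarrow> continuous_on S g \<Longrightarrow> continuous_on S (\<lambda>w. \<phi> (g w))"
  by (rule continuous_on_compose2[OF test_in_continuous[where S = UNIV]]) auto

lemma norm_integral_le: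
  fixes f :: "'a \<Rightarrow> 'b::{banach, second_countable_topology}"
  assumes "integrable M g" "\<And>x. norm (f x) \<le> g x"
  shows "norm (\<integral>x. f x \<partial>M) \<le> (\<integral>x. g x \<partial>M)"
  by (rule order_trans[OF integral_norm_bound integral_mono'[OF assms(1)]])
     (auto intro: assms(2) order_trans[OF norm_ge_zero assms(2)])

text \<open>Turns an error bound that is linear in a small parameter into an exact identity: a norm
  bounded in this way vanishes.\<close>

lemma nonpos_if_le_small:
  fixes a :: real
  assumes "M \<ge> 0" "\<And>h. 0 < h \<Longrightarrow> h \<le> 1 \<Longrightarrow> a \<le> M * h"
  shows "a \<le> 0"
proof (rule ccontr)
  assume a: "\<not> a \<le> 0"
  let ?h = "min 1 (a / (2 * (M + 1)))"
  have "a \<le> M * ?h" using a assms(1) by (intro assms(2)) auto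
  also have "\<dots> \<le> (M + 1) * (a / (2 * (M + 1)))"
    using a assms(1) by (intro mult_mono) auto
  also have "\<dots> = a / 2"
  proof -
    have "M + 1 \<noteq> 0" using assms(1) by linarith
    then show ?thesis by (simp add: divide_simps)
  qed
  finally show False using a by simp
qed

text \<open>The derivatives of convolutions and of distributions along moving bumps are all obtained
  from a quadratic remainder estimate, valid for increments of length at most
  \<open>d\<close>.\<close>

lemma has_derivative_quadratic:
  fixes f :: "'a::real_normed_vector \<Rightarrow> 'b::real_normed_vector"
  assumes "bounded_linear D" "d > 0"
    and "\<And>h. norm h \<le> d \<Longrightarrow> norm (f (x + h) - f x - D h) \<le> K * (norm h)\<^sup>2"
  shows "(f has_derivative D) (at x)"
  unfolding has_derivative_at_alt
proof (intro conjI allI impI)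
  fix e :: real assume e: "e > 0"
  let ?d = "min d (e / (\<bar>K\<bar> + 1))"
  have "norm (f y - f x - D (y - x)) \<le> e * norm (y - x)" if "norm (y - x) < ?d" for y
  proof -
    let ?h = "norm (y - x)"
    have h: "?h \<le> d" "?h * (\<bar>K\<bar> + 1) \<le> e"
      using that by (auto simp: pos_less_divide_eq intro: less_imp_le)
    have "norm (f y - f x - D (y - x)) \<le> K * ?h\<^sup>2"
      using assms(3)[OF h(1)] by simp
    also have "\<dots> \<le> (?h * (\<bar>K\<bar> + 1)) * ?h"
      using mult_right_mono[of K "\<bar>K\<bar> + 1" "?h\<^sup>2"] by (simp add: power2_eq_square mult_ac)
    also have "\<dots> \<le> e * ?h" using h(2) by (intro mult_right_mono) auto
    finally show ?thesis .
  qed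
  moreover have "?d > 0" using e assms(2) by auto
  ultimately show "\<exists>d>0. \<forall>y. norm (y - x) < d \<longrightarrow> norm (f y - f x - D (y - x)) \<le> e * norm (y - x)"
    by blast
qed (rule assms(1))

definition conv :: "(real^'n::finite \<Rightarrow> complex) \<Rightarrow> (real^'n \<Rightarrow> complex) \<Rightarrow> real^'n \<Rightarrow> complex"
  where "conv \<theta> \<eta> z = (\<integral>w. \<theta> (z - w) * \<eta> w \<partial>lborel)"

lemma conv_commute:
  fixes \<theta> :: "real^'n::finite \<Rightarrow> complex"
  assumes "\<theta> \<in> borel_measurable borel" "\<eta> \<in> borel_measurable borel"
  shows "conv \<theta> \<eta> = conv \<eta> \<theta>"
proof
  fix z
  have [measurable]: "\<theta> \<in> borel_measurable borel" "\<eta> \<in> borel_measurable borel" by fact+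
  show "conv \<theta> \<eta> z = conv \<eta> \<theta> z"
    unfolding conv_def
    by (subst integral_lborel_affine[where c = "-1" and t = z]) (auto simp: mult.commute)
qed

lemma test_in_measurable: "\<phi> \<in> test_in R \<Longrightarrow> \<phi> \<in> borel_measurable borel"
  by (rule borel_measurable_continuous_onI[OF test_in_continuous])

lemma conv_integrable:
  assumes "\<theta> \<in> test_in R" "\<eta> \<in> test_in S"
  shows "integrable lborel (\<lambda>w. \<theta> (z - w) * \<eta> w)"
  using test_in_integrable_mult[OF assms(2), of "\<lambda>w. \<theta> (z - w)"]
    test_in_continuous_compose[OF assms(1), of UNIV "\<lambda>w. z - w"]
  by (simp add: mult.commute continuous_on_diff)

text \<open>The Taylor remainder of \<open>\<theta>\<close> is quadratic in \<open>h\<close>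
  uniformly in the integration variable, so it can be integrated against
  \<open>norm (\<eta> w)\<close>.\<close>

lemma conv_has_derivative:
  fixes \<theta> :: "real^'n::finite \<Rightarrow> complex"
  assumes \<theta>: "\<theta> \<in> test_in R" and \<eta>: "\<eta> \<in> test_in S"
  shows "(conv \<theta> \<eta> has_derivative (\<lambda>h. \<Sum>j\<in>UNIV. h $ j *\<^sub>R conv (partial_derivative j \<theta>) \<eta> z)) (at z)"
proof -
  obtain A where A: "A \<ge> 0" "deriv_bound 2 A \<theta>" using deriv_bound_ex[OF \<theta>] .
  let ?I = "\<integral>w. norm (\<eta> w) \<partial>lborel" and ?N = "(real CARD('n))\<^sup>2 * A"
  let ?D = "\<lambda>j w. partial_derivative j \<theta> (z - w)"
  note int = conv_integrable[OF \<theta> \<eta>] conv_integrable[OF test_in_partial_derivative[OF \<theta>] \<eta>]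
  show ?thesis
  proof (rule has_derivative_quadratic[where d = 1 and K = "?N * ?I"])
    show "bounded_linear (\<lambda>h. \<Sum>j\<in>UNIV. h $ j *\<^sub>R conv (partial_derivative j \<theta>) \<eta> z)"
      by (intro bounded_linear_sum bounded_linear_scaleR_const bounded_linear_vec_nth)
    fix h :: "real^'n"
    let ?E = "\<lambda>w. \<theta> (z + h - w) - \<theta> (z - w) - (\<Sum>j\<in>UNIV. h $ j *\<^sub>R ?D j w)"
    have eq: "conv \<theta> \<eta> (z + h) - conv \<theta> \<eta> z - (\<Sum>j\<in>UNIV. h $ j *\<^sub>R conv (partial_derivative j \<theta>) \<eta> z)
      = (\<integral>w. ?E w * \<eta> w \<partial>lborel)"
    proof -
      have "(\<integral>w. ?E w * \<eta> w \<partial>lborel) = (\<integral>w. \<theta> (z + h - w) * \<eta> w - \<theta> (z - w) * \<eta> w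
          - (\<Sum>j\<in>UNIV. h $ j *\<^sub>R (?D j w * \<eta> w)) \<partial>lborel)"
        by (simp add: algebra_simps sum_distrib_left)
      also have "\<dots> = (\<integral>w. \<theta> (z + h - w) * \<eta> w \<partial>lborel) - (\<integral>w. \<theta> (z - w) * \<eta> w \<partial>lborel)
          - (\<integral>w. (\<Sum>j\<in>UNIV. h $ j *\<^sub>R (?D j w * \<eta> w)) \<partial>lborel)"
        by (subst Bochner_Integration.integral_diff)
           (auto intro!: int Bochner_Integration.integrable_diff Bochner_Integration.integrable_sum integrable_scaleR_right
             simp: Bochner_Integration.integral_diff[OF int(1) int(1)])
      also have "(\<integral>w. (\<Sum>j\<in>UNIV. h $ j *\<^sub>R (?D j w * \<eta> w)) \<partial>lborel)
          = (\<Sum>j\<in>UNIV. h $ j *\<^sub>R conv (partial_derivative j \<theta>) \<eta> z)"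
        unfolding conv_def
        by (subst Bochner_Integration.integral_sum) (auto intro!: int integrable_scaleR_right)
      finally show ?thesis by (simp add: conv_def)
    qed
    have "norm (\<integral>w. ?E w * \<eta> w \<partial>lborel) \<le> (\<integral>w. (?N * (norm h)\<^sup>2) * norm (\<eta> w) \<partial>lborel)"
    proof (rule norm_integral_le)
      show "integrable lborel (\<lambda>w. (?N * (norm h)\<^sup>2) * norm (\<eta> w))"
        using test_in_integrable[OF \<eta>] by auto
      fix w
      have "norm (?E w) \<le> ?N * (norm h)\<^sup>2"
        using smooth_taylor[OF test_in_smooth[OF \<theta>] A(2), of "z - w" h] by (simp add: algebra_simps)
      then show "norm (?E w * \<eta> w) \<le> (?N * (norm h)\<^sup>2) * norm (\<eta> w)"
        unfolding norm_mult by (rule mult_right_mono) simp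
    qed
    also have "\<dots> = ?N * ?I * (norm h)\<^sup>2" by simp
    finally show "norm (conv \<theta> \<eta> (z + h) - conv \<theta> \<eta> z
      - (\<Sum>j\<in>UNIV. h $ j *\<^sub>R conv (partial_derivative j \<theta>) \<eta> z)) \<le> ?N * ?I * (norm h)\<^sup>2"
      unfolding eq .
  qed simp
qed

lemma partial_derivative_conv:
  assumes "\<theta> \<in> test_in R" "\<eta> \<in> test_in S"
  shows "partial_derivative j (conv \<theta> \<eta>) = conv (partial_derivative j \<theta>) \<eta>"
  using partial_derivative_eqI[OF conv_has_derivative[OF assms], of j] by (auto simp: sum_axis_scaleR)

lemma partial_derivative_conv_right:
  assumes "\<theta> \<in> test_in R" "\<eta> \<in> test_in S"
  shows "partial_derivative j (conv \<theta> \<eta>) = conv \<theta> (partial_derivative j \<eta>)"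
  using partial_derivative_conv[OF assms(2,1), of j]
    conv_commute[OF assms[THEN test_in_measurable]]
    conv_commute[OF assms(1)[THEN test_in_measurable] test_in_partial_derivative[OF assms(2), THEN test_in_measurable]]
  by simp

lemma iterated_partial_conv:
  assumes "\<theta> \<in> test_in R" "\<eta> \<in> test_in S"
  shows "iterated_partial js (conv \<theta> \<eta>) = conv (iterated_partial js \<theta>) \<eta>"
    and "iterated_partial js (conv \<theta> \<eta>) = conv \<theta> (iterated_partial js \<eta>)"
proof -
  show "iterated_partial js (conv \<theta> \<eta>) = conv (iterated_partial js \<theta>) \<eta>"
    by (induction js) (auto simp: partial_derivative_conv[OF test_in_iterated_partial[OF assms(1)] assms(2)])
  show "iterated_partial js (conv \<theta> \<eta>) = conv \<theta> (iterated_partial js \<eta>)"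
    by (induction js) (auto simp: partial_derivative_conv_right[OF assms(1) test_in_iterated_partial[OF assms(2)]])
qed

text \<open>The functions \<open>conv \<alpha> \<eta>\<close> with \<open>\<alpha>\<close> in
  \<open>test_in R\<close> are closed under partial derivatives, which can always be put on
  \<open>\<alpha>\<close>; this is the invariant for \<open>smooth_coinduct\<close>.\<close>

lemma conv_test_in:
  fixes \<theta> :: "real^'n::finite \<Rightarrow> complex"
  assumes "\<theta> \<in> test_in R" "\<eta> \<in> test_in S"
  shows "conv \<theta> \<eta> \<in> test_in (R + S)"
proof -
  have "smooth (conv \<theta> \<eta>)"
  proof (rule smooth_coinduct[where S = "(\<lambda>\<alpha>. conv \<alpha> \<eta>) ` test_in R"])
    fix \<alpha> :: "real^'n \<Rightarrow> complex" and x
    assume "\<alpha> \<in> (\<lambda>\<alpha>. conv \<alpha> \<eta>) ` test_in R"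
    then show "\<alpha> differentiable (at x)"
      using conv_has_derivative[OF _ assms(2)] by (auto simp: differentiable_def)
  qed (auto simp: assms partial_derivative_conv[OF _ assms(2)] test_in_partial_derivative)
  moreover have "conv \<theta> \<eta> z = 0" if "norm z > R + S" for z
  proof -
    have "\<theta> (z - w) * \<eta> w = 0" for w
    proof (cases "norm w > S")
      case False
      then have "norm (z - w) > R" using that norm_triangle_ineq2[of z w] by linarith
      then show ?thesis using test_in_zero[OF assms(1)] by simp
    qed (simp add: test_in_zero[OF assms(2)])
    then have "(\<lambda>w. \<theta> (z - w) * \<eta> w) = (\<lambda>w. 0)" by blast
    then show ?thesis by (simp add: conv_def)
  qed
  ultimately show ?thesis by (auto simp: test_in_def)
qed

text \<open>For \<open>\<theta>\<close> equal to the reflected kernel \<open>\<psi> (- y)\<close>,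
  the value \<open>F (bump x t \<theta>)\<close> is the convolution of \<open>F\<close> with the
  dilate of \<open>\<psi>\<close> at \<open>x\<close>. Viewed as one functional applied to a moving
  bump, other kernels are treated in the same way.\<close>

definition bump :: "real^'n::finite \<Rightarrow> real \<Rightarrow> (real^'n \<Rightarrow> complex) \<Rightarrow> real^'n \<Rightarrow> complex"
  where "bump x t \<phi> z = (1 / t) ^ CARD('n) *\<^sub>R \<phi> ((1 / t) *\<^sub>R (z - x))"

lemma iterated_partial_bump:
  assumes "smooth \<phi>"
  shows "iterated_partial js (bump x t \<phi>) = (\<lambda>z. (1 / t) ^ length js *\<^sub>R bump x t (iterated_partial js \<phi>) z)"
proof -
  have "iterated_partial js (bump x t \<phi>)
      = iterated_partial js (\<lambda>z. complex_of_real ((1 / t) ^ CARD('a)) * \<phi> ((1 / t) *\<^sub>R (z - x)))"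
    by (simp add: bump_def[abs_def] scaleR_conv_of_real)
  also have "\<dots> = (\<lambda>z. complex_of_real ((1 / t) ^ CARD('a)) * ((1 / t) ^ length js *\<^sub>R iterated_partial js \<phi> ((1 / t) *\<^sub>R (z - x))))"
    by (subst iterated_partial_cmult[OF smooth_affine[OF assms]]) (simp only: iterated_partial_affine[OF assms])
  finally show ?thesis by (simp add: bump_def scaleR_conv_of_real mult_ac)
qed

lemma partial_derivative_bump:
  "smooth \<phi> \<Longrightarrow> partial_derivative j (bump x t \<phi>) = (\<lambda>z. (1 / t) *\<^sub>R bump x t (partial_derivative j \<phi>) z)"
  using iterated_partial_bump[of \<phi> "[j]"] by simp

lemma bump_test_in:
  assumes "\<phi> \<in> test_in R" "t > 0"
  shows "bump x t \<phi> \<in> test_in (norm x + t * R)"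
proof -
  have "smooth (\<lambda>z. complex_of_real ((1 / t) ^ CARD('a)) * \<phi> ((1 / t) *\<^sub>R (z - x)) + 0 * \<phi> z)"
    by (intro smooth_lincomb smooth_affine test_in_smooth[OF assms(1)])
  moreover have "bump x t \<phi> z = 0" if "norm z > norm x + t * R" for z
  proof -
    have "norm (z - x) > t * R" using that norm_triangle_ineq2[of z x] by linarith
    then have "norm ((1 / t) *\<^sub>R (z - x)) > R"
      using assms(2) by (simp only: norm_scaleR) (simp add: pos_less_divide_eq mult.commute)
    then show ?thesis using test_in_zero[OF assms(1)] by (simp add: bump_def)
  qed
  ultimately show ?thesis by (simp add: test_in_def bump_def[abs_def] scaleR_conv_of_real)
qed

text \<open>The affine changes of variable compose: probing a rescaled distribution at scale
  \<open>s\<close> is probing the original one at scale \<open>t * s\<close> around a moved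
  centre.\<close>

lemma bump_bump:
  assumes "t \<noteq> 0" shows "bump x t (bump w s \<phi>) = bump (x + t *\<^sub>R w) (t * s) \<phi>"
proof
  fix z
  have "(1 / s) *\<^sub>R ((1 / t) *\<^sub>R (z - x) - w) = (1 / (t * s)) *\<^sub>R (z - (x + t *\<^sub>R w))"
    using assms by (simp add: scaleR_diff_right scaleR_add_right mult.commute)
  then show "bump x t (bump w s \<phi>) z = bump (x + t *\<^sub>R w) (t * s) \<phi> z"
    by (simp only: bump_def) (simp add: power_mult_distrib power_divide)
qed

text \<open>By translation invariance the integral of \<open>\<phi> (x + v) - \<phi> x\<close> is
  zero, so \<open>h\<close> times the wanted integral is minus the integral of a Taylor remainder.
  The remainder is \<open>O(h\<^sup>2)\<close> and, for shifts of length at most 1, vanishes outside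
  the ball of radius \<open>R + 1\<close>; divide by \<open>h\<close> and let it tend to 0.\<close>

lemma integral_partial_derivative:
  fixes \<phi> :: "real^'n::finite \<Rightarrow> complex"
  assumes \<phi>: "\<phi> \<in> test_in R"
  shows "(\<integral>x. partial_derivative j \<phi> x \<partial>lborel) = 0"
proof -
  obtain A where A: "A \<ge> 0" "deriv_bound 2 A \<phi>" using deriv_bound_ex[OF \<phi>] .
  let ?N = "(real CARD('n))\<^sup>2 * A" and ?I = "\<integral>x. partial_derivative j \<phi> x \<partial>lborel"
  let ?V = "measure lborel (cball (0::real^'n) (R + 1))"
  have int: "integrable lborel \<phi>" "integrable lborel (partial_derivative j \<phi>)"
    using \<phi> test_in_partial_derivative test_in_integrable by blast+
  have shift: "integrable lborel (\<lambda>x. \<phi> (x + v)) \<and> (\<integral>x. \<phi> (x + v) \<partial>lborel) = (\<integral>x. \<phi> x \<partial>lborel)" for v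
  proof -
    have "integrable lborel (\<lambda>x. \<phi> (x + v))"
      by (rule integrable_continuous_vanishing[where R = "R + norm v"])
         (auto intro!: test_in_continuous_compose[OF \<phi>] continuous_intros
           test_in_zero[OF \<phi>] simp: less_diff_eq[symmetric] intro: less_le_trans[OF _ norm_diff_ineq])
    then show ?thesis
      using integral_lborel_affine[of \<phi> 1 v] test_in_measurable[OF \<phi>] by (simp add: add.commute)
  qed
  have bd: "norm ?I \<le> \<bar>h\<bar> * (?N * ?V)" if h: "h \<noteq> 0" "\<bar>h\<bar> \<le> 1" for h
  proof -
    let ?v = "h *\<^sub>R axis j (1::real)"
    have nv: "norm ?v = \<bar>h\<bar>" by (simp add: norm_axis_1)
    let ?E = "\<lambda>x. \<phi> (x + ?v) - \<phi> x - h *\<^sub>R partial_derivative j \<phi> x"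
    have "norm (\<integral>x. ?E x \<partial>lborel) \<le> (\<integral>x. ?N * h\<^sup>2 * indicator (cball (0::real^'n) (R + 1)) x \<partial>lborel)"
    proof (rule norm_integral_le)
      show "integrable lborel (\<lambda>x. ?N * h\<^sup>2 * indicator (cball (0::real^'n) (R + 1)) x)"
        by (intro integrable_mult_right integrable_real_indicator emeasure_lborel_cball_finite) auto
      fix x :: "real^'n"
      show "norm (?E x) \<le> ?N * h\<^sup>2 * indicator (cball 0 (R + 1)) x"
      proof (cases "norm x \<le> R + 1")
        case True
        have "(\<Sum>i\<in>UNIV. ?v $ i *\<^sub>R partial_derivative i \<phi> x) = h *\<^sub>R partial_derivative j \<phi> x"
          using sum_axis_scaleR[of j "\<lambda>i. h *\<^sub>R partial_derivative i \<phi> x"] by (simp add: mult.commute)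
        then have "norm (?E x) \<le> ?N * (norm ?v)\<^sup>2"
          using smooth_taylor[OF test_in_smooth[OF \<phi>] A(2), of x ?v] by simp
        then show ?thesis using True nv by simp
      next
        case False
        then have "norm x > R" "norm (x + ?v) > R"
          using h nv norm_diff_ineq[of x ?v] by linarith+
        then show ?thesis
          using test_in_zero[OF \<phi>] test_in_zero[OF test_in_partial_derivative[OF \<phi>]] False by simp
      qed
    qed
    also have "\<dots> = ?N * h\<^sup>2 * ?V" by simp
    also have "(\<integral>x. ?E x \<partial>lborel) = - (h *\<^sub>R ?I)"
      using shift int by simp
    finally have "\<bar>h\<bar> * norm ?I \<le> \<bar>h\<bar> * (\<bar>h\<bar> * (?N * ?V))"
      by (simp add: power2_eq_square mult_ac)
    then show ?thesis using h by (metis mult_le_cancel_left_pos zero_less_abs_iff)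
  qed
  have "norm ?I \<le> 0"
  proof (rule nonpos_if_le_small)
    show "?N * ?V \<ge> 0" using A by simp
    show "norm ?I \<le> (?N * ?V) * h" if "0 < h" "h \<le> 1" for h
      using bd[of h] that by (simp add: mult.commute)
  qed
  then show ?thesis by simp
qed

section \<open>Mollification, its residuals, and the order of partial derivatives\<close>

locale mollifier =
  fixes \<theta> :: "real^'n::finite \<Rightarrow> complex"
  assumes \<theta>_test: "\<theta> \<in> test_in 1" and \<theta>_int: "(\<integral>x. \<theta> x \<partial>lborel) = 1"
begin

text \<open>No sign is assumed of \<open>\<theta>\<close>, so this may exceed 1, and repeated
  residuals accumulate powers of it.\<close>

definition "\<theta>_norm = (\<integral>x. norm (\<theta> x) \<partial>lborel)"

lemma \<theta>_norm_nonneg: "\<theta>_norm \<ge> 0" unfolding \<theta>_norm_def by simp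

lemma \<theta>_integrable: "integrable lborel \<theta>" by (rule test_in_integrable[OF \<theta>_test])

lemma conv_bump:
  assumes "\<eta> \<in> test_in R" "t > 0"
  shows "conv (bump 0 t \<theta>) \<eta> z = (\<integral>v. \<theta> v * \<eta> (z - t *\<^sub>R v) \<partial>lborel)"
proof -
  have [measurable]: "\<theta> \<in> borel_measurable borel" "\<eta> \<in> borel_measurable borel"
    using \<theta>_test assms test_in_measurable by blast+
  have "conv (bump 0 t \<theta>) \<eta> z
      = \<bar>- t\<bar> ^ CARD('n) *\<^sub>R (\<integral>v. bump 0 t \<theta> (z - (z + (- t) *\<^sub>R v)) * \<eta> (z + (- t) *\<^sub>R v) \<partial>lborel)"
    unfolding conv_def by (subst integral_lborel_affine[where c = "-t" and t = z])
      (use assms in \<open>auto simp: bump_def\<close>)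
  also have "\<dots> = (\<integral>v. \<bar>- t\<bar> ^ CARD('n) *\<^sub>R (bump 0 t \<theta> (z - (z + (- t) *\<^sub>R v)) * \<eta> (z + (- t) *\<^sub>R v)) \<partial>lborel)"
    by (rule integral_scaleR_right[symmetric])
  also have "(\<lambda>v. \<bar>- t\<bar> ^ CARD('n) *\<^sub>R (bump 0 t \<theta> (z - (z + (- t) *\<^sub>R v)) * \<eta> (z + (- t) *\<^sub>R v)))
      = (\<lambda>v. \<theta> v * \<eta> (z - t *\<^sub>R v))"
    using assms(2) by (auto simp: bump_def fun_eq_iff power_divide)
  finally show ?thesis .
qed

text \<open>Since \<open>\<theta>\<close> has integral one, \<open>\<eta> z\<close> itself is the
  integral of \<open>\<theta> v * \<eta> z\<close>. The residual is thereby an average of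
  differences of \<open>\<eta>\<close> over shifts of length at most \<open>t\<close>.\<close>

lemma iterated_partial_residual:
  assumes "\<eta> \<in> test_in R" "t > 0"
  shows "iterated_partial js (\<lambda>z. \<eta> z - conv (bump 0 t \<theta>) \<eta> z) z
    = (\<integral>v. \<theta> v * (iterated_partial js \<eta> z - iterated_partial js \<eta> (z - t *\<^sub>R v)) \<partial>lborel)"
proof -
  have b: "bump 0 t \<theta> \<in> test_in t" using bump_test_in[OF \<theta>_test assms(2), of 0] by simp
  let ?\<eta> = "iterated_partial js \<eta>"
  have \<eta>': "?\<eta> \<in> test_in R" by (rule test_in_iterated_partial[OF assms(1)])
  have "iterated_partial js (\<lambda>z. \<eta> z - conv (bump 0 t \<theta>) \<eta> z) z = ?\<eta> z - conv (bump 0 t \<theta>) ?\<eta> z"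
    using iterated_partial_diff[OF test_in_smooth[OF assms(1)] test_in_smooth[OF conv_test_in[OF b assms(1)]], of js]
      iterated_partial_conv(2)[OF b assms(1), of js] by simp
  also have "\<dots> = (\<integral>v. \<theta> v * ?\<eta> z \<partial>lborel) - (\<integral>v. \<theta> v * ?\<eta> (z - t *\<^sub>R v) \<partial>lborel)"
    unfolding conv_bump[OF \<eta>' assms(2)] by (simp add: \<theta>_int)
  also have "\<dots> = (\<integral>v. \<theta> v * ?\<eta> z - \<theta> v * ?\<eta> (z - t *\<^sub>R v) \<partial>lborel)"
    by (rule Bochner_Integration.integral_diff[symmetric])
       (intro test_in_integrable_mult[OF \<theta>_test] test_in_continuous_compose[OF \<eta>'] continuous_intros)+
  finally show ?thesis by (simp add: algebra_simps)
qed

lemma residual_test_in: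
  assumes "\<eta> \<in> test_in R" "t > 0"
  shows "(\<lambda>z. \<eta> z - conv (bump 0 t \<theta>) \<eta> z) \<in> test_in (R + t)"
  using test_in_diff[OF test_in_mono[OF assms(1)] conv_test_in[OF bump_test_in[OF \<theta>_test assms(2), of 0] assms(1)]]
    assms(2) by (simp add: add.commute)

lemma residual_bound_aux:
  assumes "\<eta> \<in> test_in R" "t > 0" and "\<And>v. norm v \<le> 1 \<Longrightarrow> norm (iterated_partial js \<eta> z - iterated_partial js \<eta> (z - t *\<^sub>R v)) \<le> B"
  shows "norm (iterated_partial js (\<lambda>z. \<eta> z - conv (bump 0 t \<theta>) \<eta> z) z) \<le> \<theta>_norm * B"
proof -
  let ?\<eta> = "iterated_partial js \<eta>"
  have "norm (\<integral>v. \<theta> v * (?\<eta> z - ?\<eta> (z - t *\<^sub>R v)) \<partial>lborel) \<le> (\<integral>v. norm (\<theta> v) * B \<partial>lborel)"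
  proof (rule norm_integral_le)
    show "integrable lborel (\<lambda>v. norm (\<theta> v) * B)" using \<theta>_integrable by auto
    fix v
    show "norm (\<theta> v * (?\<eta> z - ?\<eta> (z - t *\<^sub>R v))) \<le> norm (\<theta> v) * B"
      using assms(3)[of v] test_in_zero[OF \<theta>_test, of v]
      by (cases "norm v \<le> 1") (auto simp: norm_mult intro: mult_left_mono)
  qed
  then show ?thesis by (simp add: iterated_partial_residual[OF assms(1,2)] \<theta>_norm_def)
qed

text \<open>No derivative is lost and nothing is gained; this is the start of the induction on the
  decay rate in \<open>residual_decay_aux\<close>.\<close>

lemma residual_bound:
  assumes "\<eta> \<in> test_in R" "t > 0" "deriv_bound m A \<eta>"
  shows "deriv_bound m (\<theta>_norm * (2 * A)) (\<lambda>z. \<eta> z - conv (bump 0 t \<theta>) \<eta> z)"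
  unfolding deriv_bound_def
proof (intro allI impI residual_bound_aux[OF assms(1,2)])
  fix js :: "'n list" and z v :: "real^'n" assume "length js \<le> m"
  then show "norm (iterated_partial js \<eta> z - iterated_partial js \<eta> (z - t *\<^sub>R v)) \<le> 2 * A"
    using norm_triangle_ineq4[of "iterated_partial js \<eta> z" "iterated_partial js \<eta> (z - t *\<^sub>R v)"]
      deriv_boundD[OF assms(3), of js] by (smt (verit))
qed

text \<open>The mean value inequality trades one derivative for a factor \<open>t\<close>, because
  the shifts that occur have length at most \<open>t\<close>.\<close>

lemma residual_gain:
  assumes "\<eta> \<in> test_in R" "t > 0" "deriv_bound (Suc m) A \<eta>"
  shows "deriv_bound m (\<theta>_norm * (real CARD('n) * A * t)) (\<lambda>z. \<eta> z - conv (bump 0 t \<theta>) \<eta> z)"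
  unfolding deriv_bound_def
proof (intro allI impI residual_bound_aux[OF assms(1,2)])
  fix js :: "'n list" and z v :: "real^'n" assume js: "length js \<le> m" and v: "norm v \<le> 1"
  have "deriv_bound 1 A (iterated_partial js \<eta>)"
    using deriv_bound_mono[OF assms(3), of "1 + length js" A] js by (intro deriv_bound_iterated_partial) simp
  then have "norm (iterated_partial js \<eta> z - iterated_partial js \<eta> (z - t *\<^sub>R v)) \<le> real CARD('n) * A * norm (z - (z - t *\<^sub>R v))"
    by (intro smooth_lipschitz smooth_iterated_partial test_in_smooth[OF assms(1)])
  also have "\<dots> \<le> real CARD('n) * A * t"
    using v assms(2) deriv_bound_nonneg[OF assms(3)]
    by (intro mult_left_mono) (auto simp: mult_left_le)
  finally show "norm (iterated_partial js \<eta> z - iterated_partial js \<eta> (z - t *\<^sub>R v)) \<le> real CARD('n) * A * t" .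
qed

text \<open>For a convolution one partial derivative can be moved onto each factor, so the order
  is irrelevant; mollification transfers this to all test functions.\<close>

lemma partial_derivative_commute:
  fixes \<phi> :: "real^'n \<Rightarrow> complex"
  assumes \<phi>: "\<phi> \<in> test_in R"
  shows "partial_derivative i (partial_derivative j \<phi>) = partial_derivative j (partial_derivative i \<phi>)"
proof
  fix z
  \<comment> \<open>Order 3: two derivatives are compared, and \<open>residual_gain\<close> spends a
    third.\<close>
  obtain A where A: "A \<ge> 0" "deriv_bound 3 A \<phi>" using deriv_bound_ex[OF \<phi>] .
  let ?D = "norm (partial_derivative i (partial_derivative j \<phi>) z - partial_derivative j (partial_derivative i \<phi>) z)"
  let ?M = "2 * \<theta>_norm * (real CARD('n) * A)"
  have bd: "?D \<le> ?M * t" if t: "t > 0" for t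
  proof -
    let ?c = "conv (bump 0 t \<theta>) \<phi>" and ?r = "\<lambda>z. \<phi> z - conv (bump 0 t \<theta>) \<phi> z"
    have b: "bump 0 t \<theta> \<in> test_in t" using bump_test_in[OF \<theta>_test t, of 0] by simp
    have sm: "smooth ?c" by (rule test_in_smooth[OF conv_test_in[OF b \<phi>]])
    have r: "norm (iterated_partial js ?r z) \<le> \<theta>_norm * (real CARD('n) * A * t)" if "length js \<le> 2" for js
      using residual_gain[OF \<phi> t, of 2 A] A that by (auto simp: deriv_bound_def numeral_3_eq_3)
    have r': "iterated_partial js ?r z = iterated_partial js \<phi> z - iterated_partial js ?c z" for js
      by (subst iterated_partial_diff[OF test_in_smooth[OF \<phi>] sm]) simp
    have c: "iterated_partial [i, j] ?c = iterated_partial [j, i] ?c"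
      using partial_derivative_conv[OF b \<phi>] partial_derivative_conv_right[OF b \<phi>]
        partial_derivative_conv[OF b test_in_partial_derivative[OF \<phi>]]
        partial_derivative_conv_right[OF test_in_partial_derivative[OF b] \<phi>] by simp
    have "iterated_partial [i, j] \<phi> z - iterated_partial [j, i] \<phi> z = iterated_partial [i, j] ?r z - iterated_partial [j, i] ?r z"
      unfolding r' c by simp
    then have "?D = norm (iterated_partial [i, j] ?r z - iterated_partial [j, i] ?r z)" by simp
    also have "\<dots> \<le> ?M * t"
      using norm_triangle_ineq4[of "iterated_partial [i, j] ?r z" "iterated_partial [j, i] ?r z"]
        r[of "[i, j]"] r[of "[j, i]"] by simp
    finally show ?thesis .
  qed
  have "?D \<le> 0"
    by (rule nonpos_if_le_small[where M = ?M]) (use A \<theta>_norm_nonneg bd in auto)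
  then show "partial_derivative i (partial_derivative j \<phi>) z = partial_derivative j (partial_derivative i \<phi>) z" by simp
qed

lemma iterated_partial_commute:
  fixes \<phi> :: "real^'n \<Rightarrow> complex"
  assumes "\<phi> \<in> test_in R"
  shows "iterated_partial js (partial_derivative j \<phi>) = partial_derivative j (iterated_partial js \<phi>)"
proof (induction js)
  case (Cons i js)
  then show ?case using partial_derivative_commute[OF test_in_iterated_partial[OF assms]] by simp
qed simp

end

section \<open>Distributions\<close>

text \<open>Continuity on test functions supported in a fixed ball; \<open>C\<close> and
  \<open>k\<close> may depend on the radius \<open>R\<close>. The estimates are proved for this
  class because it contains the tempered distributions and is preserved by
  \<open>distr_deriv\<close> and by composition with \<open>bump x t\<close>.\<close>

definition distribution :: "'n::finite functional \<Rightarrow> bool"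
  where "distribution G \<longleftrightarrow>
    (\<forall>\<phi>\<in>test_functions. \<forall>\<eta>\<in>test_functions. \<forall>a b. G (\<lambda>x. a * \<phi> x + b * \<eta> x) = a * G \<phi> + b * G \<eta>) \<and>
    (\<forall>R. \<exists>C\<ge>0. \<exists>k. \<forall>\<phi>\<in>test_in R. \<forall>A. deriv_bound k A \<phi> \<longrightarrow> norm (G \<phi>) \<le> C * A)"

lemma distribution_lincomb:
  assumes "distribution G" "\<phi> \<in> test_in R" "\<eta> \<in> test_in S"
  shows "G (\<lambda>x. a * \<phi> x + b * \<eta> x) = a * G \<phi> + b * G \<eta>"
  using assms by (auto simp: distribution_def dest!: test_in_test_functions)

lemma distribution_cmult:
  "distribution G \<Longrightarrow> \<phi> \<in> test_in R \<Longrightarrow> G (\<lambda>x. a * \<phi> x) = a * G \<phi>"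
  using distribution_lincomb[of G \<phi> R \<phi> R a 0] by simp

lemma distribution_diff:
  "distribution G \<Longrightarrow> \<phi> \<in> test_in R \<Longrightarrow> \<eta> \<in> test_in S \<Longrightarrow> G (\<lambda>x. \<phi> x - \<eta> x) = G \<phi> - G \<eta>"
  using distribution_lincomb[of G \<phi> R \<eta> S 1 "-1"] by simp

lemma distribution_add:
  "distribution G \<Longrightarrow> \<phi> \<in> test_in R \<Longrightarrow> \<eta> \<in> test_in S \<Longrightarrow> G (\<lambda>x. \<phi> x + \<eta> x) = G \<phi> + G \<eta>"
  using distribution_lincomb[of G \<phi> R \<eta> S 1 1] by simp

lemma distribution_bound:
  assumes "distribution G"
  obtains C k where "C \<ge> 0" "\<And>\<phi> A. \<phi> \<in> test_in R \<Longrightarrow> deriv_bound k A \<phi> \<Longrightarrow> norm (G \<phi>) \<le> C * A"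
  using assms unfolding distribution_def by meson

lemma test_in_zero_function: "(\<lambda>x::real^'n::finite. 0) \<in> test_in R"
  using test_in_sum[of "{}" "undefined :: nat \<Rightarrow> real^'n \<Rightarrow> complex" R] by simp

lemma distribution_sum:
  assumes G: "distribution G" and "finite A" "\<And>i. i \<in> A \<Longrightarrow> \<phi> i \<in> test_in R"
  shows "G (\<lambda>x. \<Sum>i\<in>A. c i * \<phi> i x) = (\<Sum>i\<in>A. c i * G (\<phi> i))"
  using assms(2,3)
proof (induction A)
  case empty
  show ?case using distribution_cmult[OF G test_in_zero_function, of 0] by simp
next
  case (insert a A)
  have "(\<lambda>x. \<Sum>i\<in>A. c i * \<phi> i x) \<in> test_in R"
    using test_in_sum[of A "\<lambda>i x. c i * \<phi> i x" R] insert by (auto intro: test_in_cmult)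
  then show ?case
    using distribution_add[OF G test_in_cmult[of "\<phi> a" R "c a"]] distribution_cmult[OF G, of "\<phi> a" R] insert
    by simp
qed

lemma distribution_distr_deriv:
  assumes G: "distribution G" shows "distribution (distr_deriv j G)"
  unfolding distribution_def
proof (intro conjI ballI allI)
  fix \<phi> \<eta> :: "real^'a \<Rightarrow> complex" and a b
  assume "\<phi> \<in> test_functions" "\<eta> \<in> test_functions"
  then obtain R S where t: "\<phi> \<in> test_in R" "\<eta> \<in> test_in S" by (meson test_functions_test_in)
  have "partial_derivative j (\<lambda>x. a * \<phi> x + b * \<eta> x)
      = (\<lambda>x. a * partial_derivative j \<phi> x + b * partial_derivative j \<eta> x)"
    using iterated_partial_lincomb[OF t[THEN test_in_smooth], of "[j]" a b] by simp
  then show "distr_deriv j G (\<lambda>x. a * \<phi> x + b * \<eta> x) = a * distr_deriv j G \<phi> + b * distr_deriv j G \<eta>"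
    using distribution_lincomb[OF G t[THEN test_in_partial_derivative], of a j b j]
    by (simp add: distr_deriv_def)
next
  fix R
  obtain C k where C: "C \<ge> 0" "\<And>\<phi> A. \<phi> \<in> test_in R \<Longrightarrow> deriv_bound k A \<phi> \<Longrightarrow> norm (G \<phi>) \<le> C * A"
    using distribution_bound[OF G, of R] by metis
  have "norm (distr_deriv j G \<phi>) \<le> C * A" if "\<phi> \<in> test_in R" "deriv_bound (Suc k) A \<phi>" for \<phi> A
    using C(2)[OF test_in_partial_derivative[OF that(1)], of A j]
      deriv_bound_iterated_partial[of k "[j]" A \<phi>] that(2) by (simp add: distr_deriv_def)
  then show "\<exists>C\<ge>0. \<exists>k. \<forall>\<phi>\<in>test_in R. \<forall>A. deriv_bound k A \<phi> \<longrightarrow> norm (distr_deriv j G \<phi>) \<le> C * A"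
    using C(1) by blast
qed

lemma deriv_bound_bump:
  fixes \<phi> :: "real^'n::finite \<Rightarrow> complex"
  assumes "smooth \<phi>" "deriv_bound k A \<phi>" "t > 0"
  shows "deriv_bound k ((1 / t) ^ CARD('n) * (1 / t + 1) ^ k * A) (bump x t \<phi>)"
  unfolding deriv_bound_def
proof (intro allI impI)
  fix js :: "'n list" and z assume js: "length js \<le> k"
  have A: "A \<ge> 0" by (rule deriv_bound_nonneg[OF assms(2)])
  have "(1 / t) ^ length js \<le> (1 / t + 1) ^ length js" using assms(3) by (intro power_mono) auto
  also have "\<dots> \<le> (1 / t + 1) ^ k" using js assms(3) by (intro power_increasing) auto
  finally have p: "(1 / t) ^ length js \<le> (1 / t + 1) ^ k" .
  have "norm (iterated_partial js (bump x t \<phi>) z)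
      = (1 / t) ^ length js * ((1 / t) ^ CARD('n) * norm (iterated_partial js \<phi> ((1 / t) *\<^sub>R (z - x))))"
    using assms(3) by (simp add: iterated_partial_bump[OF assms(1)] bump_def)
  also have "\<dots> \<le> (1 / t + 1) ^ k * ((1 / t) ^ CARD('n) * A)"
    using p A assms(3) deriv_boundD[OF assms(2) js] by (intro mult_mono) auto
  finally show "norm (iterated_partial js (bump x t \<phi>) z) \<le> (1 / t) ^ CARD('n) * (1 / t + 1) ^ k * A"
    by (simp add: mult_ac)
qed

lemma bump_lincomb: "bump x t (\<lambda>y. a * \<phi> y + b * \<eta> y) = (\<lambda>z. a * bump x t \<phi> z + b * bump x t \<eta> z)"
  by (auto simp: bump_def scaleR_conv_of_real algebra_simps)

text \<open>This stability reduces an estimate at centre \<open>x\<close> and scale \<open>t\<close>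
  to one at unit scale. The derivatives of a bump grow by powers of \<open>1 / t\<close>, which
  changes only the constant when \<open>t\<close> is fixed.\<close>

lemma distribution_bump:
  fixes G :: "'n::finite functional"
  assumes G: "distribution G" and t: "t > 0"
  shows "distribution (\<lambda>\<phi>. G (bump x t \<phi>))"
  unfolding distribution_def
proof (intro conjI ballI allI)
  fix \<phi> \<eta> :: "real^'n \<Rightarrow> complex" and a b
  assume "\<phi> \<in> test_functions" "\<eta> \<in> test_functions"
  then obtain R S where *: "\<phi> \<in> test_in R" "\<eta> \<in> test_in S" by (meson test_functions_test_in)
  show "G (bump x t (\<lambda>x. a * \<phi> x + b * \<eta> x)) = a * G (bump x t \<phi>) + b * G (bump x t \<eta>)"
    unfolding bump_lincomb by (rule distribution_lincomb[OF G *[THEN bump_test_in[OF _ t]]])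
next
  fix R
  obtain C k where C: "C \<ge> 0"
      "\<And>\<phi> A. \<phi> \<in> test_in (norm x + t * R) \<Longrightarrow> deriv_bound k A \<phi> \<Longrightarrow> norm (G \<phi>) \<le> C * A"
    using distribution_bound[OF G, of "norm x + t * R"] by metis
  have "norm (G (bump x t \<phi>)) \<le> C * ((1 / t) ^ CARD('n) * (1 / t + 1) ^ k) * A"
    if "\<phi> \<in> test_in R" "deriv_bound k A \<phi>" for \<phi> A
    using C(2)[OF bump_test_in[OF that(1) t] deriv_bound_bump[OF test_in_smooth[OF that(1)] that(2) t]]
    by (simp add: mult_ac)
  moreover have "C * ((1 / t) ^ CARD('n) * (1 / t + 1) ^ k) \<ge> 0" using C(1) t by simp
  ultimately show "\<exists>C\<ge>0. \<exists>k. \<forall>\<phi>\<in>test_in R. \<forall>A. deriv_bound k A \<phi> \<longrightarrow> norm (G (bump x t \<phi>)) \<le> C * A"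
    by blast
qed

lemma iterated_partial_translate:
  "smooth \<phi> \<Longrightarrow> iterated_partial js (\<lambda>z. \<phi> (z - h)) = (\<lambda>z. iterated_partial js \<phi> (z - h))"
  using iterated_partial_affine[of \<phi> js 1 h] by simp

lemma test_in_translate:
  assumes "\<phi> \<in> test_in R" "norm h \<le> d" shows "(\<lambda>z. \<phi> (z - h)) \<in> test_in (R + d)"
proof -
  have "\<phi> (z - h) = 0" if "norm z > R + d" for z
    using that assms(2) norm_triangle_ineq2[of z h] by (intro test_in_zero[OF assms(1)]) linarith
  then show ?thesis using smooth_affine[OF test_in_smooth[OF assms(1)], of 1 h] by (simp add: test_in_def)
qed

context mollifier
begin

text \<open>A distribution is controlled by finitely many derivatives of the test function, and for
  each of them Taylor's formula holds with a quadratic error. So under \<open>G\<close> the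
  increment of the moving bump may be replaced by its linear part.\<close>

lemma distribution_translate_derivative:
  fixes G :: "'n functional"
  assumes G: "distribution G" and \<phi>: "\<phi> \<in> test_in R" and t: "t > 0"
  shows "((\<lambda>x. G (bump x t \<phi>)) has_derivative
    (\<lambda>h. \<Sum>j\<in>UNIV. h $ j *\<^sub>R distr_deriv j G (bump x t \<phi>))) (at x)"
proof -
  let ?\<beta> = "bump x t \<phi>"
  let ?S = "norm x + t * R"
  have \<beta>: "?\<beta> \<in> test_in ?S" by (rule bump_test_in[OF \<phi> t])
  have \<beta>': "?\<beta> \<in> test_in (?S + 1)" by (rule test_in_mono[OF \<beta>]) simp
  obtain C k where C: "C \<ge> 0"
      "\<And>\<phi> A. \<phi> \<in> test_in (?S + 1) \<Longrightarrow> deriv_bound k A \<phi> \<Longrightarrow> norm (G \<phi>) \<le> C * A"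
    using distribution_bound[OF G, of "?S + 1"] by metis
  obtain A where A: "A \<ge> 0" "deriv_bound (2 + k) A ?\<beta>" using deriv_bound_ex[OF \<beta>] .
  show ?thesis
  proof (rule has_derivative_quadratic[where d = 1 and K = "C * ((real CARD('n))\<^sup>2 * A)"])
    show "bounded_linear (\<lambda>h. \<Sum>j\<in>UNIV. h $ j *\<^sub>R distr_deriv j G (bump x t \<phi>))"
      by (intro bounded_linear_sum bounded_linear_scaleR_const bounded_linear_vec_nth)
    fix h :: "real^'n" assume h: "norm h \<le> 1"
    let ?T = "\<lambda>z. ?\<beta> (z - h)"
    let ?P = "\<lambda>z. \<Sum>j\<in>UNIV. complex_of_real (h $ j) * partial_derivative j ?\<beta> z"
    \<comment> \<open>The linear term has a plus sign because moving the centre by \<open>h\<close>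
      shifts the argument by \<open>- h\<close>. The minus sign in \<open>distr_deriv\<close>
      accounts for the same effect.\<close>
    let ?E = "\<lambda>z. (?T z - ?\<beta> z) + ?P z"
    have T: "?T \<in> test_in (?S + 1)" by (rule test_in_translate[OF \<beta> h])
    have pd: "partial_derivative j ?\<beta> \<in> test_in (?S + 1)" for j by (rule test_in_partial_derivative[OF \<beta>'])
    have P: "?P \<in> test_in (?S + 1)"
      "\<And>js. iterated_partial js ?P = (\<lambda>z. \<Sum>j\<in>UNIV. complex_of_real (h $ j) * iterated_partial js (partial_derivative j ?\<beta>) z)"
      using test_in_sum[of UNIV "\<lambda>j z. complex_of_real (h $ j) * partial_derivative j ?\<beta> z" "?S + 1"]
        test_in_cmult[OF pd] by (auto simp: iterated_partial_cmult[OF test_in_smooth[OF pd]])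
    have TB: "(\<lambda>z. ?T z - ?\<beta> z) \<in> test_in (?S + 1)" by (rule test_in_diff[OF T \<beta>'])
    have E: "?E \<in> test_in (?S + 1)" using test_in_lincomb[OF TB P(1), of 1 1] by simp
    have "deriv_bound k ((real CARD('n))\<^sup>2 * A * (norm h)\<^sup>2) ?E"
      unfolding deriv_bound_def
    proof (intro allI impI)
      fix js :: "'n list" and z assume js: "length js \<le> k"
      let ?\<alpha> = "iterated_partial js ?\<beta>"
      \<comment> \<open>Bringing \<open>partial_derivative j\<close> to the front uses that partial
        derivatives commute on test functions.\<close>
      have "iterated_partial js ?E z = ?\<alpha> (z - h) - ?\<alpha> z + (\<Sum>j\<in>UNIV. complex_of_real (h $ j) * partial_derivative j ?\<alpha> z)"
        using iterated_partial_lincomb[OF test_in_smooth[OF TB] test_in_smooth[OF P(1)], of js 1 1]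
          iterated_partial_diff[OF test_in_smooth[OF T] test_in_smooth[OF \<beta>], of js]
          iterated_partial_translate[OF test_in_smooth[OF \<beta>], of js h]
        by (simp add: P(2) iterated_partial_commute[OF \<beta>])
      also have "\<dots> = ?\<alpha> (z + (- h)) - ?\<alpha> z - (\<Sum>j\<in>UNIV. (- h) $ j *\<^sub>R partial_derivative j ?\<alpha> z)"
        by (simp add: scaleR_conv_of_real sum_negf)
      also have "norm \<dots> \<le> (real CARD('n))\<^sup>2 * A * (norm (- h))\<^sup>2"
        using deriv_bound_mono[OF A(2), of "2 + length js" A] js
        by (intro smooth_taylor smooth_iterated_partial test_in_smooth[OF \<beta>] deriv_bound_iterated_partial) auto
      finally show "norm (iterated_partial js ?E z) \<le> (real CARD('n))\<^sup>2 * A * (norm h)\<^sup>2" by simp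
    qed
    from C(2)[OF E this]
    have "norm (G ?E) \<le> C * ((real CARD('n))\<^sup>2 * A) * (norm h)\<^sup>2" by (simp add: mult_ac)
    also have "G ?E = G ?T - G ?\<beta> + G ?P"
      by (simp add: distribution_add[OF G TB P(1)] distribution_diff[OF G T \<beta>'])
    also have "G ?P = - (\<Sum>j\<in>UNIV. h $ j *\<^sub>R distr_deriv j G ?\<beta>)"
      using distribution_sum[OF G _ pd, of UNIV "\<lambda>j. complex_of_real (h $ j)"]
      by (simp add: distr_deriv_def scaleR_conv_of_real sum_negf)
    also have "?T = bump (x + h) t \<phi>"
      by (simp add: bump_def fun_eq_iff algebra_simps)
    finally show "norm (G (bump (x + h) t \<phi>) - G (bump x t \<phi>) - (\<Sum>j\<in>UNIV. h $ j *\<^sub>R distr_deriv j G (bump x t \<phi>)))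
        \<le> C * ((real CARD('n))\<^sup>2 * A) * (norm h)\<^sup>2" by simp
  qed simp
qed

lemma distribution_bump_continuous:
  fixes G :: "'n functional"
  assumes "distribution G" "\<phi> \<in> test_in R" "t > 0"
  shows "continuous_on S (\<lambda>x. G (bump x t \<phi>))"
  using distribution_translate_derivative[OF assms]
  by (meson continuous_at_imp_continuous_on has_derivative_continuous)

end

section \<open>The derivative in the scale\<close>

definition euler :: "nat \<Rightarrow> (real^'n::finite \<Rightarrow> complex) \<Rightarrow> real^'n \<Rightarrow> complex"
  where "euler N \<alpha> y = - (of_nat N * \<alpha> y + (\<Sum>j\<in>UNIV. y $ j *\<^sub>R partial_derivative j \<alpha> y))"

lemma euler_test_in:
  assumes "\<alpha> \<in> test_in R" shows "euler N \<alpha> \<in> test_in R"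
proof -
  have "(\<lambda>y. \<Sum>j\<in>UNIV. y $ j *\<^sub>R partial_derivative j \<alpha> y) \<in> test_in R"
    using test_in_sum[of UNIV "\<lambda>j y. y $ j *\<^sub>R partial_derivative j \<alpha> y" R]
      test_in_coordinate_mult[OF test_in_partial_derivative[OF assms]] by auto
  from test_in_lincomb[OF assms this, of "- of_nat N" "-1"]
  show ?thesis by (simp add: euler_def[abs_def])
qed

text \<open>For \<open>N\<close> equal to the dimension the operator is minus a divergence. This is
  why the scale derivative of \<open>G (bump x t \<phi>)\<close> involves only first derivatives of
  \<open>G\<close>, and why they are tested with the kernels
  \<open>y $ j *\<^sub>R \<phi> y\<close>.\<close>

lemma euler_CARD:
  fixes \<phi> :: "real^'n::finite \<Rightarrow> complex"
  assumes "smooth \<phi>"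
  shows "euler CARD('n) \<phi> = (\<lambda>y. - (\<Sum>j\<in>UNIV. partial_derivative j (\<lambda>y. y $ j *\<^sub>R \<phi> y) y))"
  by (auto simp: euler_def partial_derivative_coordinate_mult(2)[OF assms] sum.distrib)

text \<open>The operator \<open>euler N\<close> is what appears when a dilation path with prefactor
  of degree \<open>N\<close> is differentiated in the scale. The degree rises by one, so a second
  derivative brings in \<open>euler (Suc N)\<close>.\<close>

lemma euler_path:
  fixes \<alpha> :: "real^'n::finite \<Rightarrow> complex"
  assumes "smooth \<alpha>" "t > 0"
  shows "((\<lambda>t. (1 / t) ^ N *\<^sub>R \<alpha> ((1 / t) *\<^sub>R v)) has_vector_derivative
    ((1 / t) ^ Suc N *\<^sub>R euler N \<alpha> ((1 / t) *\<^sub>R v))) (at t)"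
proof -
  have d1: "((\<lambda>t. 1 / t) has_derivative (\<lambda>h. - h * (1 / t)\<^sup>2)) (at t)"
    using assms(2) by (auto intro!: derivative_eq_intros simp: power2_eq_square field_simps)
  have d2: "((\<lambda>t. \<alpha> ((1 / t) *\<^sub>R v)) has_derivative
      (\<lambda>h. \<Sum>j\<in>UNIV. ((- h * (1 / t)\<^sup>2) *\<^sub>R v) $ j *\<^sub>R partial_derivative j \<alpha> ((1 / t) *\<^sub>R v))) (at t)"
    by (rule has_derivative_compose[OF has_derivative_scaleR_left[OF d1] smooth_has_derivative[OF assms(1)]])
  have d3: "((\<lambda>t. (1 / t) ^ N) has_derivative (\<lambda>h. - h * (real N * (1 / t) ^ Suc N))) (at t)"
  proof (cases N)
    case (Suc M)
    show ?thesis unfolding Suc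
      by (rule has_derivative_eq_rhs[OF has_derivative_power[OF d1, of "Suc M"]])
         (auto simp: fun_eq_iff power2_eq_square algebra_simps add_divide_distrib diff_divide_distrib)
  qed simp
  have "((\<lambda>t. (1 / t) ^ N *\<^sub>R \<alpha> ((1 / t) *\<^sub>R v)) has_derivative
    (\<lambda>h. (1 / t) ^ N *\<^sub>R (\<Sum>j\<in>UNIV. ((- h * (1 / t)\<^sup>2) *\<^sub>R v) $ j *\<^sub>R partial_derivative j \<alpha> ((1 / t) *\<^sub>R v))
      + (- h * (real N * (1 / t) ^ Suc N)) *\<^sub>R \<alpha> ((1 / t) *\<^sub>R v))) (at t)"
    by (rule has_derivative_scaleR[OF d3 d2])
  then show ?thesis
    unfolding has_vector_derivative_def
  proof (rule has_derivative_eq_rhs, intro ext)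
    fix h
    have "(\<Sum>j\<in>UNIV. ((- h * (1 / t)\<^sup>2) *\<^sub>R v) $ j *\<^sub>R partial_derivative j \<alpha> ((1 / t) *\<^sub>R v))
      = - (h * (1 / t)) *\<^sub>R (\<Sum>j\<in>UNIV. ((1 / t) *\<^sub>R v) $ j *\<^sub>R partial_derivative j \<alpha> ((1 / t) *\<^sub>R v))"
      by (simp add: scaleR_sum_right power2_eq_square mult_ac sum_negf)
    then show "(1 / t) ^ N *\<^sub>R (\<Sum>j\<in>UNIV. ((- h * (1 / t)\<^sup>2) *\<^sub>R v) $ j *\<^sub>R partial_derivative j \<alpha> ((1 / t) *\<^sub>R v))
      + (- h * (real N * (1 / t) ^ Suc N)) *\<^sub>R \<alpha> ((1 / t) *\<^sub>R v)
      = h *\<^sub>R ((1 / t) ^ Suc N *\<^sub>R euler N \<alpha> ((1 / t) *\<^sub>R v))"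
      by (simp only:) (simp add: euler_def scaleR_conv_of_real algebra_simps)
  qed
qed

text \<open>Two applications of the mean value inequality, first to \<open>f'\<close> and then to
  \<open>f\<close> minus its linear part; the segment form covers \<open>s < t\<close> as
  well.\<close>

lemma taylor_real:
  fixes f :: "real \<Rightarrow> 'b::real_normed_vector"
  assumes "\<And>x. x \<in> closed_segment t s \<Longrightarrow> (f has_vector_derivative f' x) (at x)"
    and "\<And>x. x \<in> closed_segment t s \<Longrightarrow> (f' has_vector_derivative f'' x) (at x)"
    and "\<And>x. x \<in> closed_segment t s \<Longrightarrow> norm (f'' x) \<le> K"
  shows "norm (f s - f t - (s - t) *\<^sub>R f' t) \<le> K * (s - t)\<^sup>2"
proof -
  let ?S = "closed_segment t s"
  have on: "onorm (\<lambda>h::real. h *\<^sub>R v) \<le> norm v" for v :: 'b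
    by (rule onorm_le) (simp add: mult.commute)
  have K: "K \<ge> 0" using assms(3)[of t] norm_ge_zero order_trans by blast
  have 1: "norm (f' x - f' t) \<le> K * norm (x - t)" if "x \<in> ?S" for x
  proof (rule differentiable_bound[of ?S f' "\<lambda>x h. h *\<^sub>R f'' x"])
    fix y assume y: "y \<in> ?S"
    show "(f' has_derivative (\<lambda>h. h *\<^sub>R f'' y)) (at y within ?S)"
      using assms(2)[OF y] by (auto simp: has_vector_derivative_def intro: has_derivative_at_withinI)
    show "onorm (\<lambda>h. h *\<^sub>R f'' y) \<le> K" by (rule order_trans[OF on assms(3)[OF y]])
  qed (use that in auto)
  let ?g = "\<lambda>x. f x - (x - t) *\<^sub>R f' t"
  have "norm (?g s - ?g t) \<le> (K * norm (s - t)) * norm (s - t)"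
  proof (rule differentiable_bound[of ?S ?g "\<lambda>x h. h *\<^sub>R (f' x - f' t)"])
    fix x assume x: "x \<in> ?S"
    have "(?g has_derivative (\<lambda>h. h *\<^sub>R f' x - (h - 0) *\<^sub>R f' t)) (at x within ?S)"
      using has_derivative_at_withinI[OF assms(1)[OF x, unfolded has_vector_derivative_def], of ?S]
      by (intro has_derivative_diff has_derivative_scaleR_left has_derivative_ident has_derivative_const)
    then show "(?g has_derivative (\<lambda>h. h *\<^sub>R (f' x - f' t))) (at x within ?S)"
      by (simp add: scaleR_diff_right)
    have "norm (x - t) \<le> norm (s - t)" using segment_bound[OF x] by (simp add: norm_minus_commute)
    then show "onorm (\<lambda>h. h *\<^sub>R (f' x - f' t)) \<le> K * norm (s - t)"
      using order_trans[OF order_trans[OF on 1[OF x]] mult_left_mono[OF _ K]] by blast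
  qed auto
  moreover have "?g s - ?g t = f s - f t - (s - t) *\<^sub>R f' t" by simp
  ultimately show ?thesis by (simp only:) (simp add: power2_eq_square abs_mult_self_eq mult.assoc)
qed

context mollifier
begin

text \<open>Each derivative commutes with the sum in \<open>euler\<close> up to one extra copy of
  itself, which raises the degree \<open>N\<close> by one. This matches the extra factor
  \<open>1 / t\<close> that each derivative of a bump carries.\<close>

lemma iterated_partial_euler:
  fixes \<phi> :: "real^'n \<Rightarrow> complex"
  assumes "\<phi> \<in> test_in R"
  shows "iterated_partial js (euler N \<phi>) = euler (N + length js) (iterated_partial js \<phi>)"
proof (induction js)
  case (Cons j js)
  let ?\<alpha> = "iterated_partial js \<phi>" and ?M = "N + length js"
  have \<alpha>: "?\<alpha> \<in> test_in R" by (rule test_in_iterated_partial[OF assms])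
  have pd: "partial_derivative i ?\<alpha> \<in> test_in R" for i by (rule test_in_partial_derivative[OF \<alpha>])
  let ?P = "\<lambda>y. \<Sum>i\<in>UNIV. y $ i *\<^sub>R partial_derivative i ?\<alpha> y"
  have P: "?P \<in> test_in R"
     "partial_derivative j ?P = (\<lambda>y. \<Sum>i\<in>UNIV. partial_derivative j (\<lambda>y. y $ i *\<^sub>R partial_derivative i ?\<alpha> y) y)"
    using test_in_sum[of UNIV "\<lambda>i y. y $ i *\<^sub>R partial_derivative i ?\<alpha> y" R]
      test_in_coordinate_mult[OF pd] by (auto dest: spec[of _ "[j]"])
  have "partial_derivative j (euler ?M ?\<alpha>) y = euler (Suc ?M) (partial_derivative j ?\<alpha>) y" for y
  proof -
    have "partial_derivative j (euler ?M ?\<alpha>) y = - of_nat ?M * partial_derivative j ?\<alpha> y - partial_derivative j ?P y"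
    proof -
      have "euler ?M ?\<alpha> = (\<lambda>y. - of_nat ?M * ?\<alpha> y + -1 * ?P y)"
        by (simp add: euler_def fun_eq_iff algebra_simps)
      then show ?thesis
        using iterated_partial_lincomb[OF test_in_smooth[OF \<alpha>] test_in_smooth[OF P(1)], of "[j]" "- of_nat ?M" "-1"]
        by (simp only: iterated_partial.simps) simp
    qed
    also have "partial_derivative j ?P y = (\<Sum>i\<in>UNIV. y $ i *\<^sub>R partial_derivative i (partial_derivative j ?\<alpha>) y)
        + partial_derivative j ?\<alpha> y"
      unfolding P(2) by (simp add: partial_derivative_coordinate_mult(2)[OF test_in_smooth[OF pd]] sum.distrib
        partial_derivative_commute[OF \<alpha>, of j])
    finally show ?thesis by (rule trans) (simp add: euler_def algebra_simps)
  qed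
  then show ?case by (simp add: Cons.IH fun_eq_iff)
qed simp

text \<open>For every multi-index up to the order of \<open>G\<close>, the derivatives of the bump
  as functions of the scale satisfy a second-order Taylor estimate that is uniform in
  \<open>z\<close>; applying \<open>G\<close> leaves a quadratic remainder.\<close>

lemma distribution_dilate_derivative:
  fixes G :: "'n functional"
  assumes G: "distribution G" and \<phi>0: "\<phi> \<in> test_in R0" and t: "t > 0"
  shows "((\<lambda>t. G (bump x t \<phi>)) has_vector_derivative
    (\<Sum>j\<in>UNIV. distr_deriv j G (bump x t (\<lambda>y. y $ j *\<^sub>R \<phi> y)))) (at t)"
proof -
  define R where "R = max R0 0"
  have \<phi>: "\<phi> \<in> test_in R" and R: "R \<ge> 0" using test_in_mono[OF \<phi>0, of R] by (auto simp: R_def)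
  let ?S = "norm x + 2 * t * R" and ?n = "CARD('n)"
  let ?\<beta> = "bump x t (euler ?n \<phi>)"
  have bt: "bump x s \<alpha> \<in> test_in ?S" if "\<alpha> \<in> test_in R" "0 < s" "s \<le> 2 * t" for s \<alpha>
    using test_in_mono[OF bump_test_in[OF that(1,2), of x], of ?S] mult_right_mono[OF that(3) R] by simp
  have eu: "euler ?n \<phi> \<in> test_in R" by (rule euler_test_in[OF \<phi>])
  obtain C k where C: "C \<ge> 0"
      "\<And>\<phi> A. \<phi> \<in> test_in ?S \<Longrightarrow> deriv_bound k A \<phi> \<Longrightarrow> norm (G \<phi>) \<le> C * A"
    using distribution_bound[OF G, of ?S] by metis
  have "\<exists>B\<ge>0. \<forall>y. norm (euler (Suc (?n + length js)) (euler (?n + length js) (iterated_partial js \<phi>)) y) \<le> B" for js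
    using test_in_bounded[OF euler_test_in[OF euler_test_in[OF test_in_iterated_partial[OF \<phi>]]]] by metis
  then obtain B where B: "\<And>js. B js \<ge> 0"
    "\<And>js y. norm (euler (Suc (?n + length js)) (euler (?n + length js) (iterated_partial js \<phi>)) y) \<le> B js" by metis
  let ?J = "{js :: 'n list. length js \<le> k}"
  have fin: "finite ?J" using finite_lists_length_le[of "UNIV :: 'n set" k] by simp
  let ?K = "\<lambda>js. (2 / t) ^ Suc (Suc (?n + length js)) * B js"
  have K0: "?K js \<ge> 0" for js using t B(1) by simp
  define K where "K = sum ?K ?J"
  have K: "?K js \<le> K" if "length js \<le> k" for js
    unfolding K_def using that fin K0 by (intro member_le_sum) auto
  show ?thesis
    unfolding has_vector_derivative_def
  \<comment> \<open>For \<open>\<bar>h\<bar> \<le> t / 2\<close> the scales between \<open>t\<close>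
    and \<open>t + h\<close> are at least \<open>t / 2\<close>, so
    \<open>1 / \<tau> \<le> 2 / t\<close>; this is the origin of the powers in
    \<open>?K\<close>.\<close>
  proof (rule has_derivative_quadratic[where d = "t / 2" and K = "C * K"])
    show "bounded_linear (\<lambda>h. h *\<^sub>R (\<Sum>j\<in>UNIV. distr_deriv j G (bump x t (\<lambda>y. y $ j *\<^sub>R \<phi> y))))"
      by (rule bounded_linear_scaleR_left)
    show "t / 2 > 0" using t by simp
    fix h :: real assume h: "norm h \<le> t / 2"
    let ?s = "t + h"
    have s: "0 < ?s" "?s \<le> 2 * t" using h t by auto
    let ?E = "\<lambda>z. (bump x ?s \<phi> z - bump x t \<phi> z) - complex_of_real (h * (1 / t)) * ?\<beta> z"
    have b1: "bump x ?s \<phi> \<in> test_in ?S" and b2: "bump x t \<phi> \<in> test_in ?S" and b3: "?\<beta> \<in> test_in ?S"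
      using t s by (auto intro!: bt \<phi> eu)
    note b4 = test_in_cmult[OF b3, of "complex_of_real (h * (1 / t))"]
    note b5 = test_in_diff[OF b1 b2]
    have E: "?E \<in> test_in ?S" by (rule test_in_diff[OF b5 b4])
    have "deriv_bound k (K * h\<^sup>2) ?E"
      unfolding deriv_bound_def
    proof (intro allI impI)
      fix js :: "'n list" and z assume js: "length js \<le> k"
      let ?\<alpha> = "iterated_partial js \<phi>" and ?N = "?n + length js"
      have \<alpha>: "?\<alpha> \<in> test_in R" by (rule test_in_iterated_partial[OF \<phi>])
      let ?f = "\<lambda>\<tau>. (1 / \<tau>) ^ ?N *\<^sub>R ?\<alpha> ((1 / \<tau>) *\<^sub>R (z - x))"
      let ?f' = "\<lambda>\<tau>. (1 / \<tau>) ^ Suc ?N *\<^sub>R euler ?N ?\<alpha> ((1 / \<tau>) *\<^sub>R (z - x))"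
      let ?f'' = "\<lambda>\<tau>. (1 / \<tau>) ^ Suc (Suc ?N) *\<^sub>R euler (Suc ?N) (euler ?N ?\<alpha>) ((1 / \<tau>) *\<^sub>R (z - x))"
      have ip: "iterated_partial js (bump x \<tau> \<phi>) z = ?f \<tau>" for \<tau>
        by (simp add: iterated_partial_bump[OF test_in_smooth[OF \<phi>]] bump_def power_add mult.commute)
      have "iterated_partial js ?E z = (?f ?s - ?f t) - complex_of_real (h * (1 / t)) * iterated_partial js ?\<beta> z"
        by (simp only: iterated_partial_diff[OF test_in_smooth[OF b5] test_in_smooth[OF b4]]
          iterated_partial_diff[OF test_in_smooth[OF b1] test_in_smooth[OF b2]]
          iterated_partial_cmult[OF test_in_smooth[OF b3]] ip)
      also have "complex_of_real (h * (1 / t)) * iterated_partial js ?\<beta> z = (?s - t) *\<^sub>R ?f' t"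
        by (simp add: iterated_partial_bump[OF test_in_smooth[OF eu]] iterated_partial_euler[OF \<phi>] bump_def
            scaleR_conv_of_real power_add mult_ac)
      finally have eq: "iterated_partial js ?E z = ?f ?s - ?f t - (?s - t) *\<^sub>R ?f' t" .
      have "norm (?f ?s - ?f t - (?s - t) *\<^sub>R ?f' t) \<le> ?K js * (?s - t)\<^sup>2"
      proof (rule taylor_real[where f'' = ?f''])
        fix \<tau> assume "\<tau> \<in> closed_segment t ?s"
        then have \<tau>: "\<tau> \<ge> t / 2" "\<tau> > 0" using h t by (auto simp: closed_segment_eq_real_ivl split: if_splits)
        show "(?f has_vector_derivative ?f' \<tau>) (at \<tau>)" "(?f' has_vector_derivative ?f'' \<tau>) (at \<tau>)"
          by (intro euler_path test_in_smooth[OF \<alpha>] test_in_smooth[OF euler_test_in[OF \<alpha>]] \<tau>)+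
        have "(1 / \<tau>) ^ Suc (Suc ?N) \<le> (2 / t) ^ Suc (Suc ?N)"
          using \<tau> t by (intro power_mono) (auto simp: field_simps)
        then show "norm (?f'' \<tau>) \<le> ?K js"
          using \<tau> t B unfolding norm_scaleR by (intro mult_mono) auto
      qed
      also have "\<dots> \<le> K * h\<^sup>2" using mult_right_mono[OF K[OF js], of "h\<^sup>2"] by simp
      finally show "norm (iterated_partial js ?E z) \<le> K * h\<^sup>2" unfolding eq .
    qed
    from C(2)[OF E this] have "norm (G ?E) \<le> C * K * h\<^sup>2" by (simp add: mult.assoc)
    also have "G ?E = G (bump x ?s \<phi>) - G (bump x t \<phi>) - h *\<^sub>R (complex_of_real (1 / t) * G ?\<beta>)"
      by (simp only: distribution_diff[OF G b5 b4] distribution_diff[OF G b1 b2] distribution_cmult[OF G b3])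
         (simp add: scaleR_conv_of_real)
    also have "complex_of_real (1 / t) * G ?\<beta> = (\<Sum>j\<in>UNIV. distr_deriv j G (bump x t (\<lambda>y. y $ j *\<^sub>R \<phi> y)))"
    proof -
      let ?y = "\<lambda>j y. y $ j *\<^sub>R \<phi> y"
      have y: "?y j \<in> test_in R" for j by (rule test_in_coordinate_mult[OF \<phi>])
      have "(\<lambda>z. complex_of_real (1 / t) * ?\<beta> z) = (\<lambda>z. \<Sum>j\<in>UNIV. - 1 * partial_derivative j (bump x t (?y j)) z)"
        by (simp only: euler_CARD[OF test_in_smooth[OF \<phi>]] partial_derivative_bump[OF test_in_smooth[OF y]]
            bump_def fun_eq_iff) (simp add: scaleR_conv_of_real sum_distrib_left sum_negf)
      moreover have "partial_derivative j (bump x t (?y j)) \<in> test_in ?S" for j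
        using t by (intro test_in_partial_derivative bt y) auto
      ultimately have "G (\<lambda>z. complex_of_real (1 / t) * ?\<beta> z) = (\<Sum>j\<in>UNIV. - 1 * G (partial_derivative j (bump x t (?y j))))"
        using distribution_sum[OF G, of UNIV "\<lambda>j. partial_derivative j (bump x t (?y j))" ?S "\<lambda>_. -1"] by simp
      then show ?thesis
        using distribution_cmult[OF G b3, of "complex_of_real (1 / t)"] by (simp add: distr_deriv_def)
    qed
    finally show "norm (G (bump x (t + h) \<phi>) - G (bump x t \<phi>) - h *\<^sub>R (\<Sum>j\<in>UNIV. distr_deriv j G (bump x t (\<lambda>y. y $ j *\<^sub>R \<phi> y))))
        \<le> C * K * (norm h)\<^sup>2" by simp
  qed
qed

end

section \<open>A reproducing formula\<close>

text \<open>On each cell the error is the integral of \<open>g t - g w\<close>, at most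
  \<open>e\<close> times the volume; the volumes add up to that of the box.\<close>

lemma riemann_sum_error:
  fixes g :: "'a::euclidean_space \<Rightarrow> 'b::banach"
  assumes g: "(g has_integral I) (cbox a b)" and D: "D tagged_division_of cbox a b" and e: "e \<ge> 0"
    and le: "\<And>t K w. (t, K) \<in> D \<Longrightarrow> w \<in> K \<Longrightarrow> norm (g t - g w) \<le> e"
  shows "norm ((\<Sum>(t, K)\<in>D. measure lborel K *\<^sub>R g t) - I) \<le> e * measure lborel (cbox a b)"
proof -
  have gi: "g integrable_on cbox a b" using g by blast
  have "I = integral (cbox a b) g" using g by (simp add: integral_unique)
  also have "\<dots> = (\<Sum>(t, K)\<in>D. integral K g)" by (rule integral_combine_tagged_division_topdown[OF gi D])
  finally have "(\<Sum>(t, K)\<in>D. measure lborel K *\<^sub>R g t) - I = (\<Sum>(t, K)\<in>D. measure lborel K *\<^sub>R g t - integral K g)"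
    by (simp add: sum_subtractf case_prod_unfold)
  also have "norm \<dots> \<le> (\<Sum>(t, K)\<in>D. e * measure lborel K)"
    unfolding case_prod_unfold
  proof (rule sum_norm_le)
    fix p assume p: "p \<in> D"
    obtain t K where tK: "p = (t, K)" by (cases p)
    obtain c d where K: "K = cbox c d" "K \<subseteq> cbox a b"
      using tagged_division_ofD(3,4)[OF D, of t K] p tK by blast
    have "g integrable_on K" using gi K integrable_on_subcbox by blast
    then have "((\<lambda>w. g t - g w) has_integral (measure lborel K *\<^sub>R g t - integral K g)) K"
      unfolding K(1) by (intro has_integral_diff has_integral_const) auto
    then show "norm (measure lborel (snd p) *\<^sub>R g (fst p) - integral (snd p) g) \<le> e * measure lborel (snd p)"
      using has_integral_bound[OF e, of "\<lambda>w. g t - g w" _ c d] le[of t K] p tK K(1) by auto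
  qed
  also have "\<dots> = e * measure lborel (cbox a b)"
    using additive_content_tagged_division[OF D] by (simp add: case_prod_unfold flip: sum_distrib_left)
  finally show ?thesis .
qed

lemma has_integral_continuous_vanishing:
  fixes f :: "'a::euclidean_space \<Rightarrow> complex"
  assumes "continuous_on UNIV f" "\<And>x. norm x > R \<Longrightarrow> f x = 0" "cball 0 R \<subseteq> cbox a b"
  shows "(f has_integral (\<integral>x. f x \<partial>lborel)) (cbox a b)"
proof -
  have "(f has_integral (\<integral>x. f x \<partial>lborel)) UNIV"
    by (rule has_integral_integral_lborel[OF integrable_continuous_vanishing[OF assms(1,2)]])
  moreover have "f x = 0" if "x \<notin> cbox a b" for x
    using assms(2)[of x] assms(3) that by (force simp: subset_iff not_le)
  then have "f = (\<lambda>x. if x \<in> cbox a b then f x else 0)" by auto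
  ultimately show ?thesis by (metis has_integral_restrict_UNIV)
qed

context mollifier
begin

text \<open>Riemann sums of the convolution integral are finite combinations of translates of
  \<open>\<alpha>\<close>, through which \<open>G\<close> passes by linearity. They converge to
  \<open>conv \<alpha> \<eta>\<close> together with all derivatives up to the order of
  \<open>G\<close>, while their images under \<open>G\<close> are Riemann sums of the integral on
  the right.\<close>

lemma distribution_conv:
  fixes G :: "'n functional"
  assumes G: "distribution G" and \<alpha>: "\<alpha> \<in> test_in R" and \<eta>0: "\<eta> \<in> test_in S0"
  shows "G (conv \<alpha> \<eta>) = (\<integral>w. \<eta> w * G (bump w 1 \<alpha>) \<partial>lborel)"
proof -
  define S where "S = max S0 0"
  have \<eta>: "\<eta> \<in> test_in S" and S: "S \<ge> 0" using test_in_mono[OF \<eta>0, of S] by (auto simp: S_def)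
  obtain a where a: "cball 0 S \<subseteq> cbox (- a) (a :: real^'n)"
    using bounded_subset_cbox_symmetric[OF bounded_cball] by blast
  let ?X = "cbox (- a) a"
  obtain M0 where M0: "\<And>w. w \<in> ?X \<Longrightarrow> norm w \<le> M0"
    using bounded_cbox[of "- a" a] unfolding bounded_iff by blast
  \<comment> \<open>One support radius \<open>R + M\<close> has to serve both the translates of
    \<open>\<alpha>\<close> over the box and \<open>conv \<alpha> \<eta>\<close>.\<close>
  define M where "M = max M0 S"
  have M: "\<And>w. w \<in> ?X \<Longrightarrow> norm w \<le> M" "S \<le> M" using M0 by (auto simp: M_def le_max_iff_disj)
  obtain C k where C: "C \<ge> 0"
      "\<And>\<phi> A. \<phi> \<in> test_in (R + M) \<Longrightarrow> deriv_bound k A \<phi> \<Longrightarrow> norm (G \<phi>) \<le> C * A"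
    using distribution_bound[OF G, of "R + M"] by metis
  obtain A where A: "A \<ge> 0" "deriv_bound (1 + k) A \<alpha>" using deriv_bound_ex[OF \<alpha>] .
  obtain B where B: "B \<ge> 0" "deriv_bound 1 B \<eta>" using deriv_bound_ex[OF \<eta>] .
  \<comment> \<open>A Lipschitz constant in \<open>w\<close> of
    \<open>\<eta> w * \<alpha> (z - w)\<close>, also with derivatives of \<open>\<alpha>\<close> in
    place of \<open>\<alpha>\<close>. It does not depend on \<open>z\<close>, so one mesh width
    serves all points and all derivatives up to order \<open>k\<close>.\<close>
  let ?Q = "2 * real CARD('n) * A * B"
  let ?V = "measure lborel ?X"
  define F where "F w = \<eta> w * G (bump w 1 \<alpha>)" for w
  have Fc: "continuous_on T F" for T
    unfolding F_def by (intro continuous_intros test_in_continuous[OF \<eta>] distribution_bump_continuous[OF G \<alpha>]) simp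
  have FI: "(F has_integral (\<integral>w. F w \<partial>lborel)) ?X"
    by (rule has_integral_continuous_vanishing[OF Fc _ a]) (simp add: F_def test_in_zero[OF \<eta>])
  have tr: "(\<lambda>z. \<alpha> (z - w)) \<in> test_in (R + M)" if "w \<in> ?X" for w
    by (rule test_in_translate[OF \<alpha> M(1)[OF that]])
  have cv: "conv \<alpha> \<eta> \<in> test_in (R + M)" by (rule test_in_mono[OF conv_test_in[OF \<alpha> \<eta>]]) (use M in simp)
  have main: "norm (G (conv \<alpha> \<eta>) - (\<integral>w. F w \<partial>lborel)) \<le> (C + 1) * ?V * e" if e: "e > 0" for e
  proof -
    have "uniformly_continuous_on ?X F" by (rule compact_uniformly_continuous[OF Fc compact_cbox])
    then obtain d1 where d1: "d1 > 0" "\<And>w w'. w \<in> ?X \<Longrightarrow> w' \<in> ?X \<Longrightarrow> dist w' w < d1 \<Longrightarrow> dist (F w') (F w) < e"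
      using e unfolding uniformly_continuous_on_def by metis
    define d where "d = min d1 (e / (?Q + 1))"
    have Q: "?Q \<ge> 0" using A B by simp
    have d: "d > 0" "?Q * d \<le> e"
    proof -
      have "?Q + 1 > 0" using Q by linarith
      then show "d > 0" using d1 e by (simp add: d_def)
      have "?Q * d \<le> (?Q + 1) * (e / (?Q + 1))" using Q e by (intro mult_mono) (use \<open>d > 0\<close> in \<open>auto simp: d_def\<close>)
      also have "\<dots> = e" using Q by (simp add: add_nonneg_eq_0_iff)
      finally show "?Q * d \<le> e" .
    qed
    obtain D where D: "D tagged_division_of ?X" "(\<lambda>x. ball x d) fine D"
      using fine_division_exists[OF gauge_ball[OF d(1)]] by blast
    have finD: "finite D" using D(1) by (rule tagged_division_of_finite)
    have tX: "t \<in> ?X" and KX: "K \<subseteq> ?X" and near: "w \<in> K \<Longrightarrow> norm (t - w) < d" if "(t, K) \<in> D" for t K w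
      using tagged_division_ofD(2,3)[OF D(1) that] D(2) that unfolding fine_def
      by (auto simp: dist_norm subset_iff)
    let ?c = "\<lambda>p. complex_of_real (measure lborel (snd p)) * \<eta> (fst p)"
    let ?t = "\<lambda>p z. \<alpha> (z - fst p)"
    let ?P = "\<lambda>z. \<Sum>p\<in>D. ?c p * ?t p z"
    have t: "?t p \<in> test_in (R + M)" if "p \<in> D" for p using tr tX[of "fst p" "snd p"] that by simp
    have P: "?P \<in> test_in (R + M)"
      "\<And>js. iterated_partial js ?P = (\<lambda>z. \<Sum>p\<in>D. ?c p * iterated_partial js \<alpha> (z - fst p))"
      using test_in_sum[OF finD, of "\<lambda>p z. ?c p * ?t p z" "R + M"] test_in_cmult[OF t]
      by (auto simp: iterated_partial_cmult[OF test_in_smooth[OF t]] iterated_partial_translate[OF test_in_smooth[OF \<alpha>]])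
    have "deriv_bound k (e * ?V) (\<lambda>z. ?P z - conv \<alpha> \<eta> z)"
      unfolding deriv_bound_def
    proof (intro allI impI)
      fix js :: "'n list" and z assume js: "length js \<le> k"
      let ?\<alpha> = "iterated_partial js \<alpha>"
      let ?g = "\<lambda>w. \<eta> w * ?\<alpha> (z - w)"
      have \<alpha>': "?\<alpha> \<in> test_in R" by (rule test_in_iterated_partial[OF \<alpha>])
      have b1: "deriv_bound 1 A ?\<alpha>" using deriv_bound_mono[OF A(2), of "1 + length js" A] js
        by (intro deriv_bound_iterated_partial) auto
      have "continuous_on UNIV (\<lambda>w. ?\<alpha> (z - w))"
        by (intro test_in_continuous_compose[OF \<alpha>'] continuous_intros)
      then have "(?g has_integral (\<integral>w. ?g w \<partial>lborel)) ?X"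
        by (intro has_integral_continuous_vanishing[OF _ _ a] continuous_intros test_in_continuous[OF \<eta>])
           (simp_all add: test_in_zero[OF \<eta>])
      moreover have "(\<integral>w. ?g w \<partial>lborel) = iterated_partial js (conv \<alpha> \<eta>) z"
        by (simp add: iterated_partial_conv(1)[OF \<alpha> \<eta>] conv_def mult.commute)
      ultimately have gI: "(?g has_integral iterated_partial js (conv \<alpha> \<eta>) z) ?X" by simp
      have "norm ((\<Sum>(t, K)\<in>D. measure lborel K *\<^sub>R ?g t) - iterated_partial js (conv \<alpha> \<eta>) z) \<le> e * ?V"
      proof (rule riemann_sum_error[OF gI D(1)])
        fix t K w assume tK: "(t, K) \<in> D" "w \<in> K"
        have n: "norm (t - w) \<le> d" using near[OF tK] by simp
        have "?g t - ?g w = \<eta> t * (?\<alpha> (z - t) - ?\<alpha> (z - w)) + (\<eta> t - \<eta> w) * ?\<alpha> (z - w)"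
          by (simp add: algebra_simps)
        also have "norm \<dots> \<le> norm (\<eta> t) * norm (?\<alpha> (z - t) - ?\<alpha> (z - w)) + norm (\<eta> t - \<eta> w) * norm (?\<alpha> (z - w))"
          by (metis norm_mult norm_triangle_ineq)
        also have "\<dots> \<le> B * (real CARD('n) * A * norm (t - w)) + (real CARD('n) * B * norm (t - w)) * A"
          using smooth_lipschitz[OF test_in_smooth[OF \<alpha>'] b1, of "z - t" "z - w"]
            smooth_lipschitz[OF test_in_smooth[OF \<eta>] B(2), of t w]
            deriv_bound_norm[OF B(2)] deriv_bound_norm[OF b1] A B
          by (intro add_mono mult_mono) (auto simp: norm_minus_commute)
        also have "\<dots> = ?Q * norm (t - w)" by (simp add: algebra_simps)
        also have "\<dots> \<le> e" using mult_left_mono[OF n Q] d(2) by linarith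
        finally show "norm (?g t - ?g w) \<le> e" .
      qed (use e in simp)
      also have "(\<Sum>(t, K)\<in>D. measure lborel K *\<^sub>R ?g t) = iterated_partial js ?P z"
        unfolding P(2) by (simp add: case_prod_unfold scaleR_conv_of_real mult_ac)
      also have "iterated_partial js ?P z - iterated_partial js (conv \<alpha> \<eta>) z
          = iterated_partial js (\<lambda>z. ?P z - conv \<alpha> \<eta> z) z"
        by (simp only: iterated_partial_diff[OF test_in_smooth[OF P(1)] test_in_smooth[OF cv]])
      finally show "norm (iterated_partial js (\<lambda>z. ?P z - conv \<alpha> \<eta> z) z) \<le> e * ?V" .
    qed
    from C(2)[OF test_in_diff[OF P(1) cv] this]
    have 1: "norm (G ?P - G (conv \<alpha> \<eta>)) \<le> C * (e * ?V)"
      by (simp only: distribution_diff[OF G P(1) cv])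
    have GP: "G ?P = (\<Sum>(t, K)\<in>D. measure lborel K *\<^sub>R F t)"
      using distribution_sum[OF G finD t, where c = ?c]
      by (simp add: F_def bump_def[abs_def] case_prod_unfold scaleR_conv_of_real mult.assoc)
    have 2: "norm (G ?P - (\<integral>w. F w \<partial>lborel)) \<le> e * ?V"
      unfolding GP
    proof (rule riemann_sum_error[OF FI D(1)])
      fix t K w assume tK: "(t, K) \<in> D" "w \<in> K"
      have "norm (t - w) < d1" using near[OF tK] by (simp add: d_def)
      then show "norm (F t - F w) \<le> e"
        using d1(2)[of w t] tX[OF tK(1)] KX[OF tK(1)] tK(2) by (auto simp: dist_norm subset_iff intro: less_imp_le)
    qed (use e in simp)
    have "norm (G (conv \<alpha> \<eta>) - (\<integral>w. F w \<partial>lborel))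
      \<le> norm (G ?P - G (conv \<alpha> \<eta>)) + norm (G ?P - (\<integral>w. F w \<partial>lborel))"
      using norm_triangle_ineq4[of "G ?P - (\<integral>w. F w \<partial>lborel)" "G ?P - G (conv \<alpha> \<eta>)"] by simp
    also have "\<dots> \<le> (C + 1) * ?V * e" using 1 2 by (simp add: algebra_simps)
    finally show ?thesis .
  qed
  have "norm (G (conv \<alpha> \<eta>) - (\<integral>w. F w \<partial>lborel)) \<le> 0"
    by (rule nonpos_if_le_small[where M = "(C + 1) * ?V"]) (use C main in auto)
  then show ?thesis by (simp add: F_def)
qed

text \<open>Repeatedly subtracting mollifications at the scales \<open>2\<^sup>-\<^sup>1, 2\<^sup>-\<^sup>2, \<dots>\<close> leaves remainders that
  decay faster than any power of the scale: each step costs one derivative and gains one factor.\<close>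

primrec residual :: "(real^'n \<Rightarrow> complex) \<Rightarrow> nat \<Rightarrow> real^'n \<Rightarrow> complex" where
  "residual \<phi> 0 = \<phi>"
| "residual \<phi> (Suc l) = (\<lambda>z. residual \<phi> l z - conv (bump 0 ((1/2) ^ Suc l) \<theta>) (residual \<phi> l) z)"

text \<open>The radius grows by the scales \<open>(1/2) ^ Suc l\<close>, whose partial sums are
  \<open>1 - (1/2) ^ l\<close>; hence the uniform radius \<open>R + 1\<close> used
  afterwards.\<close>

lemma residual_in: "\<phi> \<in> test_in R \<Longrightarrow> residual \<phi> l \<in> test_in (R + 1 - (1/2) ^ l)"
proof (induction l)
  case (Suc l)
  show ?case using residual_test_in[OF Suc.IH[OF Suc.prems], of "(1/2) ^ Suc l"] by (simp add: algebra_simps)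
qed simp

lemma residual_in': "\<phi> \<in> test_in R \<Longrightarrow> residual \<phi> l \<in> test_in (R + 1)"
  by (rule test_in_mono[OF residual_in]) auto

lemma residual_telescope:
  "\<phi> z = (\<Sum>l<m. conv (bump 0 ((1/2) ^ Suc l) \<theta>) (residual \<phi> l) z) + residual \<phi> m z"
  by (induction m) auto

text \<open>Induction on the decay rate \<open>L\<close> with \<open>m\<close> free, since raising
  the rate by one uses one derivative more. The factor \<open>2 * \<theta>_norm + 1\<close> per
  level is the crude cost of \<open>residual_bound\<close>; \<open>residual_decay\<close> removes
  it.\<close>

lemma residual_decay_aux:
  assumes "\<phi> \<in> test_in R"
  shows "\<exists>A\<ge>0. \<forall>l. deriv_bound m (A * (2 * \<theta>_norm + 1) ^ l * (1/2) ^ (l * L)) (residual \<phi> l)"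
proof (induction L arbitrary: m)
  case 0
  obtain A where A: "A \<ge> 0" "deriv_bound m A \<phi>" using deriv_bound_ex[OF assms] .
  have "deriv_bound m (A * (2 * \<theta>_norm + 1) ^ l) (residual \<phi> l)" for l
  proof (induction l)
    case (Suc l)
    have "\<theta>_norm * (2 * (A * (2 * \<theta>_norm + 1) ^ l)) \<le> A * (2 * \<theta>_norm + 1) ^ Suc l"
      using A(1) \<theta>_norm_nonneg by (simp add: algebra_simps)
    with residual_bound[OF residual_in[OF assms] _ Suc, of "(1/2) ^ Suc l"]
    show ?case using deriv_bound_mono by fastforce
  qed (use A in simp)
  then show ?case using A(1) by auto
next
  case (Suc L)
  let ?\<kappa> = "2 * \<theta>_norm + 1"
  obtain A where A: "A \<ge> 0" "\<And>l. deriv_bound (Suc m) (A * ?\<kappa> ^ l * (1/2) ^ (l * L)) (residual \<phi> l)"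
    using Suc.IH by blast
  obtain A0 where A0: "A0 \<ge> 0" "deriv_bound m A0 \<phi>" using deriv_bound_ex[OF assms] .
  \<comment> \<open>\<open>A0\<close> serves level 0, where no step has been made;
    \<open>2 ^ L\<close> compensates for estimating level \<open>l\<close> by means of level
    \<open>l - 1\<close>.\<close>
  let ?A = "A0 + \<theta>_norm * real CARD('n) * A * 2 ^ L"
  have "deriv_bound m (?A * ?\<kappa> ^ l * (1/2) ^ (l * Suc L)) (residual \<phi> l)" for l
  proof (cases l)
    case 0
    then show ?thesis using deriv_bound_mono[OF A0(2), of m ?A] A(1) \<theta>_norm_nonneg by simp
  next
    case (Suc k)
    let ?B = "\<theta>_norm * (real CARD('n) * (A * ?\<kappa> ^ k * (1/2) ^ (k * L)) * (1/2) ^ Suc k)"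
    have "deriv_bound m ?B (residual \<phi> (Suc k))"
      unfolding residual.simps(2) by (rule residual_gain[OF residual_in[OF assms] _ A(2)]) simp
    moreover have "?B \<le> ?A * ?\<kappa> ^ l * (1/2) ^ (l * Suc L)"
    proof -
      have p: "(1/2) ^ (k * L) * (1/2) ^ Suc k = 2 ^ L * (1/2::real) ^ (l * Suc L)"
        unfolding Suc by (simp add: power_add power_mult_distrib field_simps)
      have "?B = (\<theta>_norm * real CARD('n) * A) * ?\<kappa> ^ k * ((1/2) ^ (k * L) * (1/2) ^ Suc k)" by simp
      also have "\<dots> = (\<theta>_norm * real CARD('n) * A * 2 ^ L) * ?\<kappa> ^ k * (1/2) ^ (l * Suc L)"
        unfolding p by simp
      also have "\<dots> \<le> ?A * ?\<kappa> ^ l * (1/2) ^ (l * Suc L)"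
        using A(1) A0(1) \<theta>_norm_nonneg Suc
        by (intro mult_right_mono mult_mono power_increasing) auto
      finally show ?thesis .
    qed
    ultimately show ?thesis using Suc deriv_bound_mono by blast
  qed
  moreover have "?A \<ge> 0" using A(1) A0(1) \<theta>_norm_nonneg by simp
  ultimately show ?case by blast
qed

text \<open>Asking for \<open>j\<close> additional powers of the scale, with \<open>2 ^ j\<close>
  above the growth factor per level, absorbs that factor.\<close>

lemma residual_decay:
  assumes "\<phi> \<in> test_in R"
  shows "\<exists>A\<ge>0. \<forall>l. deriv_bound m (A * (1/2) ^ (l * L)) (residual \<phi> l)"
proof -
  let ?\<kappa> = "2 * \<theta>_norm + 1"
  obtain j where j: "?\<kappa> < 2 ^ j" using real_arch_pow[of 2 ?\<kappa>] by auto
  obtain A where A: "A \<ge> 0" "\<And>l. deriv_bound m (A * ?\<kappa> ^ l * (1/2) ^ (l * (L + j))) (residual \<phi> l)"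
    using residual_decay_aux[OF assms] by blast
  have "A * ?\<kappa> ^ l * (1/2) ^ (l * (L + j)) \<le> A * (1/2) ^ (l * L)" for l
  proof -
    have "?\<kappa> ^ l \<le> (2 ^ j) ^ l" using j \<theta>_norm_nonneg by (intro power_mono) auto
    then have "?\<kappa> ^ l * (1/2) ^ (l * j) \<le> (2 ^ j) ^ l * (1/2) ^ (l * j)" by (intro mult_right_mono) auto
    also have "\<dots> = 1" by (simp add: power_mult[symmetric] mult.commute[of l j] power_mult_distrib[symmetric])
    finally have "(?\<kappa> ^ l * (1/2) ^ (l * j)) * (A * (1/2) ^ (l * L)) \<le> 1 * (A * (1/2) ^ (l * L))"
      by (rule mult_right_mono) (use A(1) in simp)
    then show ?thesis by (simp add: power_add algebra_simps)
  qed
  then show ?thesis using A deriv_bound_mono[OF A(2) order_refl] by blast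
qed

text \<open>By telescoping and \<open>distribution_conv\<close>, \<open>G \<phi>\<close> is a sum of
  integrals of residuals against \<open>G (bump w s \<theta>)\<close>. Decay of order
  \<open>Suc L\<close> beats the permitted growth \<open>2 ^ (l * L)\<close> and leaves a geometric
  series of sum 2. The constant is chosen before \<open>G\<close>.\<close>

lemma reproducing_bound:
  assumes \<phi>: "\<phi> \<in> test_in R"
  shows "\<exists>A\<ge>0. \<forall>(G :: 'n functional) M. distribution G \<longrightarrow>
    (\<forall>l. (\<integral>w. indicator (cball 0 (R + 1)) w * norm (G (bump w ((1/2) ^ Suc l) \<theta>)) \<partial>lborel) \<le> M * 2 ^ (l * L))
    \<longrightarrow> norm (G \<phi>) \<le> A * M"
proof -
  obtain A where A: "A \<ge> 0" "\<And>l. deriv_bound 0 (A * (1/2) ^ (l * Suc L)) (residual \<phi> l)"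
    using residual_decay[OF \<phi>] by blast
  have "norm (G \<phi>) \<le> 2 * A * M" if G: "distribution G"
    and J: "\<And>l. (\<integral>w. indicator (cball 0 (R + 1)) w * norm (G (bump w ((1/2) ^ Suc l) \<theta>)) \<partial>lborel) \<le> M * 2 ^ (l * L)"
    for G :: "'n functional" and M
  proof -
    let ?s = "\<lambda>l. (1/2::real) ^ Suc l" and ?X = "cball (0::real^'n) (R + 1)"
    let ?J = "\<lambda>l. \<integral>w. indicator ?X w * norm (G (bump w (?s l) \<theta>)) \<partial>lborel"
    have "0 \<le> ?J 0" by (rule integral_nonneg_AE) auto
    also have "\<dots> \<le> M" using J[of 0] by simp
    finally have M: "M \<ge> 0" .
    have b: "bump 0 (?s l) \<theta> \<in> test_in (?s l)" for l using bump_test_in[OF \<theta>_test, of "?s l" 0] by simp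
    have b1: "bump 0 (?s l) \<theta> \<in> test_in 1" for l by (rule test_in_mono[OF b]) (use power_le_one[of "1/2::real" "Suc l"] in simp)
    have cv: "conv (bump 0 (?s l) \<theta>) (residual \<phi> l) \<in> test_in (1 + (R + 1))" for l
      by (rule conv_test_in[OF b1 residual_in'[OF \<phi>]])
    have le: "norm (G (conv (bump 0 (?s l) \<theta>) (residual \<phi> l))) \<le> A * M * (1/2) ^ l" for l
    proof -
      have "G (conv (bump 0 (?s l) \<theta>) (residual \<phi> l)) = (\<integral>w. residual \<phi> l w * G (bump w (?s l) \<theta>) \<partial>lborel)"
        using distribution_conv[OF G b1 residual_in'[OF \<phi>]] by (simp add: bump_bump)
      also have "norm \<dots> \<le> (\<integral>w. (A * (1/2) ^ (l * Suc L)) * (indicator ?X w * norm (G (bump w (?s l) \<theta>))) \<partial>lborel)"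
      proof (rule norm_integral_le)
        have "continuous_on ?X (\<lambda>w. norm (G (bump w (?s l) \<theta>)))"
          by (intro continuous_intros distribution_bump_continuous[OF G \<theta>_test]) simp
        from borel_integrable_compact[OF compact_cball this]
        show "integrable lborel (\<lambda>w. (A * (1/2) ^ (l * Suc L)) * (indicator ?X w * norm (G (bump w (?s l) \<theta>))))"
          by (intro integrable_mult_right) simp
        fix w
        show "norm (residual \<phi> l w * G (bump w (?s l) \<theta>)) \<le> (A * (1/2) ^ (l * Suc L)) * (indicator ?X w * norm (G (bump w (?s l) \<theta>)))"
          using deriv_bound_norm[OF A(2), of l w] test_in_zero[OF residual_in'[OF \<phi>], of w l]
          by (cases "norm w \<le> R + 1") (auto simp: norm_mult intro!: mult_right_mono)
      qed
      also have "\<dots> = (A * (1/2) ^ (l * Suc L)) * ?J l" by simp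
      also have "\<dots> \<le> (A * (1/2) ^ (l * Suc L)) * (M * 2 ^ (l * L))"
        using A(1) by (intro mult_left_mono J) auto
      also have "\<dots> = A * M * (1/2) ^ l"
        by (simp add: power_add power_divide)
      finally show ?thesis .
    qed
    have fin: "norm (G \<phi>) \<le> 2 * A * M + norm (G (residual \<phi> m))" for m
    proof -
      let ?c = "\<lambda>l. conv (bump 0 (?s l) \<theta>) (residual \<phi> l)"
      have S: "(\<lambda>z. \<Sum>l<m. ?c l z) \<in> test_in (1 + (R + 1))"
        using test_in_sum[of "{..<m}" ?c "1 + (R + 1)"] cv by auto
      have "G \<phi> = G (\<lambda>z. (\<Sum>l<m. ?c l z) + residual \<phi> m z)"
        by (rule arg_cong[of _ _ G], rule ext, rule residual_telescope)
      also have "\<dots> = (\<Sum>l<m. G (?c l)) + G (residual \<phi> m)"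
        using distribution_add[OF G S residual_in'[OF \<phi>]]
          distribution_sum[OF G, of "{..<m}" ?c "1 + (R + 1)" "\<lambda>_. 1"] cv by simp
      also have "norm \<dots> \<le> (\<Sum>l<m. A * M * (1/2) ^ l) + norm (G (residual \<phi> m))"
        by (intro norm_triangle_le add_mono sum_norm_le le order_refl)
      also have "(\<Sum>l<m. A * M * (1/2) ^ l) = A * M * (\<Sum>l<m. (1/2) ^ l)" by (simp add: sum_distrib_left)
      also have "\<dots> \<le> A * M * 2"
        using A(1) M by (intro mult_left_mono) (auto simp: sum_gp_strict)
      finally show ?thesis by (simp add: mult_ac)
    qed
    \<comment> \<open>The order of \<open>G\<close> enters only here, to make the remainder tend to
      0; it leaves no trace in the constant.\<close>
    obtain C k where C: "C \<ge> 0"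
      "\<And>\<phi> A. \<phi> \<in> test_in (R + 1) \<Longrightarrow> deriv_bound k A \<phi> \<Longrightarrow> norm (G \<phi>) \<le> C * A"
      using distribution_bound[OF G, of "R + 1"] by metis
    obtain A' where A': "A' \<ge> 0" "\<And>l. deriv_bound k (A' * (1/2) ^ (l * 1)) (residual \<phi> l)"
      using residual_decay[OF \<phi>] by blast
    have "norm (G \<phi>) - 2 * A * M \<le> C * (A' * (1/2) ^ m)" for m
      using fin[of m] C(2)[OF residual_in'[OF \<phi>] A'(2)[of m]] by simp
    moreover have "(\<lambda>m. C * (A' * (1/2) ^ m)) \<longlonglongrightarrow> C * (A' * 0)"
      by (intro tendsto_intros LIMSEQ_power_zero) auto
    ultimately have "norm (G \<phi>) - 2 * A * M \<le> C * (A' * 0)"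
      by (intro LIMSEQ_le_const) auto
    then show ?thesis by simp
  qed
  then show ?thesis using A(1) by (intro exI[of _ "2 * A"]) auto
qed

end

section \<open>The grand maximal function\<close>

lemma nn_integral_cball_rescale:
  fixes h :: "'a::euclidean_space \<Rightarrow> ennreal"
  assumes [measurable]: "h \<in> borel_measurable borel" and t: "t > 0"
  shows "(\<integral>\<^sup>+v. h (x + t *\<^sub>R v) * indicator (cball 0 r) v \<partial>lborel)
    = ennreal ((1 / t) ^ DIM('a)) * (\<integral>\<^sup>+y. h y * indicator (cball x (t * r)) y \<partial>lborel)"
proof -
  have [measurable]: "cball x (t * r) \<in> sets borel" by simp
  have i: "indicator (cball x (t * r)) (x + t *\<^sub>R v) = (indicator (cball 0 r) v :: ennreal)" for v
    using t by (auto simp: indicator_def dist_norm)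
  have "(\<integral>\<^sup>+y. h y * indicator (cball x (t * r)) y \<partial>lborel)
      = ennreal (\<bar>t\<bar> ^ DIM('a)) * (\<integral>\<^sup>+v. h (x + t *\<^sub>R v) * indicator (cball 0 r) v \<partial>lborel)"
    using t by (subst nn_integral_lborel_affine[where c = t and t = x]) (auto simp: i)
  then show ?thesis
    using t by (simp add: mult.assoc[symmetric] ennreal_mult[symmetric] power_divide)
qed

lemma le_powr_interpolate:
  assumes "0 \<le> x" "x \<le> U" "q < (1::real)"
  shows "x \<le> U powr (1 - q) * x powr q"
proof -
  have "x = x powr (1 - q) * x powr q" using assms(1) by (simp add: powr_add[symmetric])
  also have "\<dots> \<le> U powr (1 - q) * x powr q"
    using assms by (intro mult_right_mono powr_mono2) auto
  finally show ?thesis .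
qed

text \<open>The source of the self-improvement: split \<open>f\<close> into
  \<open>f powr (1 - q) * f powr q\<close>, bound the first factor by the supremum and keep the
  second for the \<open>q\<close>-integral.\<close>

lemma integral_cball_interpolate:
  fixes f :: "'a::euclidean_space \<Rightarrow> real"
  assumes f: "continuous_on UNIV f" "\<And>v. f v \<ge> 0" and U: "\<And>v. v \<in> cball 0 r \<Longrightarrow> f v \<le> U"
    and q: "0 < q" "q < 1" and h: "h \<in> borel_measurable borel" "\<And>v. ennreal (f v powr q) \<le> h v"
    and I: "(\<integral>\<^sup>+v. h v * indicator (cball 0 r) v \<partial>lborel) \<le> ennreal I" "I \<ge> 0"
  shows "(\<integral>v. indicator (cball 0 r) v * f v \<partial>lborel) \<le> U powr (1 - q) * I"
proof -
  have [measurable]: "h \<in> borel_measurable borel" "f \<in> borel_measurable borel"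
    using h(1) f(1) borel_measurable_continuous_onI by auto
  have [measurable]: "cball (0::'a) r \<in> sets borel" by simp
  have int: "integrable lborel (\<lambda>v. indicator (cball 0 r) v * f v)"
    using borel_integrable_compact[OF compact_cball continuous_on_subset[OF f(1) subset_UNIV]] by simp
  have "ennreal (\<integral>v. indicator (cball 0 r) v * f v \<partial>lborel)
      = (\<integral>\<^sup>+v. ennreal (indicator (cball 0 r) v * f v) \<partial>lborel)"
    by (rule nn_integral_eq_integral[symmetric, OF int]) (simp add: f)
  also have "\<dots> \<le> (\<integral>\<^sup>+v. ennreal (U powr (1 - q)) * (h v * indicator (cball 0 r) v) \<partial>lborel)"
  proof (rule nn_integral_mono)
    fix v
    show "ennreal (indicator (cball 0 r) v * f v) \<le> ennreal (U powr (1 - q)) * (h v * indicator (cball 0 r) v)"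
    proof (cases "v \<in> cball 0 r")
      case True
      have "ennreal (f v) \<le> ennreal (U powr (1 - q) * f v powr q)"
        using le_powr_interpolate[OF f(2) U[OF True] q(2)] by (rule ennreal_leI)
      also have "\<dots> \<le> ennreal (U powr (1 - q)) * h v"
        using h(2) by (simp add: ennreal_mult mult_left_mono)
      finally show ?thesis using True by simp
    qed simp
  qed
  also have "\<dots> = ennreal (U powr (1 - q)) * (\<integral>\<^sup>+v. h v * indicator (cball 0 r) v \<partial>lborel)"
    by (rule nn_integral_cmult) simp
  also have "\<dots> \<le> ennreal (U powr (1 - q)) * ennreal I" by (rule mult_left_mono[OF I(1)]) simp
  also have "\<dots> = ennreal (U powr (1 - q) * I)" using I(2) by (simp add: ennreal_mult)
  finally show ?thesis using I(2) by (simp add: ennreal_le_iff)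
qed

context mollifier
begin

text \<open>Packages the conclusion of \<open>reproducing_bound\<close>, so that the constant can be
  fixed before any functional is named and later constants are independent of the
  distribution.\<close>

definition reproduces :: "nat \<Rightarrow> real \<Rightarrow> real \<Rightarrow> (real^'n \<Rightarrow> complex) \<Rightarrow> bool"
  where "reproduces L A R \<phi> \<longleftrightarrow> A \<ge> 0 \<and> (\<forall>(G :: 'n functional) M. distribution G \<longrightarrow>
    (\<forall>l. (\<integral>w. indicator (cball 0 (R + 1)) w * norm (G (bump w ((1/2) ^ Suc l) \<theta>)) \<partial>lborel) \<le> M * 2 ^ (l * L))
    \<longrightarrow> norm (G \<phi>) \<le> A * M)"

lemma reproduces_ex: "\<phi> \<in> test_in R \<Longrightarrow> \<exists>A. reproduces L A R \<phi>"
  unfolding reproduces_def using reproducing_bound by blast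

lemma reproducesD:
  assumes "reproduces L A R \<phi>" "distribution G"
    "\<And>l. (\<integral>w. indicator (cball 0 (R + 1)) w * norm (G (bump w ((1/2) ^ Suc l) \<theta>)) \<partial>lborel) \<le> M * 2 ^ (l * L)"
  shows "norm (G \<phi>) \<le> A * M"
  using assms unfolding reproduces_def by blast

lemma reproduces_nonneg: "reproduces L A R \<phi> \<Longrightarrow> A \<ge> 0"
  by (simp add: reproduces_def)

text \<open>Growth of order \<open>K\<close> in the scale, on balls that widen with \<open>k\<close>
  from the radius \<open>R + 1\<close>. The margin is chosen so that an excursion of length
  \<open>2 * (1/2) ^ k\<close> from the ball of level \<open>k\<close> ends inside the ball of every
  finer level.\<close>

definition scale_bound :: "'n functional \<Rightarrow> real \<Rightarrow> real \<Rightarrow> real \<Rightarrow> bool"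
  where "scale_bound G R B K \<longleftrightarrow> (\<forall>k w. norm w \<le> R + 5 - 4 * (1/2) ^ k \<longrightarrow>
    norm (G (bump w ((1/2) ^ k) \<theta>)) \<le> B * 2 powr (real k * K))"

lemma scale_bound_mono:
  assumes "scale_bound G R B K" "B \<ge> 0" "B \<le> B'" "K \<le> K'" shows "scale_bound G R B' K'"
proof -
  have "B * 2 powr (real k * K) \<le> B' * 2 powr (real k * K')" for k
    using assms(2-4) by (intro mult_mono powr_mono mult_left_mono) auto
  then show ?thesis using assms(1) unfolding scale_bound_def by (meson order_trans)
qed

text \<open>The exponent found here is the dimension plus the order of \<open>G\<close> on a ball,
  so at this stage it still depends on \<open>G\<close>.\<close>

lemma scale_bound_ex:
  assumes G: "distribution G" shows "\<exists>B\<ge>0. \<exists>K. scale_bound G R B K"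
proof -
  obtain C m where C: "C \<ge> 0"
      "\<And>\<phi> A. \<phi> \<in> test_in (R + 6) \<Longrightarrow> deriv_bound m A \<phi> \<Longrightarrow> norm (G \<phi>) \<le> C * A"
    using distribution_bound[OF G, of "R + 6"] by metis
  obtain A where A: "A \<ge> 0" "deriv_bound m A \<theta>" using deriv_bound_ex[OF \<theta>_test] .
  have "norm (G (bump w ((1/2) ^ k) \<theta>)) \<le> (C * 2 ^ m * A) * 2 powr (real k * real (CARD('n) + m))"
    if w: "norm w \<le> R + 5 - 4 * (1/2) ^ k" for k w
  proof -
    let ?t = "(1/2::real) ^ k"
    have t1: "?t \<le> 1" by (simp add: power_le_one)
    have t0: "0 < ?t" by simp
    have "bump w ?t \<theta> \<in> test_in (R + 6)"
    proof (rule test_in_mono[OF bump_test_in[OF \<theta>_test t0]])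
      show "norm w + ?t * 1 \<le> R + 6" using w t1 t0 by linarith
    qed
    then have "norm (G (bump w ?t \<theta>)) \<le> C * ((1 / ?t) ^ CARD('n) * (1 / ?t + 1) ^ m * A)"
      by (rule C(2)) (rule deriv_bound_bump[OF test_in_smooth[OF \<theta>_test] A(2)], simp)
    also have "\<dots> \<le> C * ((2 ^ k) ^ CARD('n) * (2 * 2 ^ k) ^ m * A)"
      using C(1) A(1) one_le_power[of "2::real" k]
      by (intro mult_left_mono mult_right_mono mult_mono power_mono) (auto simp: power_divide)
    also have "\<dots> = (C * 2 ^ m * A) * 2 ^ (k * (CARD('n) + m))"
      by (simp add: power_mult_distrib power_mult distrib_left power_add mult_ac)
    also have "(2::real) ^ (k * (CARD('n) + m)) = 2 powr (real k * real (CARD('n) + m))"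
      by (simp add: powr_realpow[symmetric] del: of_nat_add)
    finally show ?thesis .
  qed
  then show ?thesis using C(1) A(1) unfolding scale_bound_def
    by (intro exI[of _ "C * 2 ^ m * A"] conjI exI[of _ "real (CARD('n) + m)"]) auto
qed

text \<open>\<open>h\<close> is extended-valued because it will be a power of a maximal function
  that may be infinite at some points; the finite number \<open>I\<close> bounds its mass on the
  ball of radius \<open>R + 5\<close>.\<close>

definition dominates :: "real \<Rightarrow> 'n functional \<Rightarrow> real \<Rightarrow> (real^'n \<Rightarrow> ennreal) \<Rightarrow> real \<Rightarrow> bool"
  where "dominates q G R h I \<longleftrightarrow> h \<in> borel_measurable borel \<and>
    (\<forall>k w. ennreal (norm (G (bump w ((1/2) ^ k) \<theta>)) powr q) \<le> h w) \<and>
    I \<ge> 0 \<and> (\<integral>\<^sup>+w. h w * indicator (cball 0 (R + 5)) w \<partial>lborel) \<le> ennreal I"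

text \<open>The reproducing bound for \<open>\<theta>\<close> itself is applied to \<open>G\<close>
  rescaled to centre \<open>w\<close> and scale \<open>(1/2) ^ k\<close>, with the local integrals
  estimated by interpolation. The supremum enters with power \<open>1 - q\<close>, and rescaling the
  integral of \<open>h\<close> costs \<open>2 ^ (k * n)\<close> in dimension \<open>n\<close>; so
  \<open>K\<close> becomes \<open>n + K * (1 - q)\<close>.\<close>

lemma scale_bound_step:
  assumes q: "0 < q" "q < 1" and G: "distribution G" and dom: "dominates q G R h I"
    and B: "scale_bound G R B K" "B \<ge> 0" and L: "real L \<ge> K * (1 - q)"
    and A: "reproduces L A 1 \<theta>"
  shows "scale_bound G R (A * 2 powr (K * (1 - q)) * I * B powr (1 - q)) (real CARD('n) + K * (1 - q))"
  unfolding scale_bound_def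
proof (intro allI impI)
  fix k :: nat and w :: "real^'n"
  let ?t = "(1/2::real) ^ k"
  assume w: "norm w \<le> R + 5 - 4 * ?t"
  have I: "I \<ge> 0" and h: "h \<in> borel_measurable borel"
    and hI: "(\<integral>\<^sup>+w. h w * indicator (cball 0 (R + 5)) w \<partial>lborel) \<le> ennreal I"
    and hq: "\<And>k w. ennreal (norm (G (bump w ((1/2) ^ k) \<theta>)) powr q) \<le> h w"
    using dom unfolding dominates_def by auto
  note [measurable] = h
  let ?G = "\<lambda>\<phi>. G (bump w ?t \<phi>)"
  have t0: "?t > 0" by simp
  have G': "distribution ?G" by (rule distribution_bump[OF G t0])
  let ?n = "CARD('n)"
  let ?I = "(1 / ?t) ^ ?n * I"
  let ?M = "(B * 2 powr (real (Suc k) * K)) powr (1 - q) * ?I"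
  have bb: "bump w ?t (bump v ((1/2) ^ Suc l) \<theta>) = bump (w + ?t *\<^sub>R v) ((1/2) ^ (k + Suc l)) \<theta>" for v l
    by (subst bump_bump) (simp_all add: power_add)
  have "norm (?G \<theta>) \<le> A * ?M"
  proof (rule reproducesD[OF A G'])
    fix l
    let ?U = "B * 2 powr (real (k + Suc l) * K)"
    have "(\<integral>v. indicator (cball 0 2) v * norm (G (bump (w + ?t *\<^sub>R v) ((1/2) ^ (k + Suc l)) \<theta>)) \<partial>lborel)
        \<le> ?U powr (1 - q) * ?I"
    proof (rule integral_cball_interpolate[OF _ _ _ q])
      show "continuous_on UNIV (\<lambda>v. norm (G (bump (w + ?t *\<^sub>R v) ((1/2) ^ (k + Suc l)) \<theta>)))"
        by (intro continuous_intros continuous_on_compose2[OF distribution_bump_continuous[OF G \<theta>_test, where S = UNIV], where f = "\<lambda>v. w + ?t *\<^sub>R v"]) auto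
      show "norm (G (bump (w + ?t *\<^sub>R v) ((1/2) ^ (k + Suc l)) \<theta>)) \<le> ?U" if "v \<in> cball 0 2" for v
      proof -
        have "norm (w + ?t *\<^sub>R v) \<le> norm w + ?t * norm v"
          using norm_triangle_ineq[of w "?t *\<^sub>R v"] by simp
        also have "\<dots> \<le> (R + 5 - 4 * ?t) + ?t * 2"
          using w that by (intro add_mono mult_left_mono) auto
        \<comment> \<open>What remains of the margin is \<open>2 * ?t\<close>, which is
          \<open>4 * (1/2) ^ (k + 1)\<close>, at least the margin required at any finer
          level.\<close>
        also have "\<dots> \<le> R + 5 - 4 * (1/2) ^ (k + Suc l)"
        proof -
          have "(1/2::real) ^ (k + Suc l) \<le> (1/2) ^ (k + 1)" by (rule power_decreasing) auto
          then show ?thesis by simp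
        qed
        finally show ?thesis using B(1) unfolding scale_bound_def by blast
      qed
      show "(\<lambda>v. h (w + ?t *\<^sub>R v)) \<in> borel_measurable borel" by measurable
      show "ennreal (norm (G (bump (w + ?t *\<^sub>R v) ((1/2) ^ (k + Suc l)) \<theta>)) powr q) \<le> h (w + ?t *\<^sub>R v)" for v
        by (rule hq)
      have sub: "cball w (?t * 2) \<subseteq> cball 0 (R + 5)"
      proof
        fix y assume y: "y \<in> cball w (?t * 2)"
        have "norm y \<le> norm w + norm (w - y)" using norm_triangle_ineq4[of w "w - y"] by simp
        then show "y \<in> cball 0 (R + 5)" using y w t0 unfolding mem_cball dist_norm diff_0 norm_minus_cancel by linarith
      qed
      have "(\<integral>\<^sup>+v. h (w + ?t *\<^sub>R v) * indicator (cball 0 2) v \<partial>lborel)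
          = ennreal ((1 / ?t) ^ ?n) * (\<integral>\<^sup>+y. h y * indicator (cball w (?t * 2)) y \<partial>lborel)"
        using nn_integral_cball_rescale[OF h t0] by simp
      also have "\<dots> \<le> ennreal ((1 / ?t) ^ ?n) * ennreal I"
        by (intro mult_left_mono order_trans[OF nn_integral_mono hI]) (use sub in \<open>auto simp: indicator_def\<close>)
      also have "\<dots> = ennreal ?I" using I by (simp add: ennreal_mult)
      finally show "(\<integral>\<^sup>+v. h (w + ?t *\<^sub>R v) * indicator (cball 0 2) v \<partial>lborel) \<le> ennreal ?I" .
    qed (use I in auto)
    also have "?U powr (1 - q) = (B * 2 powr (real (Suc k) * K)) powr (1 - q) * 2 powr (real l * (K * (1 - q)))"
      using B(2) by (simp add: powr_mult powr_powr powr_add[symmetric] algebra_simps)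
    also have "\<dots> * ?I \<le> (B * 2 powr (real (Suc k) * K)) powr (1 - q) * 2 powr (real l * real L) * ?I"
      using I L by (intro mult_right_mono mult_left_mono powr_mono) auto
    also have "\<dots> = ?M * 2 ^ (l * L)"
      by (simp add: powr_realpow[symmetric] mult_ac)
    finally show "(\<integral>v. indicator (cball 0 (1 + 1)) v * norm (?G (bump v ((1/2) ^ Suc l) \<theta>)) \<partial>lborel) \<le> ?M * 2 ^ (l * L)"
      unfolding bb by simp
  qed
  also have "(1 / ?t) ^ ?n = 2 powr (real k * real ?n)"
    by (simp add: power_divide powr_realpow[symmetric] powr_powr)
  also have "A * ((B * 2 powr (real (Suc k) * K)) powr (1 - q) * (2 powr (real k * real ?n) * I))
      = A * 2 powr (K * (1 - q)) * I * B powr (1 - q) * 2 powr (real k * (real ?n + K * (1 - q)))"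
    using B(2) by (simp add: powr_mult powr_powr powr_add[symmetric] algebra_simps)
  finally show "norm (G (bump w ?t \<theta>)) \<le> A * 2 powr (K * (1 - q)) * I * B powr (1 - q) * 2 powr (real k * (real ?n + K * (1 - q)))" .
qed

text \<open>In dimension \<open>n\<close> the map sending \<open>K\<close> to
  \<open>n + K * (1 - q)\<close> has the fixed point \<open>n / q\<close> and contracts with ratio
  \<open>1 - q\<close>. Finitely many steps bring any initial exponent down to at most
  \<open>n / q + 1\<close>, a value independent of \<open>G\<close>; the constant \<open>B\<close>
  is still uncontrolled.\<close>

lemma scale_bound_improve:
  assumes q: "0 < q" "q < 1" and G: "distribution G" and dom: "dominates q G R h I"
  shows "\<exists>B\<ge>0. scale_bound G R B (real CARD('n) / q + 1)"
proof -
  let ?n = "real CARD('n)"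
  obtain B0 K where B0: "B0 \<ge> 0" "scale_bound G R B0 K" using scale_bound_ex[OF G] by blast
  define X where "X = max (K - ?n / q) 0"
  have "\<exists>B\<ge>0. scale_bound G R B (?n / q + (1 - q) ^ i * X)" for i
  proof (induction i)
    case 0
    have "K \<le> ?n / q + X" by (simp add: X_def)
    then show ?case using scale_bound_mono[OF B0(2,1) order_refl] B0(1) by auto
  next
    case (Suc i)
    then obtain B where B: "B \<ge> 0" "scale_bound G R B (?n / q + (1 - q) ^ i * X)" by blast
    let ?K = "?n / q + (1 - q) ^ i * X"
    obtain L where L: "real L \<ge> ?K * (1 - q)" using real_arch_simple by blast
    obtain A where A: "reproduces L A 1 \<theta>"
      using reproduces_ex[OF \<theta>_test] by blast
    have "?n + ?K * (1 - q) = ?n / q + (1 - q) ^ Suc i * X" using q by (simp add: field_simps)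
    moreover have "A * 2 powr (?K * (1 - q)) * I * B powr (1 - q) \<ge> 0"
      using reproduces_nonneg[OF A] dom by (auto simp: dominates_def)
    ultimately show ?case using scale_bound_step[OF q G dom B(2,1) L A] by metis
  qed
  moreover obtain i where "(1 - q) ^ i * X \<le> 1"
  proof -
    have "(\<lambda>i. (1 - q) ^ i * X) \<longlonglongrightarrow> 0 * X" by (intro tendsto_intros LIMSEQ_power_zero) (use q in auto)
    then have "eventually (\<lambda>i. (1 - q) ^ i * X < 1) sequentially" by (rule order_tendstoD) simp
    then show ?thesis using that unfolding eventually_sequentially by (meson less_imp_le order_refl)
  qed
  ultimately show ?thesis using scale_bound_mono by (meson add_left_mono order_refl)
qed

text \<open>Only finiteness of the bound depends on the order of the distribution; once it is finite, the
  self-improving inequality \<open>B \<le> c I B\<^sup>1\<^sup>-\<^sup>q\<close> makes it uniform.\<close>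

theorem grand_maximal_unit:
  assumes q: "0 < q" "q < 1" and \<phi>: "\<phi> \<in> test_in R"
  shows "\<exists>C\<ge>0. \<forall>(G :: 'n functional) h I. distribution G \<longrightarrow> dominates q G R h I \<longrightarrow> norm (G \<phi>) \<le> C * I powr (1 / q)"
proof -
  let ?n = "real CARD('n)"
  define K where "K = ?n / q + 1"
  obtain L where L: "real L \<ge> K * (1 - q)" using real_arch_simple by blast
  obtain A where A: "reproduces L A 1 \<theta>"
    using reproduces_ex[OF \<theta>_test] by blast
  obtain A1 where A1: "reproduces L A1 R \<phi>"
    using reproduces_ex[OF \<phi>] by blast
  define c where "c = A * 2 powr (K * (1 - q))"
  have c: "c \<ge> 0" using reproduces_nonneg[OF A] by (simp add: c_def)
  define C where "C = A1 * 2 powr (K * (1 - q)) * c powr ((1 - q) / q)"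
  have "norm (G \<phi>) \<le> C * I powr (1 / q)" if G: "distribution G" and dom: "dominates q G R h I" for G h I
  proof -
    have I: "I \<ge> 0" and h: "h \<in> borel_measurable borel"
      and hI: "(\<integral>\<^sup>+w. h w * indicator (cball 0 (R + 5)) w \<partial>lborel) \<le> ennreal I"
      and hq: "\<And>k w. ennreal (norm (G (bump w ((1/2) ^ k) \<theta>)) powr q) \<le> h w"
      using dom unfolding dominates_def by auto
    let ?S = "{B. B \<ge> 0 \<and> scale_bound G R B K}"
    have ne: "?S \<noteq> {}" using scale_bound_improve[OF q G dom] by (auto simp: K_def)
    have bdd: "bdd_below ?S" by (rule bdd_belowI[of _ 0]) auto
    \<comment> \<open>The least admissible constant. The set is nonempty by
      \<open>scale_bound_improve\<close>, and the bound passes to the infimum, so \<open>b\<close>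
      itself can be fed into the improvement step.\<close>
    define b where "b = Inf ?S"
    have b0: "b \<ge> 0" unfolding b_def using ne by (intro cInf_greatest) auto
    have sb: "scale_bound G R b K"
      unfolding scale_bound_def
    proof (intro allI impI)
      fix k :: nat and w :: "real^'n" assume w: "norm w \<le> R + 5 - 4 * (1/2) ^ k"
      have "norm (G (bump w ((1/2) ^ k) \<theta>)) / 2 powr (real k * K) \<le> b"
        unfolding b_def
      proof (rule cInf_greatest[OF ne])
        fix B assume "B \<in> ?S"
        then have "norm (G (bump w ((1/2) ^ k) \<theta>)) \<le> B * 2 powr (real k * K)"
          using w by (auto simp: scale_bound_def)
        then show "norm (G (bump w ((1/2) ^ k) \<theta>)) / 2 powr (real k * K) \<le> B"
          by (simp add: pos_divide_le_eq)
      qed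
      then show "norm (G (bump w ((1/2) ^ k) \<theta>)) \<le> b * 2 powr (real k * K)"
        by (simp add: pos_divide_le_eq)
    qed
    let ?b = "c * I * b powr (1 - q)"
    have b1: "?b \<ge> 0" using c I by simp
    \<comment> \<open>The exponent \<open>K\<close> lies above the fixed point, so the step does not
      worsen it, and the improved constant is again a candidate for the infimum.\<close>
    have "?n + K * (1 - q) \<le> K" using q by (simp add: K_def field_simps)
    with scale_bound_step[OF q G dom sb b0 L A] b1
    have "scale_bound G R ?b K" using scale_bound_mono[of G R ?b _ ?b K] by (simp add: c_def)
    then have bb: "b \<le> ?b" unfolding b_def using b1 by (intro cInf_lower bdd) (auto simp: b_def)
    have ble: "b \<le> (c * I) powr (1 / q)"
    proof (cases "b = 0")
      case False
      then have bp: "b > 0" using b0 by simp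
      \<comment> \<open>Cancelling \<open>b powr (1 - q)\<close> from
        \<open>b \<le> c * I * b powr (1 - q)\<close> is legitimate because \<open>b\<close> is a
        positive real number.\<close>
      have "b powr q * b powr (1 - q) = b" using bp by (simp add: powr_add[symmetric])
      then have "b powr q * b powr (1 - q) \<le> (c * I) * b powr (1 - q)" using bb by simp
      then have "b powr q \<le> c * I" using bp by simp
      then have "(b powr q) powr (1 / q) \<le> (c * I) powr (1 / q)" using q by (intro powr_mono2) auto
      then show ?thesis using q bp by (simp add: powr_powr)
    qed simp
    let ?M = "b powr (1 - q) * 2 powr (K * (1 - q)) * I"
    have "norm (G \<phi>) \<le> A1 * ?M"
    proof (rule reproducesD[OF A1 G])
      fix l
      let ?U = "b * 2 powr (real (Suc l) * K)"
      have "(\<integral>v. indicator (cball 0 (R + 1)) v * norm (G (bump v ((1/2) ^ Suc l) \<theta>)) \<partial>lborel)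
          \<le> ?U powr (1 - q) * I"
      proof (rule integral_cball_interpolate[OF _ _ _ q])
        show "continuous_on UNIV (\<lambda>v. norm (G (bump v ((1/2) ^ Suc l) \<theta>)))"
          by (intro continuous_intros distribution_bump_continuous[OF G \<theta>_test]) auto
        show "norm (G (bump v ((1/2) ^ Suc l) \<theta>)) \<le> ?U" if v: "v \<in> cball 0 (R + 1)" for v
        proof -
          have "(1/2::real) ^ Suc l \<le> 1" by (rule power_le_one) auto
          then have "norm v \<le> R + 5 - 4 * (1/2) ^ Suc l" using v unfolding mem_cball_0 by linarith
          then show ?thesis using sb unfolding scale_bound_def by blast
        qed
        show "ennreal (norm (G (bump v ((1/2) ^ Suc l) \<theta>)) powr q) \<le> h v" for v by (rule hq)
        show "(\<integral>\<^sup>+v. h v * indicator (cball 0 (R + 1)) v \<partial>lborel) \<le> ennreal I"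
          by (rule order_trans[OF nn_integral_mono hI]) (auto simp: indicator_def)
      qed (use I h in auto)
      also have "?U powr (1 - q) = b powr (1 - q) * 2 powr (K * (1 - q)) * 2 powr (real l * (K * (1 - q)))"
        using b0 by (simp add: powr_mult powr_powr powr_add[symmetric] algebra_simps)
      also have "\<dots> * I \<le> b powr (1 - q) * 2 powr (K * (1 - q)) * 2 powr (real l * real L) * I"
        using I L by (intro mult_right_mono mult_left_mono powr_mono) auto
      also have "\<dots> = ?M * 2 ^ (l * L)"
        by (simp add: powr_realpow[symmetric] mult_ac)
      finally show "(\<integral>v. indicator (cball 0 (R + 1)) v * norm (G (bump v ((1/2) ^ Suc l) \<theta>)) \<partial>lborel) \<le> ?M * 2 ^ (l * L)" .
    qed
    also have "\<dots> \<le> A1 * (((c * I) powr (1 / q)) powr (1 - q) * 2 powr (K * (1 - q)) * I)"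
      using reproduces_nonneg[OF A1] I ble b0 q by (intro mult_left_mono mult_right_mono powr_mono2) auto
    also have "\<dots> = C * (I powr ((1 - q) / q) * I)"
      using c I by (simp add: C_def powr_powr powr_mult mult_ac)
    also have "I powr ((1 - q) / q) * I = I powr (1 / q)"
    proof (cases "I = 0")
      case False
      then have "I powr ((1 - q) / q) * I = I powr ((1 - q) / q + 1)" using I by (simp add: powr_add)
      also have "(1 - q) / q + 1 = 1 / q" using q by (simp add: field_simps)
      finally show ?thesis .
    qed simp
    finally show ?thesis .
  qed
  moreover have "C \<ge> 0" using reproduces_nonneg[OF A1] by (simp add: C_def)
  ultimately show ?thesis by blast
qed

end

section \<open>The Hardy--Littlewood maximal theorem\<close>

lemma ennreal_rpow_ennreal: "x \<ge> 0 \<Longrightarrow> ennreal_rpow (ennreal x) p = ennreal (x powr p)"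
  by (simp add: ennreal_rpow_def)

lemma ennreal_rpow_top [simp]: "ennreal_rpow top p = top"
  by (simp add: ennreal_rpow_def)

lemma ennreal_rpow_0 [simp]: "ennreal_rpow 0 p = 0"
  by (simp add: ennreal_rpow_def)

lemma ennreal_rpow_less_top_iff [simp]: "ennreal_rpow a p < top \<longleftrightarrow> a < top"
  by (simp add: ennreal_rpow_def top.not_eq_extremum)

lemma ennreal_rpow_mono:
  assumes "a \<le> b" "p \<ge> 0" shows "ennreal_rpow a p \<le> ennreal_rpow b p"
proof (cases "b = top")
  case False
  then obtain x y where "a = ennreal x" "b = ennreal y" "0 \<le> x" "0 \<le> y"
    using assms(1) by (metis ennreal_cases neq_top_trans)
  then show ?thesis using assms by (auto simp: ennreal_rpow_ennreal ennreal_leI powr_mono2)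
qed simp

lemma ennreal_rpow_rpow: "ennreal_rpow (ennreal_rpow a p) q = ennreal_rpow a (p * q)"
  by (cases a) (auto simp: ennreal_rpow_ennreal powr_powr)

lemma ennreal_rpow_mult: "ennreal_rpow (a * b) p = ennreal_rpow a p * ennreal_rpow b p"
proof (cases "a = 0 \<or> b = 0")
  case False
  then show ?thesis
    by (cases a; cases b) (auto simp: ennreal_rpow_ennreal ennreal_mult_top ennreal_top_mult powr_mult
        simp flip: ennreal_mult)
qed auto

text \<open>From \<open>a + b \<le> 2 * max a b\<close>. This crude constant works for small and
  large exponents alike; both \<open>p\<close> and \<open>1 / p\<close> occur.\<close>

lemma ennreal_rpow_add_le:
  assumes "p \<ge> 0"
  shows "ennreal_rpow (a + b) p \<le> ennreal (2 powr p) * (ennreal_rpow a p + ennreal_rpow b p)"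
proof -
  have "a + b \<le> ennreal 2 * max a b"
    by (metis add_mono ennreal_numeral max.cobounded1 max.cobounded2 mult_2)
  then have "ennreal_rpow (a + b) p \<le> ennreal (2 powr p) * ennreal_rpow (max a b) p"
    using ennreal_rpow_mono[OF _ assms, of "a + b" "ennreal 2 * max a b"]
      ennreal_rpow_ennreal[of 2 p] by (simp add: ennreal_rpow_mult)
  also have "ennreal_rpow (max a b) p \<le> ennreal_rpow a p + ennreal_rpow b p"
    by (auto simp: max_def)
  finally show ?thesis by (simp add: mult_left_mono)
qed

lemma ennreal_rpow_sum_le:
  assumes "p \<ge> 0" "finite A"
  shows "ennreal_rpow (\<Sum>i\<in>A. f i) p \<le> ennreal ((2 powr p) ^ card A) * (\<Sum>i\<in>A. ennreal_rpow (f i) p)"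
  using assms(2)
proof (induction A)
  case (insert a A)
  let ?c = "ennreal (2 powr p)"
  have c1: "1 \<le> ?c" using assms(1) by (simp add: ge_one_powr_ge_zero)
  have c2: "?c ^ card A \<ge> 1" using c1 by (rule one_le_power)
  have "ennreal_rpow (\<Sum>i\<in>insert a A. f i) p \<le> ?c * (ennreal_rpow (f a) p + ennreal_rpow (\<Sum>i\<in>A. f i) p)"
    using insert ennreal_rpow_add_le[OF assms(1)] by simp
  also have "\<dots> \<le> ?c * (?c ^ card A * ennreal_rpow (f a) p + ?c ^ card A * (\<Sum>i\<in>A. ennreal_rpow (f i) p))"
    using insert.IH mult_right_mono[OF c2, of "ennreal_rpow (f a) p"]
    by (intro mult_left_mono add_mono) (auto simp: ennreal_power)
  also have "\<dots> = ?c ^ card (insert a A) * (\<Sum>i\<in>insert a A. ennreal_rpow (f i) p)"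
    using insert by (simp add: algebra_simps)
  finally show ?case by (simp add: ennreal_power)
qed simp

lemma measurable_ennreal_rpow [measurable]:
  assumes [measurable]: "f \<in> borel_measurable M"
  shows "(\<lambda>x. ennreal_rpow (f x) p) \<in> borel_measurable M"
  unfolding ennreal_rpow_def by measurable

text \<open>The centred maximal function, normalized by the power of the radius and not by the
  volume of the ball; the factor \<open>unit_ball_vol\<close> appears in the constants of the
  estimates instead.\<close>

definition maximal_op :: "('a::euclidean_space \<Rightarrow> ennreal) \<Rightarrow> 'a \<Rightarrow> ennreal"
  where "maximal_op h x = (SUP r\<in>{0<..}. ennreal ((1 / r) ^ DIM('a)) * (\<integral>\<^sup>+y. h y * indicator (cball x r) y \<partial>lborel))"

lemma maximal_op_upper:
  fixes h :: "'a::euclidean_space \<Rightarrow> ennreal"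
  shows "r > 0 \<Longrightarrow> ennreal ((1 / r) ^ DIM('a)) * (\<integral>\<^sup>+y. h y * indicator (cball x r) y \<partial>lborel) \<le> maximal_op h x"
  unfolding maximal_op_def by (rule SUP_upper) simp

lemma maximal_op_integral_le:
  fixes h :: "'a::euclidean_space \<Rightarrow> ennreal"
  assumes "r > 0"
  shows "(\<integral>\<^sup>+y. h y * indicator (cball x r) y \<partial>lborel) \<le> ennreal (r ^ DIM('a)) * maximal_op h x"
proof -
  let ?I = "\<integral>\<^sup>+y. h y * indicator (cball x r) y \<partial>lborel"
  have "?I = ennreal (r ^ DIM('a)) * (ennreal ((1 / r) ^ DIM('a)) * ?I)"
    using assms by (simp add: mult.assoc[symmetric] ennreal_mult[symmetric] power_divide)
  also have "\<dots> \<le> ennreal (r ^ DIM('a)) * maximal_op h x"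
    by (intro mult_left_mono maximal_op_upper assms) simp
  finally show ?thesis .
qed

text \<open>Lower semicontinuity: a strict inequality survives a slight enlargement of the radius
  from \<open>r\<close> to \<open>s\<close>, and balls of radius \<open>s\<close> around nearby
  centres contain the original ball.\<close>

lemma open_maximal_op: "open {x. a < maximal_op h x}"
proof (subst open_subopen, safe)
  fix x :: 'a assume "a < maximal_op h x"
  then obtain r where r: "r > 0" "a < ennreal ((1 / r) ^ DIM('a)) * (\<integral>\<^sup>+y. h y * indicator (cball x r) y \<partial>lborel)"
    unfolding maximal_op_def less_SUP_iff by auto
  let ?I = "\<integral>\<^sup>+y. h y * indicator (cball x r) y \<partial>lborel"
  have "((\<lambda>s. ennreal ((1 / s) ^ DIM('a)) * ?I) \<longlongrightarrow> ennreal ((1 / r) ^ DIM('a)) * ?I) (at_right r)"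
    using r(1) by (intro tendsto_mult_ennreal tendsto_ennrealI tendsto_intros) (auto simp: power_divide)
  then have "\<forall>\<^sub>F s in at_right r. a < ennreal ((1 / s) ^ DIM('a)) * ?I" by (rule order_tendstoD) (rule r)
  then obtain b where b: "b > r" "\<And>s. s > r \<Longrightarrow> s < b \<Longrightarrow> a < ennreal ((1 / s) ^ DIM('a)) * ?I"
    using eventually_at_right_real[of r] unfolding eventually_at_right_field by auto
  define s where "s = (r + b) / 2"
  have s: "s > r" "s < b" using b by (auto simp: s_def)
  have "ball x (s - r) \<subseteq> {x. a < maximal_op h x}"
  proof safe
    fix y assume y: "y \<in> ball x (s - r)"
    have sub: "cball x r \<subseteq> cball y s"
    proof
      fix z assume "z \<in> cball x r"
      then show "z \<in> cball y s" using y dist_triangle[of y z x] by (simp add: dist_commute)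
    qed
    have "a < ennreal ((1 / s) ^ DIM('a)) * ?I" using b(2) s by simp
    also have "\<dots> \<le> ennreal ((1 / s) ^ DIM('a)) * (\<integral>\<^sup>+z. h z * indicator (cball y s) z \<partial>lborel)"
      using sub by (intro mult_left_mono nn_integral_mono) (auto simp: indicator_def)
    also have "\<dots> \<le> maximal_op h y" by (rule maximal_op_upper) (use r s in simp)
    finally show "a < maximal_op h y" .
  qed
  then show "\<exists>T. open T \<and> x \<in> T \<and> T \<subseteq> {x. a < maximal_op h x}"
    using s by (intro exI[of _ "ball x (s - r)"]) auto
qed

lemma borel_measurable_maximal_op [measurable]: "maximal_op h \<in> borel_measurable borel"
  by (rule borel_measurableI_greater) (simp add: borel_open open_maximal_op)

text \<open>Every point of the level set is the centre of a ball of some radius \<open>r\<close> on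
  which \<open>h\<close> has mass at least \<open>l * r ^ n\<close>. Vitali's lemma selects disjoint
  balls whose fivefold enlargements cover the set; hence the factor \<open>5 ^ n\<close>.\<close>

lemma maximal_op_weak_type:
  fixes h :: "'a::euclidean_space \<Rightarrow> ennreal"
  assumes [measurable]: "h \<in> borel_measurable borel" and l: "l > 0"
  shows "emeasure lborel {x. ennreal l < maximal_op h x}
    \<le> ennreal (unit_ball_vol (DIM('a)) * 5 ^ DIM('a) / l) * (\<integral>\<^sup>+y. h y \<partial>lborel)"
proof (cases "(\<integral>\<^sup>+y. h y \<partial>lborel) = top")
  case True
  have "unit_ball_vol (DIM('a)) * 5 ^ DIM('a) / l > 0" using l by simp
  then have "ennreal (unit_ball_vol (DIM('a)) * 5 ^ DIM('a) / l) \<noteq> 0" by (simp only: ennreal_eq_0_iff not_le)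
  then show ?thesis by (simp only: True ennreal_mult_top if_False top_greatest)
next
  case False
  let ?E = "{x. ennreal l < maximal_op h x}" and ?n = "DIM('a)"
  let ?\<omega> = "unit_ball_vol (DIM('a))"
  have \<omega>: "?\<omega> > 0" by simp
  obtain T where T: "(\<integral>\<^sup>+y. h y \<partial>lborel) = ennreal T" "T \<ge> 0" using False by (metis ennreal_cases)
  have "\<exists>r>0. ennreal (l * r ^ ?n) \<le> (\<integral>\<^sup>+y. h y * indicator (cball x r) y \<partial>lborel)" if x: "x \<in> ?E" for x
  proof -
    obtain r where r: "r > 0" "ennreal l < ennreal ((1 / r) ^ ?n) * (\<integral>\<^sup>+y. h y * indicator (cball x r) y \<partial>lborel)"
      using x unfolding maximal_op_def by (auto simp: less_SUP_iff)
    have "ennreal (l * r ^ ?n) = ennreal (r ^ ?n) * ennreal l" using l r by (simp add: ennreal_mult[symmetric] mult.commute)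
    also have "\<dots> \<le> ennreal (r ^ ?n) * (ennreal ((1 / r) ^ ?n) * (\<integral>\<^sup>+y. h y * indicator (cball x r) y \<partial>lborel))"
      using r(2) by (intro mult_left_mono) auto
    also have "\<dots> = (\<integral>\<^sup>+y. h y * indicator (cball x r) y \<partial>lborel)"
      using r(1) by (simp add: mult.assoc[symmetric] ennreal_mult[symmetric] power_divide)
    finally show ?thesis using r(1) by blast
  qed
  then obtain r where r: "\<And>x. x \<in> ?E \<Longrightarrow> r x > 0"
    "\<And>x. x \<in> ?E \<Longrightarrow> ennreal (l * r x ^ ?n) \<le> (\<integral>\<^sup>+y. h y * indicator (cball x (r x)) y \<partial>lborel)" by metis
  \<comment> \<open>The covering lemma asks for bounded radii. Above 1 the radius is at most its
    \<open>n\<close>-th power, and the mass of the ball cannot exceed \<open>T\<close>.\<close>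
  have rB: "r x \<le> max 1 (T / l)" if x: "x \<in> ?E" for x
  proof (cases "r x \<le> 1")
    case False
    have "ennreal (l * r x ^ ?n) \<le> ennreal T"
    proof -
      have "(\<integral>\<^sup>+y. h y * indicator (cball x (r x)) y \<partial>lborel) \<le> (\<integral>\<^sup>+y. h y \<partial>lborel)"
        by (rule nn_integral_mono) (simp add: indicator_def)
      then show ?thesis using r(2)[OF x] T(1) by simp
    qed
    then have "l * r x ^ ?n \<le> T" using T(2) by simp
    moreover have "r x \<le> r x ^ ?n" using False by (intro self_le_power) auto
    ultimately have "l * r x \<le> T" using l by (meson less_imp_le mult_left_mono order_trans)
    then have "r x \<le> T / l" using l by (simp add: field_simps)
    then show ?thesis by simp
  qed simp
  obtain C where C: "countable C" "C \<subseteq> ?E"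
     "pairwise (\<lambda>i j. disjnt (cball i (r i)) (cball j (r j))) C"
     "?E \<subseteq> (\<Union>i\<in>C. cball i (5 * r i))"
    by (rule Vitali_covering_lemma_cballs[where S = ?E and K = ?E and a = "\<lambda>x. x" and r = r and B = "max 1 (T / l)"])
       (use r rB in \<open>force+\<close>)
  define g where "g = from_nat_into C"
  define D where "D = to_nat_on C ` C"
  have gD: "g m \<in> C" if "m \<in> D" for m using that C(1) by (auto simp: g_def D_def)
  have g_inj: "m = m'" if "m \<in> D" "m' \<in> D" "g m = g m'" for m m'
    using that C(1) by (auto simp: g_def D_def)
  define X where "X m = (if m \<in> D then cball (g m) (r (g m)) else {})" for m
  define Y where "Y m = (if m \<in> D then cball (g m) (5 * r (g m)) else {})" for m
  have disj: "disjoint_family X"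
    unfolding disjoint_family_on_def
  proof safe
    fix m m' x assume ne: "m \<noteq> m'" and x: "x \<in> X m" "x \<in> X m'"
    then have D: "m \<in> D" "m' \<in> D" by (auto simp: X_def split: if_splits)
    then have "g m \<noteq> g m'" using g_inj ne by blast
    then have "disjnt (cball (g m) (r (g m))) (cball (g m') (r (g m')))"
      using C(3) gD D unfolding pairwise_def by blast
    then show "x \<in> {}" using x D by (auto simp: X_def disjnt_def)
  qed
  have "?E \<subseteq> (\<Union>m. Y m)"
  proof
    fix x assume "x \<in> ?E"
    then obtain i where i: "i \<in> C" "x \<in> cball i (5 * r i)" using C(4) by blast
    then have "x \<in> Y (to_nat_on C i)" using C(1) by (auto simp: Y_def D_def g_def)
    then show "x \<in> (\<Union>m. Y m)" by blast
  qed
  moreover have Ys: "range Y \<subseteq> sets lborel" by (auto simp: Y_def)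
  ultimately have "emeasure lborel ?E \<le> emeasure lborel (\<Union>m. Y m)" by (intro emeasure_mono) auto
  also have "\<dots> \<le> (\<Sum>m. emeasure lborel (Y m))" by (rule emeasure_subadditive_countably[OF Ys])
  also have "\<dots> \<le> (\<Sum>m. ennreal (?\<omega> * 5 ^ ?n / l) * emeasure (density lborel h) (X m))"
  proof (rule suminf_le)
    fix m
    show "emeasure lborel (Y m) \<le> ennreal (?\<omega> * 5 ^ ?n / l) * emeasure (density lborel h) (X m)"
    proof (cases "m \<in> D")
      case True
      let ?x = "g m"
      have x: "?x \<in> ?E" using gD[OF True] C(2) by blast
      have "emeasure lborel (Y m) = ennreal ((?\<omega> * 5 ^ ?n / l) * (l * r ?x ^ ?n))"
        using True r(1)[OF x] l by (simp add: Y_def emeasure_cball power_mult_distrib mult_ac)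
      also have "\<dots> = ennreal (?\<omega> * 5 ^ ?n / l) * ennreal (l * r ?x ^ ?n)"
        using l \<omega> r(1)[OF x] by (intro ennreal_mult) auto
      also have "\<dots> \<le> ennreal (?\<omega> * 5 ^ ?n / l) * emeasure (density lborel h) (X m)"
        using r(2)[OF x] True by (intro mult_left_mono) (auto simp: X_def emeasure_density)
      finally show ?thesis .
    qed (simp add: Y_def)
  qed auto
  also have "\<dots> = ennreal (?\<omega> * 5 ^ ?n / l) * (\<Sum>m. emeasure (density lborel h) (X m))" by simp
  also have "(\<Sum>m. emeasure (density lborel h) (X m)) = emeasure (density lborel h) (\<Union>m. X m)"
  proof (rule suminf_emeasure)
    show "range X \<subseteq> sets (density lborel h)" by (auto simp: X_def)
  qed (rule disj)
  also have "\<dots> \<le> emeasure (density lborel h) UNIV"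
    by (rule emeasure_mono) auto
  also have "\<dots> = (\<integral>\<^sup>+y. h y \<partial>lborel)" by (simp add: emeasure_density)
  finally show ?thesis by (simp add: mult_left_mono)
qed

text \<open>The layer-cake formula with the level written as \<open>exp (- t)\<close>, so that the
  integral runs over the whole line.\<close>

lemma layer_integral:
  assumes "s > 0" "a > 0"
  shows "(\<integral>\<^sup>+t. ennreal (s * exp (- s * t)) * indicator {t. exp (- t) \<le> a} t \<partial>lborel) = ennreal (a powr s)"
proof -
  have e: "{t. exp (- t) \<le> a} = {- ln a ..}"
    using assms(2) by (auto simp: ln_ge_iff[symmetric] minus_le_iff)
  have "((\<lambda>t. - exp (- s * t)) \<longlongrightarrow> - 0) at_top"
    using assms(1)
    by (intro tendsto_minus filterlim_compose[OF exp_at_bot]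
        filterlim_tendsto_neg_mult_at_bot[OF tendsto_const _ filterlim_ident]) auto
  then have "(\<integral>\<^sup>+t. ennreal (s * exp (- s * t)) * indicator {- ln a ..} t \<partial>lborel)
    = ennreal (- 0 - (- exp (- s * (- ln a))))"
    using assms(1) by (intro nn_integral_FTC_atLeast) (auto intro!: derivative_eq_intros)
  also have "\<dots> = ennreal (a powr s)" using assms(2) by (simp add: powr_def)
  finally show ?thesis unfolding e .
qed

lemma layer_integral_ennreal:
  assumes s: "s > 0"
  shows "(\<integral>\<^sup>+t. ennreal (s * exp (- s * t)) * (if ennreal (exp (- t)) \<le> a then 1 else 0) \<partial>lborel) = ennreal_rpow a s"
proof -
  have real: "(\<integral>\<^sup>+t. ennreal (s * exp (- s * t)) * (if ennreal (exp (- t)) \<le> ennreal x then 1 else 0) \<partial>lborel) = ennreal (x powr s)"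
    if x: "x \<ge> 0" for x
  proof (cases "x = 0")
    case False
    have "(\<lambda>t. ennreal (s * exp (- s * t)) * (if ennreal (exp (- t)) \<le> ennreal x then 1 else 0))
      = (\<lambda>t. ennreal (s * exp (- s * t)) * indicator {t. exp (- t) \<le> x} t)"
      using x by (auto simp: indicator_def fun_eq_iff)
    then show ?thesis using layer_integral[OF s, of x] False x by simp
  qed simp
  show ?thesis
  proof (cases a)
    case top
    let ?L = "\<integral>\<^sup>+t. ennreal (s * exp (- s * t)) * (if ennreal (exp (- t)) \<le> top then 1 else 0) \<partial>lborel"
    \<comment> \<open>For the value \<open>top\<close> the integral dominates the one for every
      finite value, hence every natural number.\<close>
    have "of_nat N \<le> ?L" for N
    proof -
      have "ennreal ((real N powr (1 / s)) powr s) \<le> ?L"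
        by (subst real[symmetric]) (auto intro!: nn_integral_mono)
      then show ?thesis using s by (cases "N = 0") (auto simp: powr_powr ennreal_of_nat_eq_real_of_nat)
    qed
    moreover have "\<exists>n. x < of_nat n" if "x \<noteq> top" for x :: ennreal
      using that ennreal_Ex_less_of_nat[of x] by (auto simp: less_top)
    ultimately have "?L = top" using leD by blast
    then show ?thesis using top by simp
  qed (use real in \<open>simp add: ennreal_rpow_ennreal\<close>)
qed

text \<open>Marcinkiewicz interpolation between the weak bound and the trivial bound for bounded
  functions: at level \<open>l\<close> the values of \<open>h\<close> below \<open>c * l\<close> are
  dropped, the weak bound is applied to the rest, and the levels are integrated by the layer-cake
  formula.\<close>

theorem maximal_op_strong_type:
  assumes s: "s > 1"
  shows "\<exists>C\<ge>0. \<forall>h::'a::euclidean_space \<Rightarrow> ennreal. h \<in> borel_measurable borel \<longrightarrow>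
    (\<integral>\<^sup>+x. ennreal_rpow (maximal_op h x) s \<partial>lborel) \<le> ennreal C * (\<integral>\<^sup>+x. ennreal_rpow (h x) s \<partial>lborel)"
proof -
  let ?n = "DIM('a)"
  define \<omega> where "\<omega> = unit_ball_vol (DIM('a))"
  have \<omega>: "\<omega> > 0" by (simp add: \<omega>_def)
  \<comment> \<open>With this \<open>c\<close> the dropped part contributes at most
    \<open>\<omega> * c * l = l / 4\<close> to the maximal function, so at level \<open>l\<close>
    the rest must exceed \<open>l / 4\<close>; this is the factor 4 in \<open>D\<close>.\<close>
  define c where "c = 1 / (4 * \<omega>)"
  have c: "c > 0" using \<omega> by (simp add: c_def)
  define D where "D = \<omega> * 5 ^ ?n * 4"
  have D: "D \<ge> 0" using \<omega> by (simp add: D_def)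
  have main: "(\<integral>\<^sup>+x. ennreal_rpow (maximal_op h x) s \<partial>lborel)
      \<le> ennreal (D * s / (s - 1) * (1 / c) powr (s - 1)) * (\<integral>\<^sup>+x. ennreal_rpow (h x) s \<partial>lborel)"
    if [measurable]: "h \<in> borel_measurable borel" for h :: "'a \<Rightarrow> ennreal"
  proof -
    let ?big = "\<lambda>l y. h y * (if ennreal (c * l) \<le> h y then 1 else 0)"
    have split: "maximal_op h x \<le> maximal_op (?big l) x + ennreal (\<omega> * (c * l))" if l: "l > 0" for l x
      unfolding maximal_op_def[of h]
    proof (rule SUP_least)
      fix r :: real assume "r \<in> {0<..}"
      then have r: "r > 0" by simp
      have [measurable]: "cball x r \<in> sets borel" by simp
      have "(\<integral>\<^sup>+y. h y * indicator (cball x r) y \<partial>lborel)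
          \<le> (\<integral>\<^sup>+y. ?big l y * indicator (cball x r) y + ennreal (c * l) * indicator (cball x r) y \<partial>lborel)"
        by (rule nn_integral_mono) (auto simp: indicator_def not_le)
      also have "\<dots> = (\<integral>\<^sup>+y. ?big l y * indicator (cball x r) y \<partial>lborel)
          + (\<integral>\<^sup>+y. ennreal (c * l) * indicator (cball x r) y \<partial>lborel)"
        by (rule nn_integral_add) measurable
      also have "(\<integral>\<^sup>+y. ennreal (c * l) * indicator (cball x r) y \<partial>lborel) = ennreal (c * l) * emeasure lborel (cball x r)"
        by (rule nn_integral_cmult_indicator) simp
      also have "emeasure lborel (cball x r) = ennreal (\<omega> * r ^ ?n)" using r by (simp add: emeasure_cball \<omega>_def)
      finally have "ennreal ((1 / r) ^ ?n) * (\<integral>\<^sup>+y. h y * indicator (cball x r) y \<partial>lborel)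
          \<le> ennreal ((1 / r) ^ ?n) * ((\<integral>\<^sup>+y. ?big l y * indicator (cball x r) y \<partial>lborel) + ennreal (c * l) * ennreal (\<omega> * r ^ ?n))"
        by (rule mult_left_mono) simp
      also have "\<dots> = ennreal ((1 / r) ^ ?n) * (\<integral>\<^sup>+y. ?big l y * indicator (cball x r) y \<partial>lborel) + ennreal (\<omega> * (c * l))"
        using r c l \<omega> by (simp add: distrib_left ennreal_mult[symmetric] power_divide mult_ac)
      also have "\<dots> \<le> maximal_op (?big l) x + ennreal (\<omega> * (c * l))"
        by (intro add_right_mono maximal_op_upper r)
      finally show "ennreal ((1 / r) ^ ?n) * (\<integral>\<^sup>+y. h y * indicator (cball x r) y \<partial>lborel)
        \<le> maximal_op (?big l) x + ennreal (\<omega> * (c * l))" .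
    qed
    have weak: "emeasure lborel {x. ennreal l \<le> maximal_op h x} \<le> ennreal (D / l) * (\<integral>\<^sup>+y. ?big l y \<partial>lborel)"
      if l: "l > 0" for l
    proof -
      have "{x. ennreal l \<le> maximal_op h x} \<subseteq> {x. ennreal (l / 4) < maximal_op (?big l) x}"
      proof safe
        fix x assume x: "ennreal l \<le> maximal_op h x"
        show "ennreal (l / 4) < maximal_op (?big l) x"
        proof (rule ccontr)
          assume "\<not> ?thesis"
          then have "maximal_op (?big l) x + ennreal (\<omega> * (c * l)) \<le> ennreal (l / 4) + ennreal (l / 4)"
            using \<omega> by (intro add_mono) (auto simp: c_def not_less)
          with x split[OF l, of x] have "ennreal l \<le> ennreal (l / 4) + ennreal (l / 4)" by (meson order_trans)
          also have "\<dots> = ennreal (l / 4 + l / 4)" using l by (intro ennreal_plus[symmetric]) auto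
          finally show False using l by (simp add: ennreal_le_iff)
        qed
      qed
      then have "emeasure lborel {x. ennreal l \<le> maximal_op h x} \<le> emeasure lborel {x. ennreal (l / 4) < maximal_op (?big l) x}"
        by (rule emeasure_mono) (simp add: open_maximal_op borel_open)
      also have "\<dots> \<le> ennreal (\<omega> * 5 ^ ?n / (l / 4)) * (\<integral>\<^sup>+y. ?big l y \<partial>lborel)"
        unfolding \<omega>_def using l by (intro maximal_op_weak_type) auto
      finally show ?thesis by (simp add: D_def)
    qed
    have "(\<integral>\<^sup>+x. ennreal_rpow (maximal_op h x) s \<partial>lborel)
        = (\<integral>\<^sup>+x. \<integral>\<^sup>+t. ennreal (s * exp (- s * t)) * (if ennreal (exp (- t)) \<le> maximal_op h x then 1 else 0) \<partial>lborel \<partial>lborel)"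
      using s by (subst layer_integral_ennreal) auto
    also have "\<dots> = (\<integral>\<^sup>+t. \<integral>\<^sup>+x. ennreal (s * exp (- s * t)) * (if ennreal (exp (- t)) \<le> maximal_op h x then 1 else 0) \<partial>lborel \<partial>lborel)"
      by (rule lborel_pair.Fubini') measurable
    also have "\<dots> \<le> (\<integral>\<^sup>+t. \<integral>\<^sup>+y. h y * (ennreal (D * s / (s - 1)) * (ennreal ((s - 1) * exp (- (s - 1) * t))
          * (if ennreal (c * exp (- t)) \<le> h y then 1 else 0))) \<partial>lborel \<partial>lborel)"
    proof (rule nn_integral_mono)
      fix t :: real
      have "(\<integral>\<^sup>+x. ennreal (s * exp (- s * t)) * (if ennreal (exp (- t)) \<le> maximal_op h x then 1 else 0) \<partial>lborel)
          = ennreal (s * exp (- s * t)) * emeasure lborel {x. ennreal (exp (- t)) \<le> maximal_op h x}"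
      proof -
        have "(\<lambda>x. ennreal (s * exp (- s * t)) * (if ennreal (exp (- t)) \<le> maximal_op h x then 1 else 0))
          = (\<lambda>x. ennreal (s * exp (- s * t)) * indicator {x. ennreal (exp (- t)) \<le> maximal_op h x} x)"
          by (auto simp: indicator_def fun_eq_iff)
        then show ?thesis by (simp add: nn_integral_cmult_indicator)
      qed
      also have "\<dots> \<le> ennreal (s * exp (- s * t)) * (ennreal (D / exp (- t)) * (\<integral>\<^sup>+y. ?big (exp (- t)) y \<partial>lborel))"
        by (intro mult_left_mono weak) auto
      also have "\<dots> = (\<integral>\<^sup>+y. (ennreal (s * exp (- s * t)) * ennreal (D / exp (- t))) * ?big (exp (- t)) y \<partial>lborel)"
        by (subst nn_integral_cmult) (auto simp: mult.assoc)
      \<comment> \<open>Regrouped as the layer-cake density of exponent \<open>s - 1\<close>, which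
        is positive by assumption.\<close>
      also have "ennreal (s * exp (- s * t)) * ennreal (D / exp (- t)) = ennreal (D * s / (s - 1)) * ennreal ((s - 1) * exp (- (s - 1) * t))"
      proof -
        have "(s * exp (- s * t)) * (D / exp (- t)) = (D * s / (s - 1)) * ((s - 1) * exp (- (s - 1) * t))"
          using s by (simp add: exp_minus exp_add[symmetric] algebra_simps exp_diff divide_simps)
        moreover have "D / exp (- t) \<ge> 0" "D * s / (s - 1) \<ge> 0" "s * exp (- s * t) \<ge> 0" "(s - 1) * exp (- (s - 1) * t) \<ge> 0"
          using s D by auto
        ultimately show ?thesis by (metis ennreal_mult)
      qed
      finally show "(\<integral>\<^sup>+x. ennreal (s * exp (- s * t)) * (if ennreal (exp (- t)) \<le> maximal_op h x then 1 else 0) \<partial>lborel)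
        \<le> (\<integral>\<^sup>+y. h y * (ennreal (D * s / (s - 1)) * (ennreal ((s - 1) * exp (- (s - 1) * t))
          * (if ennreal (c * exp (- t)) \<le> h y then 1 else 0))) \<partial>lborel)"
        by (simp add: mult_ac)
    qed
    also have "\<dots> = (\<integral>\<^sup>+y. \<integral>\<^sup>+t. h y * (ennreal (D * s / (s - 1)) * (ennreal ((s - 1) * exp (- (s - 1) * t))
          * (if ennreal (c * exp (- t)) \<le> h y then 1 else 0))) \<partial>lborel \<partial>lborel)"
      by (rule lborel_pair.Fubini') measurable
    also have "\<dots> = (\<integral>\<^sup>+y. ennreal (D * s / (s - 1) * (1 / c) powr (s - 1)) * ennreal_rpow (h y) s \<partial>lborel)"
    proof (rule nn_integral_cong)
      fix y
      have iff: "ennreal (c * exp (- t)) \<le> h y \<longleftrightarrow> ennreal (exp (- t)) \<le> ennreal (1 / c) * h y" for t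
      proof -
        have "ennreal (c * exp (- t)) \<le> h y \<longleftrightarrow> ennreal (1 / c) * ennreal (c * exp (- t)) \<le> ennreal (1 / c) * h y"
          using c by (simp add: ennreal_mult_le_mult_iff)
        also have "ennreal (1 / c) * ennreal (c * exp (- t)) = ennreal (exp (- t))"
          using c by (simp add: ennreal_mult[symmetric])
        finally show ?thesis .
      qed
      have "(\<integral>\<^sup>+t. h y * (ennreal (D * s / (s - 1)) * (ennreal ((s - 1) * exp (- (s - 1) * t))
          * (if ennreal (c * exp (- t)) \<le> h y then 1 else 0))) \<partial>lborel)
        = h y * (ennreal (D * s / (s - 1)) * ennreal_rpow (ennreal (1 / c) * h y) (s - 1))"
      proof -
        let ?F = "\<lambda>t. ennreal ((s - 1) * exp (- (s - 1) * t)) * (if ennreal (exp (- t)) \<le> ennreal (1 / c) * h y then 1 else 0)"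
        have F: "?F \<in> borel_measurable lborel" by measurable
        then have "(\<integral>\<^sup>+t. h y * (ennreal (D * s / (s - 1)) * ?F t) \<partial>lborel)
            = h y * (\<integral>\<^sup>+t. ennreal (D * s / (s - 1)) * ?F t \<partial>lborel)"
          by (intro nn_integral_cmult borel_measurable_times_ennreal) auto
        also have "(\<integral>\<^sup>+t. ennreal (D * s / (s - 1)) * ?F t \<partial>lborel) = ennreal (D * s / (s - 1)) * (\<integral>\<^sup>+t. ?F t \<partial>lborel)"
          by (rule nn_integral_cmult[OF F])
        also have "(\<integral>\<^sup>+t. ?F t \<partial>lborel) = ennreal_rpow (ennreal (1 / c) * h y) (s - 1)"
          using s by (intro layer_integral_ennreal) simp
        finally show ?thesis unfolding iff .
      qed
      also have "\<dots> = ennreal (D * s / (s - 1) * (1 / c) powr (s - 1)) * (h y * ennreal_rpow (h y) (s - 1))"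
      proof -
        have "ennreal (D * s / (s - 1) * (1 / c) powr (s - 1)) = ennreal (D * s / (s - 1)) * ennreal ((1 / c) powr (s - 1))"
          using D s by (intro ennreal_mult) auto
        then show ?thesis using c by (simp add: ennreal_rpow_mult ennreal_rpow_ennreal mult_ac)
      qed
      also have "h y * ennreal_rpow (h y) (s - 1) = ennreal_rpow (h y) s"
      proof (cases "h y")
        case (real x)
        have "x * x powr (s - 1) = x powr s"
          using real(1) by (cases "x = 0") (auto simp: powr_diff)
        then show ?thesis using real by (simp add: ennreal_rpow_ennreal ennreal_mult[symmetric])
      qed simp
      finally show "(\<integral>\<^sup>+t. h y * (ennreal (D * s / (s - 1)) * (ennreal ((s - 1) * exp (- (s - 1) * t))
          * (if ennreal (c * exp (- t)) \<le> h y then 1 else 0))) \<partial>lborel)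
        = ennreal (D * s / (s - 1) * (1 / c) powr (s - 1)) * ennreal_rpow (h y) s" .
    qed
    also have "\<dots> = ennreal (D * s / (s - 1) * (1 / c) powr (s - 1)) * (\<integral>\<^sup>+y. ennreal_rpow (h y) s \<partial>lborel)"
      by (rule nn_integral_cmult) measurable
    finally show ?thesis .
  qed
  moreover have "D * s / (s - 1) * (1 / c) powr (s - 1) \<ge> 0" using D s by simp
  ultimately show ?thesis by blast
qed

section \<open>Hajlasz functions\<close>

text \<open>Differs from \<open>admissible\<close> in that \<open>g\<close> is Borel and nonnegative
  everywhere and the range \<open>s\<close> is a parameter. The general codomain serves both the
  complex function itself and the real-valued supremum of its mollifications.\<close>

definition hajlasz :: "real \<Rightarrow> ('a::euclidean_space \<Rightarrow> 'b::real_normed_vector) \<Rightarrow> ('a \<Rightarrow> real) \<Rightarrow> bool"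
  where "hajlasz s v g \<longleftrightarrow> g \<in> borel_measurable borel \<and> (\<forall>x. g x \<ge> 0) \<and>
    (\<exists>E\<in>null_sets lborel. \<forall>x y. x \<notin> E \<longrightarrow> y \<notin> E \<longrightarrow> dist x y \<le> s \<longrightarrow>
      norm (v x - v y) \<le> dist x y * (g x + g y))"

lemma hajlasz_mono: "hajlasz s v g \<Longrightarrow> s' \<le> s \<Longrightarrow> hajlasz s' v g"
  unfolding hajlasz_def by (meson order_trans)

abbreviation pow_integral :: "real \<Rightarrow> ('a::euclidean_space \<Rightarrow> real) \<Rightarrow> ennreal"
  where "pow_integral p g \<equiv> \<integral>\<^sup>+x. ennreal (g x powr p) \<partial>lborel"

text \<open>If \<open>h\<close> exceeded twice its average almost everywhere on the ball,
  integration would give \<open>I = 0\<close>; then \<open>h\<close> vanishes almost everywhere on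
  the ball, against the strict inequality. Working almost everywhere lets the point avoid
  \<open>E\<close>.\<close>

lemma exists_le_average:
  fixes h :: "'a::euclidean_space \<Rightarrow> ennreal"
  assumes [measurable]: "h \<in> borel_measurable borel" and E: "E \<in> null_sets lborel" and r: "r > 0"
    and I: "(\<integral>\<^sup>+y. h y * indicator (cball z r) y \<partial>lborel) = ennreal I" "I \<ge> 0"
  shows "\<exists>y\<in>cball z r. y \<notin> E \<and> h y * ennreal (unit_ball_vol (DIM('a)) * r ^ DIM('a)) \<le> ennreal (2 * I)"
proof (rule ccontr)
  assume neg: "\<not> ?thesis"
  let ?V = "unit_ball_vol (DIM('a)) * r ^ DIM('a)"
  have V: "?V > 0" using r by simp
  have gt: "ennreal (2 * I) < h y * ennreal ?V" if "y \<in> cball z r" "y \<notin> E" for y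
    using neg that by (auto simp: not_le)
  have [measurable]: "cball z r \<in> sets borel" by simp
  have em: "emeasure lborel (cball z r) = ennreal ?V" using r by (simp add: emeasure_cball)
  have ae: "AE y in lborel. y \<notin> E" using E by (rule AE_not_in)
  have "ennreal (2 * I) * ennreal ?V = (\<integral>\<^sup>+y. ennreal (2 * I) * indicator (cball z r) y \<partial>lborel)"
    by (simp add: nn_integral_cmult_indicator em)
  also have "\<dots> \<le> (\<integral>\<^sup>+y. ennreal ?V * (h y * indicator (cball z r) y) \<partial>lborel)"
  proof (intro nn_integral_mono_AE, use ae in eventually_elim)
    fix y assume "y \<notin> E"
    then show "ennreal (2 * I) * indicator (cball z r) y \<le> ennreal ?V * (h y * indicator (cball z r) y)"
      using gt[of y] by (cases "y \<in> cball z r") (simp_all add: less_imp_le mult.commute[of "ennreal ?V"])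
  qed
  also have "\<dots> = ennreal ?V * ennreal I" by (subst nn_integral_cmult) (auto simp: I)
  finally have "2 * I * ?V \<le> ?V * I"
    using I(2) V by (simp add: ennreal_mult[symmetric])
  then have "(2 * I) * ?V \<le> I * ?V" by (simp only: mult.commute)
  then have "2 * I \<le> I" using V by (rule mult_right_le_imp_le)
  then have "I = 0" using I(2) by simp
  then have "AE y in lborel. h y * indicator (cball z r) y = 0"
  proof -
    have "(\<integral>\<^sup>+y. h y * indicator (cball z r) y \<partial>lborel) = 0" using I(1) \<open>I = 0\<close> by simp
    then show ?thesis by (subst (asm) nn_integral_0_iff_AE) auto
  qed
  with ae have "AE y in lborel. y \<notin> cball z r"
  proof eventually_elim
    case (elim y)
    then show ?case using gt[of y] \<open>I = 0\<close> by (auto simp: indicator_def split: if_splits)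
  qed
  then have "emeasure lborel (cball z r) = 0"
    by (subst (asm) AE_iff_measurable[of "cball z r"]) auto
  then show False using V unfolding em ennreal_eq_0_iff by linarith
qed

lemma exists_le_average_powr:
  fixes g :: "'a::euclidean_space \<Rightarrow> real"
  assumes g: "g \<in> borel_measurable borel" "\<And>x. g x \<ge> 0" and E: "E \<in> null_sets lborel" and r: "r > 0" and q: "q > 0"
    and J: "(\<integral>\<^sup>+y. ennreal (g y powr q) * indicator (cball z r) y \<partial>lborel) \<le> ennreal (r ^ DIM('a) * J)" "J \<ge> 0"
  shows "\<exists>y\<in>cball z r. y \<notin> E \<and> g y \<le> (2 * J / unit_ball_vol (DIM('a))) powr (1 / q)"
proof -
  let ?\<omega> = "unit_ball_vol (DIM('a))" and ?r = "r ^ DIM('a)"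
  have [measurable]: "g \<in> borel_measurable borel" by fact
  have \<omega>: "?\<omega> > 0" "?r > 0" using r by auto
  obtain I where I: "(\<integral>\<^sup>+y. ennreal (g y powr q) * indicator (cball z r) y \<partial>lborel) = ennreal I" "I \<ge> 0"
  proof -
    have "(\<integral>\<^sup>+y. ennreal (g y powr q) * indicator (cball z r) y \<partial>lborel) < top"
      using J(1) ennreal_less_top by (rule order_le_less_trans)
    then show ?thesis using that by (cases "\<integral>\<^sup>+y. ennreal (g y powr q) * indicator (cball z r) y \<partial>lborel") auto
  qed
  have IJ: "I \<le> ?r * J" using J I \<omega> by simp
  obtain y where y: "y \<in> cball z r" "y \<notin> E" "ennreal (g y powr q) * ennreal (?\<omega> * ?r) \<le> ennreal (2 * I)"
    using exists_le_average[OF _ E r I] by auto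
  then have "g y powr q * (?\<omega> * ?r) \<le> 2 * I" using I(2) \<omega> by (simp add: ennreal_mult[symmetric])
  also have "\<dots> \<le> 2 * (?r * J)" using IJ by simp
  finally have "g y powr q \<le> 2 * J / ?\<omega>" using \<omega> by (simp add: field_simps)
  then have "(g y powr q) powr (1 / q) \<le> (2 * J / ?\<omega>) powr (1 / q)" using q by (intro powr_mono2) auto
  then show ?thesis using y q g(2)[of y] by (auto simp: powr_powr)
qed

text \<open>Tonelli: a point \<open>y\<close> is counted for centres within distance
  \<open>t\<close> of it, a set of volume at most that of a ball of radius \<open>t\<close>, and
  such a \<open>y\<close> lies in the doubled ball because \<open>t \<le> r\<close>.\<close>

lemma nn_integral_cball_averages:
  fixes h :: "'a::euclidean_space \<Rightarrow> ennreal"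
  assumes [measurable]: "h \<in> borel_measurable borel" and r: "0 < t" "t \<le> r"
  shows "(\<integral>\<^sup>+x. (\<integral>\<^sup>+y. h y * indicator (cball x t) y \<partial>lborel) * indicator (cball z r) x \<partial>lborel)
    \<le> ennreal (unit_ball_vol (DIM('a)) * t ^ DIM('a)) * (\<integral>\<^sup>+y. h y * indicator (cball z (2 * r)) y \<partial>lborel)"
proof -
  let ?i = "\<lambda>x y. if dist x y \<le> t then 1 else (0::ennreal)"
  let ?j = "\<lambda>x. if dist z x \<le> r then 1 else (0::ennreal)"
  let ?k = "\<lambda>x. if dist z x \<le> 2 * r then 1 else (0::ennreal)"
  have ind: "indicator (cball x s) y = (if dist x y \<le> s then 1 else (0::ennreal))" for x y :: 'a and s
    by (simp add: indicator_def)
  have "(\<integral>\<^sup>+x. (\<integral>\<^sup>+y. h y * ?i x y \<partial>lborel) * ?j x \<partial>lborel) = (\<integral>\<^sup>+x. \<integral>\<^sup>+y. h y * ?i x y * ?j x \<partial>lborel \<partial>lborel)"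
    by (intro nn_integral_cong nn_integral_multc[symmetric]) measurable
  also have "\<dots> = (\<integral>\<^sup>+y. \<integral>\<^sup>+x. h y * ?i x y * ?j x \<partial>lborel \<partial>lborel)"
    by (rule lborel_pair.Fubini') measurable
  also have "\<dots> \<le> (\<integral>\<^sup>+y. ennreal (unit_ball_vol (DIM('a)) * t ^ DIM('a)) * (h y * ?k y) \<partial>lborel)"
  proof (rule nn_integral_mono)
    fix y
    have "(\<integral>\<^sup>+x. h y * ?i x y * ?j x \<partial>lborel) \<le> (\<integral>\<^sup>+x. (h y * ?k y) * indicator (cball y t) x \<partial>lborel)"
    proof (rule nn_integral_mono)
      fix x
      have "dist z y \<le> 2 * r" if "dist x y \<le> t" "dist z x \<le> r"
        using that r dist_triangle[of z y x] by linarith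
      then show "h y * ?i x y * ?j x \<le> (h y * ?k y) * indicator (cball y t) x"
        by (auto simp: indicator_def dist_commute)
    qed
    also have "\<dots> = (h y * ?k y) * ennreal (unit_ball_vol (DIM('a)) * t ^ DIM('a))"
      using r by (subst nn_integral_cmult_indicator) (auto simp: emeasure_cball)
    finally show "(\<integral>\<^sup>+x. h y * ?i x y * ?j x \<partial>lborel)
      \<le> ennreal (unit_ball_vol (DIM('a)) * t ^ DIM('a)) * (h y * ?k y)" by (simp add: mult.commute)
  qed
  also have "\<dots> = ennreal (unit_ball_vol (DIM('a)) * t ^ DIM('a)) * (\<integral>\<^sup>+y. h y * ?k y \<partial>lborel)"
    by (rule nn_integral_cmult) measurable
  finally show ?thesis unfolding ind .
qed

text \<open>Telescoping along good points \<open>X k\<close> that approach \<open>x\<close>. The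
  link from \<open>X m\<close> to \<open>x\<close> costs at most
  \<open>r * (1/2) ^ m * (g x + b m)\<close>, and \<open>g x\<close> is finite, so the pointwise
  inequality itself takes the place of a differentiation theorem. The constant 7 is 2 + 4 for the
  two ends of the links plus 1 for the last one.\<close>

lemma hajlasz_chain:
  fixes v :: "'a::euclidean_space \<Rightarrow> 'b::real_normed_vector"
  assumes E: "\<And>x y. x \<notin> E \<Longrightarrow> y \<notin> E \<Longrightarrow> dist x y \<le> s \<Longrightarrow> norm (v x - v y) \<le> dist x y * (g x + g y)"
    and g: "\<And>x. g x \<ge> 0" and r: "r > 0" "2 * r \<le> s" and x: "x \<notin> E"
    and X: "\<And>k. X k \<in> cball x (r * (1/2) ^ k)" "\<And>k. X k \<notin> E" "\<And>k. g (X k) \<le> b k"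
  shows "ennreal (norm (v x - v (X 0))) \<le> (\<Sum>k. ennreal (7 * r * (1/2) ^ k * b k))"
proof (cases "(\<Sum>k. ennreal (7 * r * (1/2) ^ k * b k)) = top")
  case False
  let ?c = "\<lambda>k. r * (1/2::real) ^ k"
  have b: "b k \<ge> 0" for k using g[of "X k"] X(3)[of k] by linarith
  have c: "?c k \<le> r" "?c k > 0" for k using r power_le_one[of "1/2::real" k] by auto
  obtain S where S: "(\<Sum>k. ennreal (7 * r * (1/2) ^ k * b k)) = ennreal S" "S \<ge> 0"
    using False by (cases "\<Sum>k. ennreal (7 * r * (1/2) ^ k * b k)") auto
  have bc: "?c k * b k \<ge> 0" for k using b[of k] r by simp
  have part: "(\<Sum>k\<le>m. 7 * r * (1/2) ^ k * b k) \<le> S" for m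
  proof -
    have "ennreal (\<Sum>k\<le>m. 7 * r * (1/2) ^ k * b k) = (\<Sum>k\<le>m. ennreal (7 * r * (1/2) ^ k * b k))"
      using b r by (intro sum_ennreal[symmetric]) auto
    also have "\<dots> \<le> ennreal S" unfolding S(1)[symmetric] by (rule sum_le_suminf) auto
    finally show ?thesis using S(2) by simp
  qed
  have step: "norm (v (X k) - v (X (Suc k))) \<le> 2 * ?c k * b k + 4 * ?c (Suc k) * b (Suc k)" for k
  proof -
    have d: "dist (X k) (X (Suc k)) \<le> 2 * ?c k"
    proof -
      have "dist (X k) (X (Suc k)) \<le> dist (X k) x + dist x (X (Suc k))" by (rule dist_triangle)
      also have "\<dots> \<le> ?c k + ?c (Suc k)" using X(1)[of k] X(1)[of "Suc k"] by (intro add_mono) (auto simp: dist_commute)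
      also have "\<dots> \<le> 2 * ?c k" using c(2)[of k] by simp
      finally show ?thesis .
    qed
    have "norm (v (X k) - v (X (Suc k))) \<le> dist (X k) (X (Suc k)) * (g (X k) + g (X (Suc k)))"
      using d c(1)[of k] r by (intro E X(2)) linarith
    also have "\<dots> \<le> (2 * ?c k) * (b k + b (Suc k))"
      using d c(2)[of k] X(3) g by (intro mult_mono add_mono) (auto intro: add_nonneg_nonneg)
    also have "\<dots> = 2 * ?c k * b k + 4 * ?c (Suc k) * b (Suc k)" by (simp add: algebra_simps)
    finally show ?thesis .
  qed
  have tele: "norm (v (X m) - v (X 0)) \<le> 6 * (\<Sum>k\<le>m. ?c k * b k)" for m
  proof -
    have "norm (v (X m) - v (X 0)) \<le> (\<Sum>k<m. norm (v (X k) - v (X (Suc k))))"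
    proof (induction m)
      case (Suc m)
      have "norm (v (X (Suc m)) - v (X 0)) \<le> norm (v (X (Suc m)) - v (X m)) + norm (v (X m) - v (X 0))"
        using norm_triangle_ineq[of "v (X (Suc m)) - v (X m)" "v (X m) - v (X 0)"] by simp
      then show ?case using Suc by (simp add: norm_minus_commute)
    qed simp
    also have "\<dots> \<le> (\<Sum>k<m. 2 * ?c k * b k + 4 * ?c (Suc k) * b (Suc k))" by (intro sum_mono step)
    also have "\<dots> = 2 * (\<Sum>k<m. ?c k * b k) + 4 * (\<Sum>k<m. ?c (Suc k) * b (Suc k))"
      by (simp only: sum.distrib sum_distrib_left mult.assoc)
    also have "(\<Sum>k<m. ?c k * b k) \<le> (\<Sum>k\<le>m. ?c k * b k)"
      by (intro sum_mono2) (use bc in auto)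
    also have "(\<Sum>k<m. ?c (Suc k) * b (Suc k)) \<le> (\<Sum>k\<le>m. ?c k * b k)"
    proof -
      have "(\<Sum>k<m. ?c (Suc k) * b (Suc k)) = (\<Sum>k\<in>Suc ` {..<m}. ?c k * b k)"
        by (subst sum.reindex) auto
      also have "\<dots> \<le> (\<Sum>k\<le>m. ?c k * b k)"
        by (intro sum_mono2) (use bc in auto)
      finally show ?thesis .
    qed
    finally show ?thesis by simp
  qed
  have "norm (v x - v (X 0)) \<le> r * (1/2) ^ m * g x + S" for m
  proof -
    have "norm (v x - v (X 0)) \<le> norm (v x - v (X m)) + norm (v (X m) - v (X 0))"
      using norm_triangle_ineq[of "v x - v (X m)" "v (X m) - v (X 0)"] by simp
    also have "norm (v x - v (X m)) \<le> ?c m * (g x + b m)"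
    proof -
      have "norm (v x - v (X m)) \<le> dist x (X m) * (g x + g (X m))"
        using X(1)[of m] c(1)[of m] r unfolding mem_cball by (intro E x X(2)) linarith
      also have "\<dots> \<le> ?c m * (g x + b m)"
        using X(1,3) g c(2)[of m] by (intro mult_mono add_mono) (auto intro: add_nonneg_nonneg)
      finally show ?thesis .
    qed
    also have "?c m * (g x + b m) + norm (v (X m) - v (X 0)) \<le> ?c m * g x + (?c m * b m + 6 * (\<Sum>k\<le>m. ?c k * b k))"
      using tele[of m] by (simp add: algebra_simps)
    also have "?c m * b m \<le> (\<Sum>k\<le>m. ?c k * b k)"
      by (rule member_le_sum[where f = "\<lambda>k. ?c k * b k"]) (use bc in auto)
    also have "(\<Sum>k\<le>m. ?c k * b k) + 6 * (\<Sum>k\<le>m. ?c k * b k) = (\<Sum>k\<le>m. 7 * r * (1/2) ^ k * b k)"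
    proof -
      have "(\<Sum>k\<le>m. 7 * r * (1/2) ^ k * b k) = 7 * (\<Sum>k\<le>m. ?c k * b k)"
        by (simp add: sum_distrib_left mult.assoc)
      then show ?thesis by simp
    qed
    also note part[of m]
    finally show ?thesis by simp
  qed
  moreover have "(\<lambda>m. r * (1/2) ^ m * g x + S) \<longlonglongrightarrow> r * 0 * g x + S"
    by (intro tendsto_intros LIMSEQ_power_zero) auto
  ultimately have "norm (v x - v (X 0)) \<le> r * 0 * g x + S" by (intro LIMSEQ_le_const) auto
  then show ?thesis unfolding S(1) by (simp add: ennreal_leI)
qed simp

text \<open>The condition on \<open>q\<close> makes the geometric series with ratio \<open>2 powr (n / q - n - 1)\<close> converge.\<close>

lemma hajlasz_poincare:
  assumes q: "0 < q" "q < 1" "real DIM('a) / (real DIM('a) + 1) < q"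
  shows "\<exists>C\<ge>0. \<forall>s (v :: 'a::euclidean_space \<Rightarrow> 'b::real_normed_vector) g z r J.
    hajlasz s v g \<longrightarrow> 0 < r \<longrightarrow> 4 * r \<le> s \<longrightarrow> J \<ge> 0 \<longrightarrow>
    (\<integral>\<^sup>+y. ennreal (g y powr q) * indicator (cball z (2 * r)) y \<partial>lborel) \<le> ennreal (r ^ DIM('a) * J) \<longrightarrow>
    (\<exists>c. (\<integral>\<^sup>+x. ennreal (norm (v x - c)) * indicator (cball z r) x \<partial>lborel) \<le> ennreal (C * (r * r ^ DIM('a)) * J powr (1 / q)))"
proof -
  let ?n = "DIM('a)"
  define \<omega> where "\<omega> = unit_ball_vol (DIM('a))"
  have \<omega>: "\<omega> > 0" by (simp add: \<omega>_def)
  define W where "W = (2 / \<omega>) powr (1 / q)"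
  have W: "W > 0" using \<omega> by (simp add: W_def)
  define e where "e = 2 powr (real ?n / q - real ?n - 1)"
  have e: "0 < e" "e < 1"
  proof -
    have "real ?n < q * (real ?n + 1)" using q(3) by (simp add: divide_less_eq split: if_splits)
    then have "real ?n / q < real ?n + 1" using q(1) by (simp add: divide_less_eq mult.commute)
    then show "e < 1" by (simp add: e_def powr_less_one)
  qed (simp add: e_def)
  define C where "C = W * \<omega> * (6 + 7 / (1 - e))"
  have C0: "C \<ge> 0" using W \<omega> e by (simp add: C_def)
  have "\<exists>c. (\<integral>\<^sup>+x. ennreal (norm (v x - c)) * indicator (cball z r) x \<partial>lborel) \<le> ennreal (C * (r * r ^ ?n) * J powr (1 / q))"
    if hj: "hajlasz s v g" and r: "0 < r" "4 * r \<le> s" and J: "J \<ge> 0"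
      "(\<integral>\<^sup>+y. ennreal (g y powr q) * indicator (cball z (2 * r)) y \<partial>lborel) \<le> ennreal (r ^ ?n * J)"
    for s g z r J and v :: "'a \<Rightarrow> 'b"
  proof -
    have gm[measurable]: "g \<in> borel_measurable borel" and g: "\<And>x. g x \<ge> 0" using hj by (auto simp: hajlasz_def)
    obtain E where E: "E \<in> null_sets lborel"
      "\<And>x y. x \<notin> E \<Longrightarrow> y \<notin> E \<Longrightarrow> dist x y \<le> s \<Longrightarrow> norm (v x - v y) \<le> dist x y * (g x + g y)"
      using hj unfolding hajlasz_def by blast
    let ?h = "\<lambda>y. ennreal (g y powr q)"
    define b where "b = (2 * J / \<omega>) powr (1 / q)"
    have b: "b = W * J powr (1 / q)" "b \<ge> 0" using J(1) \<omega> by (auto simp: b_def W_def powr_mult[symmetric])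
    have mono: "(\<integral>\<^sup>+y. ?h y * indicator (cball x t) y \<partial>lborel) \<le> ennreal (r ^ ?n * J)" if "cball x t \<subseteq> cball z (2 * r)" for x t
      by (rule order_trans[OF nn_integral_mono J(2)]) (use that in \<open>auto simp: indicator_def\<close>)
    obtain y0 where y0: "y0 \<in> cball z r" "y0 \<notin> E" "g y0 \<le> b"
      using exists_le_average_powr[OF gm g E(1) r(1) q(1) mono[of z r] J(1)] r
      by (auto simp: b_def \<omega>_def subset_iff)
    let ?t = "\<lambda>k. r * (1/2::real) ^ k"
    have t: "0 < ?t k" "?t k \<le> r" for k using r power_le_one[of "1/2::real" k] by auto
    let ?I = "\<lambda>k x. \<integral>\<^sup>+y. ?h y * indicator (cball x (?t k)) y \<partial>lborel"
    let ?c = "\<lambda>k. W * 2 powr (real k * (real ?n / q)) * J powr (1 / q - 1) / r ^ ?n"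
    have pw: "ennreal (norm (v x - v y0)) \<le> ennreal (6 * r * b) + (\<Sum>k. ennreal (7 * r * (1/2) ^ k * ?c k) * ?I k x)"
      if x: "x \<in> cball z r" "x \<notin> E" for x
    proof -
      have sub: "cball x (?t k) \<subseteq> cball z (2 * r)" for k
      proof
        fix y assume "y \<in> cball x (?t k)"
        then show "y \<in> cball z (2 * r)" using x t(2)[of k] dist_triangle[of z y x] by simp
      qed
      define i where "i k = enn2real (?I k x) / r ^ ?n" for k
      have fin: "?I k x \<le> ennreal (r ^ ?n * J)" for k by (rule mono[OF sub])
      have i: "?I k x = ennreal (r ^ ?n * i k)" "i k \<ge> 0" "i k \<le> J" for k
      proof -
        have "?I k x = ennreal (enn2real (?I k x))"
          using neq_top_trans[OF _ fin[of k]] by (simp add: less_top)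
        then show 1: "?I k x = ennreal (r ^ ?n * i k)" using r by (simp add: i_def)
        show 2: "i k \<ge> 0" using r by (simp add: i_def)
        have "r ^ ?n * i k \<le> r ^ ?n * J" using fin[of k] J(1) r unfolding 1 by simp
        then show "i k \<le> J" using r by simp
      qed
      have rn: "r ^ ?n * i k = ?t k ^ ?n * (2 ^ (k * ?n) * i k)" for k
        by (simp add: power_mult_distrib power_divide power_mult)
      let ?b = "\<lambda>k. (2 * (2 ^ (k * ?n) * i k) / \<omega>) powr (1 / q)"
      have "\<exists>y\<in>cball x (?t k). y \<notin> E \<and> g y \<le> ?b k" for k
        unfolding \<omega>_def
        by (rule exists_le_average_powr[OF gm g E(1) t(1) q(1)]) (use i(1,2)[of k] rn[of k] in auto)
      then obtain X where X: "\<And>k. X k \<in> cball x (?t k)" "\<And>k. X k \<notin> E" "\<And>k. g (X k) \<le> ?b k"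
        by metis
      \<comment> \<open>Linearization: as \<open>1 / q > 1\<close> and \<open>i k \<le> J\<close>,
        the power \<open>i k powr (1 / q)\<close> is at most
        \<open>J powr (1 / q - 1) * i k\<close>. The bound becomes linear in the local integral
        \<open>?I k x\<close> and can be integrated in \<open>x\<close>.\<close>
      have bk: "?b k \<le> ?c k * (r ^ ?n * i k)" for k
      proof -
        have "?b k = W * (2 powr (real k * (real ?n / q)) * i k powr (1 / q))"
          using i(2)[of k] \<omega> by (simp add: W_def powr_mult powr_divide powr_realpow[symmetric] powr_powr mult_ac)
        also have "i k powr (1 / q) = i k powr (1 / q - 1) * i k"
          using i(2)[of k] q by (cases "i k = 0") (auto simp: powr_diff)
        also have "\<dots> \<le> J powr (1 / q - 1) * i k"
          using i(2,3)[of k] q by (intro mult_right_mono powr_mono2) (auto simp: field_simps)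
        finally have "?b k \<le> W * (2 powr (real k * (real ?n / q)) * (J powr (1 / q - 1) * i k))"
          using W by (simp add: mult_left_mono)
        also have "\<dots> = ?c k * (r ^ ?n * i k)" using r by (simp add: mult_ac)
        finally show ?thesis .
      qed
      have "ennreal (norm (v x - v (X 0))) \<le> (\<Sum>k. ennreal (7 * r * (1/2) ^ k * ?b k))"
        by (rule hajlasz_chain[OF E(2) g r(1) _ x(2) X]) (use r in auto)
      also have "\<dots> \<le> (\<Sum>k. ennreal (7 * r * (1/2) ^ k * ?c k) * ?I k x)"
      proof (rule suminf_le)
        fix k
        have "ennreal (7 * r * (1/2) ^ k * ?b k) \<le> ennreal ((7 * r * (1/2) ^ k * ?c k) * (r ^ ?n * i k))"
          using mult_left_mono[OF bk[of k], of "7 * r * (1/2) ^ k"] r by (intro ennreal_leI) (simp add: mult.assoc)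
        also have "\<dots> = ennreal (7 * r * (1/2) ^ k * ?c k) * ?I k x"
          unfolding i(1) using r W i(2)[of k] by (intro ennreal_mult) auto
        finally show "ennreal (7 * r * (1/2) ^ k * ?b k) \<le> ennreal (7 * r * (1/2) ^ k * ?c k) * ?I k x" .
      qed auto
      finally have 1: "ennreal (norm (v x - v (X 0))) \<le> (\<Sum>k. ennreal (7 * r * (1/2) ^ k * ?c k) * ?I k x)" .
      have "g (X 0) \<le> b"
      proof -
        have "?b 0 \<le> b" unfolding b_def using i(2,3)[of 0] \<omega> q by (intro powr_mono2 divide_right_mono) auto
        then show ?thesis using X(3)[of 0] by linarith
      qed
      moreover have d: "dist (X 0) y0 \<le> 3 * r"
        using X(1)[of 0] x(1) y0(1) dist_triangle[of "X 0" y0 x] dist_triangle[of x y0 z]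
        by (simp add: dist_commute)
      ultimately have "norm (v (X 0) - v y0) \<le> (3 * r) * (b + b)"
        using r y0 X(2)[of 0] g by (intro order_trans[OF E(2)] mult_mono add_mono) (auto intro: add_nonneg_nonneg)
      then have 2: "ennreal (norm (v (X 0) - v y0)) \<le> ennreal (6 * r * b)" by (intro ennreal_leI) simp
      have "ennreal (norm (v x - v y0)) \<le> ennreal (norm (v (X 0) - v y0) + norm (v x - v (X 0)))"
        using norm_triangle_ineq[of "v x - v (X 0)" "v (X 0) - v y0"] by (intro ennreal_leI) simp
      also have "\<dots> = ennreal (norm (v (X 0) - v y0)) + ennreal (norm (v x - v (X 0)))" by simp
      also have "\<dots> \<le> ennreal (6 * r * b) + (\<Sum>k. ennreal (7 * r * (1/2) ^ k * ?c k) * ?I k x)"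
        using 1 2 by (rule add_mono[rotated])
      finally show ?thesis .
    qed
    have Im[measurable]: "?I k \<in> borel_measurable borel" for k
    proof -
      have "(\<lambda>x. \<integral>\<^sup>+y. ?h y * (if dist x y \<le> ?t k then 1 else 0) \<partial>lborel) \<in> borel_measurable borel"
        by measurable
      moreover have "?I k = (\<lambda>x. \<integral>\<^sup>+y. ?h y * (if dist x y \<le> ?t k then 1 else 0) \<partial>lborel)"
        by (simp add: indicator_def of_bool_def)
      ultimately show ?thesis by simp
    qed
    have cm[measurable]: "cball z r \<in> sets borel" by simp
    have ae: "AE x in lborel. x \<notin> E" using E(1) by (rule AE_not_in)
    have "(\<integral>\<^sup>+x. ennreal (norm (v x - v y0)) * indicator (cball z r) x \<partial>lborel)
        \<le> (\<integral>\<^sup>+x. ennreal (6 * r * b) * indicator (cball z r) x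
            + (\<Sum>k. ennreal (7 * r * (1/2) ^ k * ?c k) * (?I k x * indicator (cball z r) x)) \<partial>lborel)"
    proof (intro nn_integral_mono_AE, use ae in eventually_elim)
      fix x assume "x \<notin> E"
      then show "ennreal (norm (v x - v y0)) * indicator (cball z r) x \<le> ennreal (6 * r * b) * indicator (cball z r) x
            + (\<Sum>k. ennreal (7 * r * (1/2) ^ k * ?c k) * (?I k x * indicator (cball z r) x))"
        using pw[of x] by (cases "x \<in> cball z r") simp_all
    qed
    also have "\<dots> = (\<integral>\<^sup>+x. ennreal (6 * r * b) * indicator (cball z r) x \<partial>lborel)
        + (\<integral>\<^sup>+x. (\<Sum>k. ennreal (7 * r * (1/2) ^ k * ?c k) * (?I k x * indicator (cball z r) x)) \<partial>lborel)"
      by (rule nn_integral_add) measurable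
    also have "(\<integral>\<^sup>+x. ennreal (6 * r * b) * indicator (cball z r) x \<partial>lborel) = ennreal (6 * r * b) * ennreal (\<omega> * r ^ ?n)"
      using r by (subst nn_integral_cmult_indicator) (auto simp: emeasure_cball \<omega>_def)
    also have "\<dots> = ennreal (6 * W * \<omega> * (r * r ^ ?n) * J powr (1 / q))"
      using r b \<omega> W by (subst ennreal_mult[symmetric]) (simp_all add: mult_ac)
    also have "(\<integral>\<^sup>+x. (\<Sum>k. ennreal (7 * r * (1/2) ^ k * ?c k) * (?I k x * indicator (cball z r) x)) \<partial>lborel)
        = (\<Sum>k. \<integral>\<^sup>+x. ennreal (7 * r * (1/2) ^ k * ?c k) * (?I k x * indicator (cball z r) x) \<partial>lborel)"
      by (rule nn_integral_suminf) measurable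
    \<comment> \<open>The ratio \<open>e\<close> collects \<open>1/2\<close> from the step length,
      \<open>2 powr (n / q)\<close> from the averages on the small balls, and
      \<open>2 powr (- n)\<close> from integrating over the centres.\<close>
    also have "\<dots> \<le> (\<Sum>k. ennreal (7 * W * \<omega> * (r * r ^ ?n) * J powr (1 / q) * e ^ k))"
    proof (rule suminf_le)
      fix k
      have "(\<integral>\<^sup>+x. ennreal (7 * r * (1/2) ^ k * ?c k) * (?I k x * indicator (cball z r) x) \<partial>lborel)
          = ennreal (7 * r * (1/2) ^ k * ?c k) * (\<integral>\<^sup>+x. ?I k x * indicator (cball z r) x \<partial>lborel)"
        by (rule nn_integral_cmult) measurable
      also have "\<dots> \<le> ennreal (7 * r * (1/2) ^ k * ?c k) * (ennreal (\<omega> * ?t k ^ ?n) * ennreal (r ^ ?n * J))"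
        unfolding \<omega>_def using t J(2)
        by (intro mult_left_mono order_trans[OF nn_integral_cball_averages]) auto
      also have "\<dots> = ennreal ((7 * r * (1/2) ^ k * ?c k) * ((\<omega> * ?t k ^ ?n) * (r ^ ?n * J)))"
        using r W \<omega> J(1) by (simp add: ennreal_mult[symmetric])
      also have "(7 * r * (1/2) ^ k * ?c k) * ((\<omega> * ?t k ^ ?n) * (r ^ ?n * J))
          = 7 * W * \<omega> * (r * r ^ ?n) * (J powr (1 / q - 1) * J) * ((1/2) ^ k * 2 powr (real k * (real ?n / q)) * (1/2) ^ (k * ?n))"
        using r by (simp add: power_mult_distrib power_mult mult_ac)
      also have "J powr (1 / q - 1) * J = J powr (1 / q)"
        using J(1) by (cases "J = 0") (auto simp: powr_diff)
      also have "(1/2) ^ k * 2 powr (real k * (real ?n / q)) * (1/2) ^ (k * ?n) = e ^ k"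
      proof -
        have "e ^ k = 2 powr (real k * (real ?n / q - real ?n - 1))"
          by (simp add: e_def powr_realpow[symmetric] powr_powr mult.commute)
        also have "\<dots> = 2 powr (real k * (real ?n / q)) * (2 powr (- real (k * ?n)) * 2 powr (- real k))"
          by (simp add: powr_add[symmetric] algebra_simps)
        also have "2 powr (- real (k * ?n)) = (1/2) ^ (k * ?n)" by (simp add: powr_minus powr_realpow power_one_over inverse_eq_divide del: of_nat_mult)
        also have "2 powr (- real k) = (1/2) ^ k" by (simp add: powr_minus powr_realpow power_one_over inverse_eq_divide)
        finally show ?thesis by (simp add: mult_ac)
      qed
      finally show "(\<integral>\<^sup>+x. ennreal (7 * r * (1/2) ^ k * ?c k) * (?I k x * indicator (cball z r) x) \<partial>lborel)
        \<le> ennreal (7 * W * \<omega> * (r * r ^ ?n) * J powr (1 / q) * e ^ k)" .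
    qed auto
    also have "(\<Sum>k. ennreal (7 * W * \<omega> * (r * r ^ ?n) * J powr (1 / q) * e ^ k))
        = ennreal (7 * W * \<omega> * (r * r ^ ?n) * J powr (1 / q) * (1 / (1 - e)))"
      using r W \<omega> e by (intro suminf_ennreal_eq sums_mult geometric_sums) auto
    also have "ennreal (6 * W * \<omega> * (r * r ^ ?n) * J powr (1 / q)) + ennreal (7 * W * \<omega> * (r * r ^ ?n) * J powr (1 / q) * (1 / (1 - e)))
        = ennreal (C * (r * r ^ ?n) * J powr (1 / q))"
      using r W \<omega> e by (simp add: C_def ennreal_plus[symmetric] algebra_simps del: ennreal_plus)
    finally show ?thesis by (auto simp: add_left_mono)
  qed
  then show ?thesis using C0 by blast
qed

text \<open>The strong-type bound with exponent \<open>p / q > 1\<close>, applied to the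
  \<open>q\<close>-th power of \<open>H\<close>.\<close>

lemma pow_integral_maximal:
  assumes "0 < q" "q < p"
  shows "\<exists>C\<ge>0. \<forall>H :: 'a::euclidean_space \<Rightarrow> ennreal. H \<in> borel_measurable borel \<longrightarrow>
    (\<integral>\<^sup>+x. ennreal_rpow (ennreal_rpow (maximal_op (\<lambda>y. ennreal_rpow (H y) q) x) (1 / q)) p \<partial>lborel)
    \<le> ennreal C * (\<integral>\<^sup>+x. ennreal_rpow (H x) p \<partial>lborel)"
proof -
  obtain C where C: "C \<ge> 0" "\<And>h :: 'a \<Rightarrow> ennreal. h \<in> borel_measurable borel \<Longrightarrow>
    (\<integral>\<^sup>+x. ennreal_rpow (maximal_op h x) (p / q) \<partial>lborel) \<le> ennreal C * (\<integral>\<^sup>+x. ennreal_rpow (h x) (p / q) \<partial>lborel)"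
    using maximal_op_strong_type[of "p / q"] assms by auto
  show ?thesis
    using C(1) C(2)[of "\<lambda>y. ennreal_rpow (_ y) q"] assms
    by (intro exI[of _ C]) (auto simp: ennreal_rpow_rpow)
qed

text \<open>For distances between \<open>s\<close> and \<open>3/2 * s\<close> pass through a point
  \<open>w\<close> near the midpoint, where \<open>g\<close> is at most a multiple of its
  \<open>q\<close>-average; that average is controlled by the maximal function at \<open>x\<close>.
  The ball of radius \<open>s / 4\<close> around the midpoint lies within \<open>s\<close> of both
  ends, because \<open>3/4 + 1/4 = 1\<close>.\<close>

lemma hajlasz_extend_step:
  assumes q: "0 < q" "q < p" and s: "s > 0"
  shows "\<exists>C\<ge>0. \<forall>(v :: 'a::euclidean_space \<Rightarrow> 'b::real_normed_vector) g.
    hajlasz s v g \<longrightarrow> pow_integral p g < top \<longrightarrow>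
    (\<exists>g'. hajlasz (3/2 * s) v g' \<and> pow_integral p g' \<le> ennreal C * pow_integral p g)"
proof -
  let ?n = "DIM('a)"
  define \<omega> where "\<omega> = unit_ball_vol (DIM('a))"
  have \<omega>: "\<omega> > 0" by (simp add: \<omega>_def)
  \<comment> \<open>The factor \<open>4 ^ ?n\<close> compares the ball of radius
    \<open>s / 4\<close> with the one of radius \<open>s\<close>; the outer 2 is there because
    \<open>g w\<close> occurs in both legs.\<close>
  define W where "W = 2 * (2 * 4 ^ ?n / \<omega>) powr (1 / q)"
  have W: "W \<ge> 0" by (simp add: W_def)
  obtain C where C: "C \<ge> 0" "\<And>H :: 'a \<Rightarrow> ennreal. H \<in> borel_measurable borel \<Longrightarrow>
    (\<integral>\<^sup>+x. ennreal_rpow (ennreal_rpow (maximal_op (\<lambda>y. ennreal_rpow (H y) q) x) (1 / q)) p \<partial>lborel)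
    \<le> ennreal C * (\<integral>\<^sup>+x. ennreal_rpow (H x) p \<partial>lborel)"
    using pow_integral_maximal[OF q] by blast
  have p: "p > 0" using q by simp
  define D where "D = 2 powr p * (1 + W powr p * C)"
  have "\<exists>g'. hajlasz (3/2 * s) v g' \<and> pow_integral p g' \<le> ennreal D * pow_integral p g"
    if hj: "hajlasz s v g" and fin: "pow_integral p g < top" for v :: "'a \<Rightarrow> 'b" and g
  proof -
    have gm[measurable]: "g \<in> borel_measurable borel" and g: "\<And>x. g x \<ge> 0" using hj by (auto simp: hajlasz_def)
    obtain E where E: "E \<in> null_sets lborel"
      "\<And>x y. x \<notin> E \<Longrightarrow> y \<notin> E \<Longrightarrow> dist x y \<le> s \<Longrightarrow> norm (v x - v y) \<le> dist x y * (g x + g y)"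
      using hj unfolding hajlasz_def by blast
    let ?h = "\<lambda>y. ennreal (g y powr q)"
    let ?M = "maximal_op ?h"
    have Mint: "(\<integral>\<^sup>+x. ennreal_rpow (ennreal_rpow (?M x) (1 / q)) p \<partial>lborel) \<le> ennreal C * pow_integral p g"
      using C(2)[of "\<lambda>x. ennreal (g x)"] by (simp add: ennreal_rpow_ennreal g)
    also have "\<dots> < top" using fin by (simp add: ennreal_mult_less_top)
    finally have Mfin: "AE x in lborel. ennreal_rpow (ennreal_rpow (?M x) (1 / q)) p \<noteq> \<infinity>"
      by (intro nn_integral_noteq_infinite) auto
    \<comment> \<open>Where the maximal function is infinite, \<open>enn2real\<close> returns 0, so
      this null set has to join the exceptional set.\<close>
    define N where "N = {x. ?M x = top}"
    have N: "N \<in> null_sets lborel"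
    proof (rule AE_iff_null_sets[THEN iffD2])
      show "AE x in lborel. x \<notin> N" using Mfin by (auto simp: N_def elim!: eventually_mono)
      show "N \<in> sets lborel" unfolding N_def by simp
    qed
    define m where "m x = enn2real (ennreal_rpow (?M x) (1 / q))" for x
    have m[measurable]: "m \<in> borel_measurable borel" unfolding m_def by measurable
    have m0: "m x \<ge> 0" for x by (simp add: m_def)
    define g' where "g' x = g x + W * m x" for x
    have "hajlasz (3/2 * s) v g'"
      unfolding hajlasz_def
    proof (intro conjI allI bexI[of _ "E \<union> N"] impI)
      show "g' \<in> borel_measurable borel" unfolding g'_def by measurable
      show "g' x \<ge> 0" for x using g W m0 by (simp add: g'_def)
      show "E \<union> N \<in> null_sets lborel" using E(1) N by auto
      fix x y assume x: "x \<notin> E \<union> N" and y: "y \<notin> E \<union> N" and d: "dist x y \<le> 3/2 * s"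
      have gg': "g x \<le> g' x" for x using W m0 by (simp add: g'_def)
      show "norm (v x - v y) \<le> dist x y * (g' x + g' y)"
      proof (cases "dist x y \<le> s")
        case True
        then have "norm (v x - v y) \<le> dist x y * (g x + g y)" using E(2) x y by blast
        also have "\<dots> \<le> dist x y * (g' x + g' y)" by (intro mult_left_mono add_mono gg') auto
        finally show ?thesis .
      next
        case False
        let ?z = "midpoint x y"
        obtain J where J: "?M x = ennreal J" "J \<ge> 0" using x by (auto simp: N_def intro: ennreal_cases)
        have "cball ?z (s / 4) \<subseteq> cball x s"
        proof
          fix w assume "w \<in> cball ?z (s / 4)"
          then show "w \<in> cball x s" using dist_midpoint(1)[of x y] dist_triangle[of x w ?z] d s by simp
        qed
        then have "(\<integral>\<^sup>+y. ?h y * indicator (cball ?z (s / 4)) y \<partial>lborel) \<le> (\<integral>\<^sup>+y. ?h y * indicator (cball x s) y \<partial>lborel)"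
          by (intro nn_integral_mono) (auto simp: indicator_def)
        also have "\<dots> \<le> ennreal (s ^ ?n) * ?M x" by (rule maximal_op_integral_le[OF s])
        also have "\<dots> = ennreal ((s / 4) ^ ?n * (4 ^ ?n * J))"
          using J s by (simp add: ennreal_mult[symmetric] power_divide)
        finally obtain w where w: "w \<in> cball ?z (s / 4)" "w \<notin> E" "g w \<le> (2 * (4 ^ ?n * J) / \<omega>) powr (1 / q)"
          using exists_le_average_powr[OF gm g E(1) _ q(1), of "s / 4" ?z "4 ^ ?n * J"] J s by (auto simp: \<omega>_def)
        have "2 * g w \<le> W * m x"
        proof -
          have "m x = J powr (1 / q)" using J by (simp add: m_def ennreal_rpow_ennreal)
          then show ?thesis using w(3) J(2) \<omega> by (simp add: W_def powr_mult powr_divide mult_ac)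
        qed
        have dx: "dist x w \<le> s" and dy: "dist w y \<le> s"
          using w(1) dist_midpoint(1,2)[of x y] dist_midpoint(3,4)[of x y]
            dist_triangle[of x w ?z] dist_triangle[of w y ?z] d s by (auto simp: dist_commute)
        have "norm (v x - v y) \<le> norm (v x - v w) + norm (v w - v y)"
          using norm_triangle_ineq[of "v x - v w" "v w - v y"] by simp
        also have "\<dots> \<le> dist x w * (g x + g w) + dist w y * (g w + g y)"
          using E(2)[of x w] E(2)[of w y] x y w(2) dx dy by (intro add_mono) auto
        also have "dist x w * (g x + g w) + dist w y * (g w + g y) \<le> s * (g x + g w) + s * (g w + g y)"
          using dx dy g by (intro add_mono mult_right_mono) auto
        also have "\<dots> = s * (g x + 2 * g w + g y)" by (simp add: algebra_simps)
        also have "\<dots> \<le> dist x y * (g x + 2 * g w + g y)"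
          using False g by (intro mult_right_mono) (auto intro: add_nonneg_nonneg)
        also have "\<dots> \<le> dist x y * (g' x + g' y)"
          using \<open>2 * g w \<le> W * m x\<close> gg'[of y] by (intro mult_left_mono) (auto simp: g'_def)
        finally show ?thesis .
      qed
    qed
    moreover have "pow_integral p g' \<le> ennreal D * pow_integral p g"
    proof -
      have "pow_integral p g' \<le> (\<integral>\<^sup>+x. ennreal (2 powr p) * (ennreal (g x powr p) + ennreal (W powr p) * ennreal_rpow (ennreal_rpow (?M x) (1 / q)) p) \<partial>lborel)"
      proof (rule nn_integral_mono)
        fix x
        have "ennreal (g' x) \<le> ennreal (g x) + ennreal W * ennreal_rpow (?M x) (1 / q)"
        proof -
          have "ennreal (g' x) = ennreal (g x) + ennreal W * ennreal (m x)"
            using g m0 W by (simp add: g'_def ennreal_mult)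
          moreover have "ennreal (m x) \<le> ennreal_rpow (?M x) (1 / q)"
            unfolding m_def by (cases "ennreal_rpow (?M x) (1 / q) = top") (auto simp: less_top)
          ultimately show ?thesis by (simp add: mult_left_mono)
        qed
        then have "ennreal_rpow (ennreal (g' x)) p \<le> ennreal_rpow (ennreal (g x) + ennreal W * ennreal_rpow (?M x) (1 / q)) p"
          using p by (intro ennreal_rpow_mono) auto
        also have "\<dots> \<le> ennreal (2 powr p) * (ennreal_rpow (ennreal (g x)) p + ennreal_rpow (ennreal W * ennreal_rpow (?M x) (1 / q)) p)"
          using p by (intro ennreal_rpow_add_le) auto
        finally have *: "ennreal_rpow (ennreal (g' x)) p
          \<le> ennreal (2 powr p) * (ennreal_rpow (ennreal (g x)) p + ennreal_rpow (ennreal W * ennreal_rpow (?M x) (1 / q)) p)" .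
        show "ennreal (g' x powr p) \<le> ennreal (2 powr p) * (ennreal (g x powr p) + ennreal (W powr p) * ennreal_rpow (ennreal_rpow (?M x) (1 / q)) p)"
        proof -
          have "g' x \<ge> 0" using g m0 W by (simp add: g'_def)
          then show ?thesis
            using * by (simp only: ennreal_rpow_mult ennreal_rpow_ennreal[OF g] ennreal_rpow_ennreal[OF W] ennreal_rpow_ennreal)
        qed
      qed
      also have "\<dots> = ennreal (2 powr p) * (pow_integral p g + ennreal (W powr p) * (\<integral>\<^sup>+x. ennreal_rpow (ennreal_rpow (?M x) (1 / q)) p \<partial>lborel))"
        by (simp add: nn_integral_cmult nn_integral_add)
      also have "\<dots> \<le> ennreal (2 powr p) * (pow_integral p g + ennreal (W powr p) * (ennreal C * pow_integral p g))"
        by (intro mult_left_mono add_left_mono Mint) auto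
      also have "\<dots> = ennreal D * pow_integral p g"
        using C(1) by (simp add: D_def ennreal_mult ennreal_plus distrib_left distrib_right mult.assoc)
      finally show ?thesis .
    qed
    ultimately show ?thesis by blast
  qed
  moreover have "D \<ge> 0" using C(1) by (simp add: D_def)
  ultimately show ?thesis by blast
qed

text \<open>The number of steps depends on \<open>S / s\<close> only, so the product of their
  constants does not depend on \<open>v\<close> and \<open>g\<close>.\<close>

lemma hajlasz_extend:
  assumes q: "0 < q" "q < p" and s: "s > 0"
  shows "\<exists>C\<ge>0. \<forall>(v :: 'a::euclidean_space \<Rightarrow> 'b::real_normed_vector) g.
    hajlasz s v g \<longrightarrow> pow_integral p g < top \<longrightarrow>
    (\<exists>g'. hajlasz S v g' \<and> pow_integral p g' \<le> ennreal C * pow_integral p g)"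
proof -
  have "\<exists>C\<ge>0. \<forall>(v :: 'a \<Rightarrow> 'b) g. hajlasz s v g \<longrightarrow> pow_integral p g < top \<longrightarrow>
    (\<exists>g'. hajlasz ((3/2) ^ m * s) v g' \<and> pow_integral p g' \<le> ennreal C * pow_integral p g)" for m
  proof (induction m)
    case 0
    show ?case by (intro exI[of _ 1]) auto
  next
    case (Suc m)
    then obtain C where C: "C \<ge> 0" "\<And>(v :: 'a \<Rightarrow> 'b) g. hajlasz s v g \<Longrightarrow> pow_integral p g < top \<Longrightarrow>
      (\<exists>g'. hajlasz ((3/2) ^ m * s) v g' \<and> pow_integral p g' \<le> ennreal C * pow_integral p g)" by blast
    have "(3/2) ^ m * s > 0" using s by simp
    then obtain D where D: "D \<ge> 0" "\<And>(v :: 'a \<Rightarrow> 'b) g. hajlasz ((3/2) ^ m * s) v g \<Longrightarrow> pow_integral p g < top \<Longrightarrow>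
      (\<exists>g'. hajlasz (3/2 * ((3/2) ^ m * s)) v g' \<and> pow_integral p g' \<le> ennreal D * pow_integral p g)"
      using hajlasz_extend_step[OF q] by blast
    have "\<exists>g'. hajlasz ((3/2) ^ Suc m * s) v g' \<and> pow_integral p g' \<le> ennreal (D * C) * pow_integral p g"
      if v: "hajlasz s v g" "pow_integral p g < top" for v :: "'a \<Rightarrow> 'b" and g
    proof -
      obtain g1 where g1: "hajlasz ((3/2) ^ m * s) v g1" "pow_integral p g1 \<le> ennreal C * pow_integral p g"
        using C(2)[OF v] by blast
      have "pow_integral p g1 < top" using g1(2) v(2) by (simp add: ennreal_mult_less_top order_le_less_trans)
      then obtain g2 where g2: "hajlasz (3/2 * ((3/2) ^ m * s)) v g2" "pow_integral p g2 \<le> ennreal D * pow_integral p g1"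
        using D(2)[OF g1(1)] by blast
      have "pow_integral p g2 \<le> ennreal D * (ennreal C * pow_integral p g)"
        using g2(2) g1(2) by (meson mult_left_mono order_trans zero_le)
      then show ?thesis using g2(1) C(1) D(1) by (auto simp: ennreal_mult mult.assoc)
    qed
    then show ?case using C(1) D(1) by (intro exI[of _ "D * C"]) auto
  qed
  moreover obtain m where "S / s < (3/2) ^ m" using real_arch_pow[of "3/2" "S / s"] by auto
  then have "S \<le> (3/2) ^ m * s" using s by (simp add: divide_less_eq)
  ultimately show ?thesis using hajlasz_mono by meson
qed

section \<open>From Hajlasz functions to Hardy spaces\<close>

lemma deriv_bound_test_weighted:
  assumes "\<phi> \<in> test_in R" "R \<ge> 0" "deriv_bound k A \<phi>" "length js \<le> k"
  shows "(1 + norm x) ^ m * norm (iterated_partial js \<phi> x) \<le> (1 + R) ^ m * A"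
proof (cases "norm x \<le> R")
  case True
  then have "(1 + norm x) ^ m \<le> (1 + R) ^ m" by (intro power_mono) auto
  then show ?thesis using deriv_boundD[OF assms(3,4)] assms(2) by (intro mult_mono) auto
next
  case False
  then have "iterated_partial js \<phi> x = 0" by (intro test_in_zero[OF test_in_iterated_partial[OF assms(1)]]) simp
  then show ?thesis using assms(2) deriv_bound_nonneg[OF assms(3)] by simp
qed

lemma test_in_schwartz:
  assumes "\<phi> \<in> test_in R" shows "\<phi> \<in> schwartz_functions"
proof -
  have \<phi>: "\<phi> \<in> test_in (max R 0)" by (rule test_in_mono[OF assms]) simp
  have "bounded (range (\<lambda>x. (1 + norm x) ^ k *\<^sub>R iterated_partial js \<phi> x))" for k js
  proof -
    obtain A where A: "A \<ge> 0" "deriv_bound (length js) A \<phi>" using deriv_bound_ex[OF \<phi>] .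
    show ?thesis
      unfolding bounded_iff
      using deriv_bound_test_weighted[OF \<phi> _ A(2), of js _ k]
      by (intro exI[of _ "(1 + max R 0) ^ k * A"]) auto
  qed
  then show ?thesis using test_in_smooth[OF assms] by (simp add: schwartz_functions_def)
qed

lemma schwartz_seminorm_bdd:
  fixes \<phi> :: "real^'n::finite \<Rightarrow> complex"
  assumes "\<phi> \<in> schwartz_functions"
  shows "bdd_above ((\<lambda>(js, x). (1 + norm x) ^ k * norm (iterated_partial js \<phi> x)) ` ({js. length js \<le> k} \<times> UNIV))"
proof -
  have "\<exists>B\<ge>0. \<forall>x. (1 + norm x) ^ k * norm (iterated_partial js \<phi> x) \<le> B" for js
  proof -
    have "bounded (range (\<lambda>x. (1 + norm x) ^ k *\<^sub>R iterated_partial js \<phi> x))"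
      using assms by (auto simp: schwartz_functions_def)
    then obtain B where "\<And>x. norm ((1 + norm x) ^ k *\<^sub>R iterated_partial js \<phi> x) \<le> B"
      unfolding bounded_iff by blast
    then have "(1 + norm x) ^ k * norm (iterated_partial js \<phi> x) \<le> max B 0" for x
      by (auto simp: le_max_iff_disj)
    then show ?thesis by (meson max.cobounded2)
  qed
  then obtain B where B: "\<And>js. B js \<ge> 0" "\<And>js x. (1 + norm x) ^ k * norm (iterated_partial js \<phi> x) \<le> B js" by metis
  have fin: "finite {js :: 'n list. length js \<le> k}"
    using finite_lists_length_le[of "UNIV :: 'n set" k] by simp
  show ?thesis
  proof (rule bdd_aboveI2, clarify)
    fix js :: "'n list" and x assume "length js \<le> k"
    then have "B js \<le> sum B {js. length js \<le> k}" using fin B(1) by (intro member_le_sum) auto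
    then show "(1 + norm x) ^ k * norm (iterated_partial js \<phi> x) \<le> sum B {js. length js \<le> k}"
      using B(2)[of x js] by linarith
  qed
qed

lemma schwartz_seminorm_upper:
  assumes "\<phi> \<in> schwartz_functions" "length js \<le> k"
  shows "(1 + norm x) ^ k * norm (iterated_partial js \<phi> x) \<le> schwartz_seminorm k \<phi>"
  unfolding schwartz_seminorm_def
  using cSUP_upper[OF _ schwartz_seminorm_bdd[OF assms(1)], of "(js, x)" k] assms(2) by simp

lemma schwartz_seminorm_least:
  assumes "\<And>js x. length js \<le> k \<Longrightarrow> (1 + norm x) ^ k * norm (iterated_partial js \<phi> x) \<le> A"
  shows "schwartz_seminorm k \<phi> \<le> A"
  unfolding schwartz_seminorm_def by (rule cSUP_least) (use assms in \<open>auto intro: exI[of _ "[]"]\<close>)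

lemma schwartz_seminorm_nonneg: "\<phi> \<in> schwartz_functions \<Longrightarrow> schwartz_seminorm k \<phi> \<ge> 0"
  by (rule order_trans[OF _ schwartz_seminorm_upper[of \<phi> "[]" k 0]]) auto

lemma schwartz_partial_derivative:
  assumes "\<phi> \<in> schwartz_functions" shows "partial_derivative j \<phi> \<in> schwartz_functions"
  using assms smooth_partial_derivative[of \<phi> j] by (auto simp: schwartz_functions_def iterated_partial_snoc)

lemma tempered_bound:
  assumes "f \<in> tempered_distributions"
  obtains C k where "C \<ge> 0" "\<And>\<phi>. \<phi> \<in> schwartz_functions \<Longrightarrow> norm (f \<phi>) \<le> C * schwartz_seminorm k \<phi>"
proof -
  obtain C k where C: "\<And>\<phi>. \<phi> \<in> schwartz_functions \<Longrightarrow> norm (f \<phi>) \<le> C * schwartz_seminorm k \<phi>"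
    using assms unfolding tempered_distributions_def by blast
  have "norm (f \<phi>) \<le> \<bar>C\<bar> * schwartz_seminorm k \<phi>" if "\<phi> \<in> schwartz_functions" for \<phi>
    using C[OF that] mult_right_mono[OF abs_ge_self schwartz_seminorm_nonneg[OF that]] order_trans by blast
  then show ?thesis using that[of "\<bar>C\<bar>"] by auto
qed

text \<open>On functions supported in a ball of radius \<open>R\<close> the polynomial weight of the
  seminorm is at most \<open>(1 + R) ^ k\<close>.\<close>

lemma tempered_distribution:
  assumes f: "f \<in> tempered_distributions" shows "distribution f"
  unfolding distribution_def
proof (intro conjI ballI allI)
  fix \<phi> \<eta> :: "real^'a \<Rightarrow> complex" and a b
  assume "\<phi> \<in> test_functions" "\<eta> \<in> test_functions"
  then obtain R S where t: "\<phi> \<in> test_in R" "\<eta> \<in> test_in S" by (meson test_functions_test_in)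
  have "f (\<lambda>x. a * \<phi> x + b * \<eta> x) = f (\<lambda>x. a * \<phi> x) + f (\<lambda>x. b * \<eta> x)"
    using f test_in_schwartz[OF test_in_cmult[OF t(1), of a]] test_in_schwartz[OF test_in_cmult[OF t(2), of b]]
    by (simp add: tempered_distributions_def)
  also have "\<dots> = a * f \<phi> + b * f \<eta>"
    using f t[THEN test_in_schwartz] unfolding tempered_distributions_def by simp
  finally show "f (\<lambda>x. a * \<phi> x + b * \<eta> x) = a * f \<phi> + b * f \<eta>" .
next
  fix R0 :: real
  obtain C k where C: "C \<ge> 0" "\<And>\<phi>. \<phi> \<in> schwartz_functions \<Longrightarrow> norm (f \<phi>) \<le> C * schwartz_seminorm k \<phi>"
    using tempered_bound[OF f] by metis
  define R where "R = max R0 0"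
  have "norm (f \<phi>) \<le> (C * (1 + R) ^ k) * A" if "\<phi> \<in> test_in R0" "deriv_bound k A \<phi>" for \<phi> A
  proof -
    have \<phi>: "\<phi> \<in> test_in R" by (rule test_in_mono[OF that(1)]) (simp add: R_def)
    have "norm (f \<phi>) \<le> C * schwartz_seminorm k \<phi>" by (rule C(2)[OF test_in_schwartz[OF \<phi>]])
    also have "\<dots> \<le> C * ((1 + R) ^ k * A)"
      by (intro mult_left_mono C(1) schwartz_seminorm_least deriv_bound_test_weighted[OF \<phi> _ that(2)]) (simp add: R_def)
    finally show ?thesis by (simp add: mult.assoc)
  qed
  moreover have "C * (1 + R) ^ k \<ge> 0" using C(1) by (simp add: R_def)
  ultimately show "\<exists>C\<ge>0. \<exists>k. \<forall>\<phi>\<in>test_in R0. \<forall>A. deriv_bound k A \<phi> \<longrightarrow> norm (f \<phi>) \<le> C * A" by blast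
qed

lemma tempered_distr_deriv:
  assumes f: "f \<in> tempered_distributions" shows "distr_deriv j f \<in> tempered_distributions"
proof -
  obtain C k where C: "C \<ge> 0" "\<And>\<phi>. \<phi> \<in> schwartz_functions \<Longrightarrow> norm (f \<phi>) \<le> C * schwartz_seminorm k \<phi>"
    using tempered_bound[OF f] by metis
  have sm: "smooth \<phi>" if "\<phi> \<in> schwartz_functions" for \<phi> :: "real^'a \<Rightarrow> complex"
    using that by (simp add: schwartz_functions_def)
  have "norm (distr_deriv j f \<phi>) \<le> C * schwartz_seminorm (Suc k) \<phi>" if \<phi>: "\<phi> \<in> schwartz_functions" for \<phi>
  proof -
    have "norm (distr_deriv j f \<phi>) \<le> C * schwartz_seminorm k (partial_derivative j \<phi>)"
      using C(2)[OF schwartz_partial_derivative[OF \<phi>]] by (simp add: distr_deriv_def)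
    also have "schwartz_seminorm k (partial_derivative j \<phi>) \<le> schwartz_seminorm (Suc k) \<phi>"
    proof (rule schwartz_seminorm_least)
      fix js :: "'a list" and x assume js: "length js \<le> k"
      have "(1 + norm x) ^ k * norm (iterated_partial (js @ [j]) \<phi> x) \<le> (1 + norm x) ^ Suc k * norm (iterated_partial (js @ [j]) \<phi> x)"
        by (intro mult_right_mono power_increasing) auto
      also have "\<dots> \<le> schwartz_seminorm (Suc k) \<phi>" by (rule schwartz_seminorm_upper[OF \<phi>]) (use js in simp)
      finally show "(1 + norm x) ^ k * norm (iterated_partial js (partial_derivative j \<phi>) x) \<le> schwartz_seminorm (Suc k) \<phi>"
        by (simp add: iterated_partial_snoc)
    qed
    finally show ?thesis using C(1) by (simp add: mult_left_mono)
  qed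
  moreover have "distr_deriv j f (\<lambda>x. \<phi> x + \<eta> x) = distr_deriv j f \<phi> + distr_deriv j f \<eta>"
    if "\<phi> \<in> schwartz_functions" "\<eta> \<in> schwartz_functions" for \<phi> \<eta>
  proof -
    have "partial_derivative j (\<lambda>x. \<phi> x + \<eta> x) = (\<lambda>x. partial_derivative j \<phi> x + partial_derivative j \<eta> x)"
      using iterated_partial_lincomb[OF that[THEN sm], of "[j]" 1 1] by simp
    then show ?thesis
      using f schwartz_partial_derivative[OF that(1)] schwartz_partial_derivative[OF that(2)]
      by (simp add: distr_deriv_def tempered_distributions_def)
  qed
  moreover have "distr_deriv j f (\<lambda>x. c * \<phi> x) = c * distr_deriv j f \<phi>" if "\<phi> \<in> schwartz_functions" for c \<phi>
    using f schwartz_partial_derivative[OF that] iterated_partial_cmult[OF sm[OF that], of "[j]" c]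
    by (simp add: distr_deriv_def tempered_distributions_def)
  ultimately show ?thesis unfolding tempered_distributions_def by blast
qed

lemma given_by_integrable:
  assumes u: "given_by f u" and \<phi>: "\<phi> \<in> test_in R"
  shows "integrable lebesgue (\<lambda>x. u x * \<phi> x)"
proof -
  obtain B where B: "B \<ge> 0" "\<And>x. norm (\<phi> x) \<le> B" using test_in_bounded[OF \<phi>] by metis
  have i: "integrable lebesgue (\<lambda>x. indicator (cball 0 R) x *\<^sub>R u x)"
    using u by (auto simp: given_by_def locally_integrable_def set_integrable_def)
  have [measurable]: "\<phi> \<in> borel_measurable lebesgue"
    using test_in_measurable[OF \<phi>] by (simp add: measurable_completion)
  have [measurable]: "(\<lambda>x. indicator (cball 0 R) x *\<^sub>R u x) \<in> borel_measurable lebesgue"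
    using i by (rule borel_measurable_integrable)
  have eq: "(\<lambda>x. u x * \<phi> x) = (\<lambda>x. (indicator (cball 0 R) x *\<^sub>R u x) * \<phi> x)"
    using test_in_zero[OF \<phi>] by (fastforce simp: indicator_def not_le)
  show ?thesis
    unfolding eq
  proof (rule Bochner_Integration.integrable_bound)
    show "integrable lebesgue (\<lambda>x. B *\<^sub>R (indicator (cball 0 R) x *\<^sub>R u x))" using i by (rule integrable_scaleR_right)
    show "AE x in lebesgue. norm ((indicator (cball 0 R) x *\<^sub>R u x) * \<phi> x) \<le> norm (B *\<^sub>R (indicator (cball 0 R) x *\<^sub>R u x))"
      using B by (intro AE_I2) (auto simp: norm_mult indicator_def mult.commute intro!: mult_right_mono)
  qed measurable
qed

lemma integral_lebesgue_test:
  "\<phi> \<in> test_in R \<Longrightarrow> (\<integral>x. \<phi> x \<partial>lebesgue) = (\<integral>x. \<phi> x \<partial>lborel)"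
  using test_in_measurable[of \<phi> R] by (simp add: integral_completion)

text \<open>A test function of integral zero does not see constants; with \<open>c\<close>
  subtracted, the Poincare inequality becomes applicable.\<close>

lemma given_by_shift:
  assumes u: "given_by f u" and \<phi>: "\<phi> \<in> test_in R" and 0: "(\<integral>x. \<phi> x \<partial>lborel) = 0"
  shows "integrable lebesgue (\<lambda>x. (u x - c) * \<phi> x)" "f \<phi> = (\<integral>x. (u x - c) * \<phi> x \<partial>lebesgue)"
proof -
  have i: "integrable lebesgue \<phi>" using test_in_integrable[OF \<phi>] by (simp add: integrable_completion test_in_measurable[OF \<phi>])
  then have ci: "integrable lebesgue (\<lambda>x. c * \<phi> x)" by simp
  have "(\<integral>x. c * \<phi> x \<partial>lebesgue) = 0" using 0 by (simp add: integral_lebesgue_test[OF \<phi>])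
  moreover have "f \<phi> = (\<integral>x. u x * \<phi> x \<partial>lebesgue)" using u test_in_test_functions[OF \<phi>] by (simp add: given_by_def)
  ultimately show "f \<phi> = (\<integral>x. (u x - c) * \<phi> x \<partial>lebesgue)"
    using Bochner_Integration.integral_diff[OF given_by_integrable[OF u \<phi>] ci]
    unfolding left_diff_distrib by simp
  show "integrable lebesgue (\<lambda>x. (u x - c) * \<phi> x)"
    using Bochner_Integration.integrable_diff[OF given_by_integrable[OF u \<phi>] ci] by (simp add: algebra_simps)
qed

context mollifier
begin

text \<open>Coincides with \<open>maximal_function \<psi> \<rho>\<close> when
  \<open>\<theta>\<close> is the reflection of \<open>\<psi>\<close>.\<close>

definition radial_max :: "real \<Rightarrow> 'n functional \<Rightarrow> real^'n \<Rightarrow> ennreal"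
  where "radial_max \<rho> F x = (SUP t\<in>{0<..\<rho>}. ennreal (norm (F (bump x t \<theta>))))"

lemma radial_max_upper: "0 < t \<Longrightarrow> t \<le> \<rho> \<Longrightarrow> ennreal (norm (F (bump x t \<theta>))) \<le> radial_max \<rho> F x"
  unfolding radial_max_def by (rule SUP_upper) simp

text \<open>A supremum of continuous functions has open superlevel sets, although uncountably many
  scales are involved.\<close>

lemma radial_max_measurable:
  assumes "distribution F" shows "radial_max \<rho> F \<in> borel_measurable borel"
proof (rule borel_measurableI_greater, simp)
  fix a
  have "{x. a < radial_max \<rho> F x} = (\<Union>t\<in>{0<..\<rho>}. {x. a < ennreal (norm (F (bump x t \<theta>)))})"
    by (auto simp: radial_max_def less_SUP_iff)
  also have "open \<dots>"
    by (intro open_UN ballI open_Collect_less continuous_on_const continuous_on_ennreal continuous_on_norm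
        distribution_bump_continuous[OF assms \<theta>_test]) auto
  finally show "{x. a < radial_max \<rho> F x} \<in> sets borel" by (rule borel_open)
qed

text \<open>In dimension \<open>n\<close> a derivative of the bump is at most
  \<open>B * (1 / t) ^ Suc n\<close> on a ball of radius \<open>t\<close>, and the Poincare
  inequality supplies exactly \<open>t * t ^ n\<close>, so the bound is free of the scale. It asks
  for \<open>4 * t \<le> s\<close> for all \<open>t \<le> \<rho>\<close>, whence the range
  \<open>4 * \<rho>\<close>.\<close>

lemma hardy_of_hajlasz:
  assumes q: "0 < q" "q < 1" "real CARD('n) / (real CARD('n) + 1) < q" "q < p"
  shows "\<exists>C\<ge>0. \<forall>f u g j. given_by f u \<longrightarrow> hajlasz (4 * \<rho>) u g \<longrightarrow> pow_integral p g < top \<longrightarrow>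
    (\<integral>\<^sup>+x. ennreal_rpow (radial_max \<rho> (distr_deriv j f) x) p \<partial>lborel) \<le> ennreal C * pow_integral p g"
proof -
  let ?n = "CARD('n)"
  obtain P where P: "P \<ge> 0" "\<And>s (v :: real^'n \<Rightarrow> complex) g z r J.
    hajlasz s v g \<Longrightarrow> 0 < r \<Longrightarrow> 4 * r \<le> s \<Longrightarrow> J \<ge> 0 \<Longrightarrow>
    (\<integral>\<^sup>+y. ennreal (g y powr q) * indicator (cball z (2 * r)) y \<partial>lborel) \<le> ennreal (r ^ ?n * J) \<Longrightarrow>
    (\<exists>c. (\<integral>\<^sup>+x. ennreal (norm (v x - c)) * indicator (cball z r) x \<partial>lborel) \<le> ennreal (P * (r * r ^ ?n) * J powr (1 / q)))"
    using hajlasz_poincare[where ?'a = "real^'n" and ?'b = complex, of q] q by auto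
  obtain C where C: "C \<ge> 0" "\<And>H :: real^'n \<Rightarrow> ennreal. H \<in> borel_measurable borel \<Longrightarrow>
    (\<integral>\<^sup>+x. ennreal_rpow (ennreal_rpow (maximal_op (\<lambda>y. ennreal_rpow (H y) q) x) (1 / q)) p \<partial>lborel)
    \<le> ennreal C * (\<integral>\<^sup>+x. ennreal_rpow (H x) p \<partial>lborel)"
    using pow_integral_maximal[OF q(1,4)] by blast
  obtain B0 where B0: "B0 \<ge> 0" "deriv_bound 1 B0 \<theta>" using deriv_bound_ex[OF \<theta>_test] .
  \<comment> \<open>The added 1, here and next to \<open>P\<close> in \<open>K\<close>, makes
    \<open>K\<close> strictly positive, so that \<open>K\<close> times an infinite maximal function
    is infinite.\<close>
  define B where "B = B0 + 1"
  have B: "B > 0" "\<And>j y. norm (partial_derivative j \<theta> y) \<le> B"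
    using B0(1) deriv_boundD[OF B0(2), of "[_]"] by (auto simp: B_def intro: add_increasing2)
  define K where "K = B * (P + 1) * (2 ^ ?n) powr (1 / q)"
  have K: "K > 0" using B P by (simp add: K_def)
  have "(\<integral>\<^sup>+x. ennreal_rpow (radial_max \<rho> (distr_deriv j f) x) p \<partial>lborel) \<le> ennreal (K powr p * C) * pow_integral p g"
    if u: "given_by f u" and hj: "hajlasz (4 * \<rho>) u g" and fin: "pow_integral p g < top" for f u g j
  proof -
    have gm[measurable]: "g \<in> borel_measurable borel" and g: "\<And>x. g x \<ge> 0" using hj by (auto simp: hajlasz_def)
    let ?M = "maximal_op (\<lambda>y. ennreal (g y powr q))"
    have pw: "radial_max \<rho> (distr_deriv j f) x \<le> ennreal K * ennreal_rpow (?M x) (1 / q)" for x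
    proof (cases "?M x")
      case top
      then show ?thesis using K by (simp add: ennreal_mult_top)
    next
      case (real m)
      show ?thesis
        unfolding radial_max_def
      proof (rule SUP_least)
        fix t assume "t \<in> {0<..\<rho>}"
        then have t: "0 < t" "t \<le> \<rho>" by auto
        let ?\<phi> = "partial_derivative j (bump x t \<theta>)"
        have \<phi>: "?\<phi> \<in> test_in (norm x + t * 1)"
          by (rule test_in_partial_derivative[OF bump_test_in[OF \<theta>_test t(1)]])
        have "(\<integral>\<^sup>+y. ennreal (g y powr q) * indicator (cball x (2 * t)) y \<partial>lborel) \<le> ennreal ((2 * t) ^ ?n) * ?M x"
          using maximal_op_integral_le[of "2 * t" "\<lambda>y. ennreal (g y powr q)" x] t by simp
        also have "\<dots> = ennreal (t ^ ?n * (2 ^ ?n * m))"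
          using real t by (simp add: ennreal_mult[symmetric] power_mult_distrib mult_ac)
        finally obtain c where c: "(\<integral>\<^sup>+y. ennreal (norm (u y - c)) * indicator (cball x t) y \<partial>lborel)
            \<le> ennreal (P * (t * t ^ ?n) * (2 ^ ?n * m) powr (1 / q))"
          using P(2)[OF hj t(1)] t(2) real(1) by force
        have bd: "norm (?\<phi> y) \<le> (1 / t) ^ Suc ?n * B * indicator (cball x t) y" for y
        proof (cases "y \<in> cball x t")
          case True
          have "norm (?\<phi> y) = (1 / t) ^ Suc ?n * norm (partial_derivative j \<theta> ((1 / t) *\<^sub>R (y - x)))"
            using t by (simp add: partial_derivative_bump[OF test_in_smooth[OF \<theta>_test]] bump_def)
          also have "\<dots> \<le> (1 / t) ^ Suc ?n * B" using B(2) t by (intro mult_left_mono) auto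
          finally show ?thesis using True by simp
        next
          case False
          then have "norm ((1 / t) *\<^sub>R (y - x)) > 1"
            using t by (simp only: norm_scaleR) (simp add: dist_norm norm_minus_commute pos_less_divide_eq)
          then have "?\<phi> y = 0"
            using test_in_zero[OF test_in_partial_derivative[OF \<theta>_test]]
            by (simp add: partial_derivative_bump[OF test_in_smooth[OF \<theta>_test]] bump_def)
          then show ?thesis using False by simp
        qed
        have "ennreal (norm (distr_deriv j f (bump x t \<theta>))) = ennreal (norm (\<integral>y. (u y - c) * ?\<phi> y \<partial>lebesgue))"
          using given_by_shift(2)[OF u \<phi> integral_partial_derivative[OF bump_test_in[OF \<theta>_test t(1)]], of c]
          by (simp add: distr_deriv_def)
        also have "\<dots> \<le> (\<integral>\<^sup>+y. ennreal (norm ((u y - c) * ?\<phi> y)) \<partial>lborel)"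
          using integral_norm_bound_ennreal[OF given_by_shift(1)[OF u \<phi> integral_partial_derivative[OF bump_test_in[OF \<theta>_test t(1)]], of c]]
          by (simp add: nn_integral_completion)
        also have "\<dots> \<le> (\<integral>\<^sup>+y. ennreal ((1 / t) ^ Suc ?n * B) * (ennreal (norm (u y - c)) * indicator (cball x t) y) \<partial>lborel)"
        proof (rule nn_integral_mono)
          fix y
          have "ennreal (norm ((u y - c) * ?\<phi> y)) \<le> ennreal (norm (u y - c) * ((1 / t) ^ Suc ?n * B * indicator (cball x t) y))"
            unfolding norm_mult by (intro ennreal_leI mult_left_mono bd) simp
          also have "\<dots> = ennreal ((1 / t) ^ Suc ?n * B) * (ennreal (norm (u y - c)) * indicator (cball x t) y)"
            using t B(1) by (cases "y \<in> cball x t") (simp_all add: ennreal_mult[symmetric] mult_ac)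
          finally show "ennreal (norm ((u y - c) * ?\<phi> y)) \<le> ennreal ((1 / t) ^ Suc ?n * B) * (ennreal (norm (u y - c)) * indicator (cball x t) y)" .
        qed
        also have "\<dots> = ennreal ((1 / t) ^ Suc ?n * B) * (\<integral>\<^sup>+y. ennreal (norm (u y - c)) * indicator (cball x t) y \<partial>lborel)"
        proof -
          \<comment> \<open>Measurability of \<open>u\<close> is available after cutting off to a
            compact set, so the integrand is rewritten with the cut-off function.\<close>
          have "integrable lebesgue (\<lambda>y. indicator (cball x t) y *\<^sub>R u y)"
            using u by (auto simp: given_by_def locally_integrable_def set_integrable_def)
          then have [measurable]: "(\<lambda>y. indicator (cball x t) y *\<^sub>R u y) \<in> borel_measurable lebesgue"
            by (rule borel_measurable_integrable)
          have [measurable]: "cball x t \<in> sets lebesgue" by simp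
          have "(\<lambda>y. ennreal (norm (indicator (cball x t) y *\<^sub>R u y - c)) * indicator (cball x t) y) \<in> borel_measurable lebesgue"
            by measurable
          moreover have "(\<lambda>y. ennreal (norm (indicator (cball x t) y *\<^sub>R u y - c)) * indicator (cball x t) y)
              = (\<lambda>y. ennreal (norm (u y - c)) * indicator (cball x t) y)"
            by (auto simp: indicator_def)
          ultimately show ?thesis unfolding nn_integral_completion[of lborel, symmetric] by (simp add: nn_integral_cmult)
        qed
        also have "\<dots> \<le> ennreal ((1 / t) ^ Suc ?n * B) * ennreal (P * (t * t ^ ?n) * (2 ^ ?n * m) powr (1 / q))"
          by (rule mult_left_mono[OF c]) simp
        also have "\<dots> = ennreal (((1 / t) ^ Suc ?n * B) * (P * (t * t ^ ?n) * (2 ^ ?n * m) powr (1 / q)))"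
          using t B(1) P(1) by (intro ennreal_mult[symmetric]) auto
        also have "((1 / t) ^ Suc ?n * B) * (P * (t * t ^ ?n) * (2 ^ ?n * m) powr (1 / q)) = B * P * ((2 ^ ?n) powr (1 / q) * m powr (1 / q))"
          using t real(1) by (simp add: power_divide powr_mult)
        also have "ennreal \<dots> \<le> ennreal (K * m powr (1 / q))"
          using B P(1) by (intro ennreal_leI) (auto simp: K_def mult.assoc intro!: mult_left_mono mult_right_mono)
        also have "\<dots> = ennreal K * ennreal_rpow (?M x) (1 / q)"
          using K real by (simp add: ennreal_rpow_ennreal ennreal_mult)
        finally show "ennreal (norm (distr_deriv j f (bump x t \<theta>))) \<le> ennreal K * ennreal_rpow (?M x) (1 / q)" .
      qed
    qed
    have "(\<integral>\<^sup>+x. ennreal_rpow (radial_max \<rho> (distr_deriv j f) x) p \<partial>lborel)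
        \<le> (\<integral>\<^sup>+x. ennreal (K powr p) * ennreal_rpow (ennreal_rpow (?M x) (1 / q)) p \<partial>lborel)"
    proof (rule nn_integral_mono)
      fix x
      show "ennreal_rpow (radial_max \<rho> (distr_deriv j f) x) p \<le> ennreal (K powr p) * ennreal_rpow (ennreal_rpow (?M x) (1 / q)) p"
        using ennreal_rpow_mono[OF pw[of x], of p] q K
        by (simp only: ennreal_rpow_mult ennreal_rpow_ennreal[OF less_imp_le[OF K]])
    qed
    also have "\<dots> = ennreal (K powr p) * (\<integral>\<^sup>+x. ennreal_rpow (ennreal_rpow (?M x) (1 / q)) p \<partial>lborel)"
      by (rule nn_integral_cmult) measurable
    also have "\<dots> \<le> ennreal (K powr p) * (ennreal C * pow_integral p g)"
      using C(2)[of "\<lambda>x. ennreal (g x)"] by (intro mult_left_mono) (simp_all add: ennreal_rpow_ennreal g)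
    finally show ?thesis using C(1) by (simp add: ennreal_mult mult.assoc)
  qed
  moreover have "K powr p * C \<ge> 0" using C(1) by simp
  ultimately show ?thesis by blast
qed

text \<open>This is \<open>grand_maximal_unit\<close> for \<open>F\<close> rescaled to centre
  \<open>z\<close> and scale \<open>T\<close>, with \<open>h\<close> the \<open>q\<close>-th power
  of the radial maximal function; the scales \<open>T * (1/2) ^ k\<close> never exceed
  \<open>\<rho>\<close>. The radius \<open>R + 6\<close> is \<open>R + 5\<close> plus 1 for the
  distance between \<open>z\<close> and \<open>x\<close>, measured in units of
  \<open>T\<close>.\<close>

lemma grand_maximal:
  assumes q: "0 < q" "q < 1" and \<phi>: "\<phi> \<in> test_in R" and R: "R \<ge> 0"
  shows "\<exists>C\<ge>0. \<forall>F x z T. distribution F \<longrightarrow> 0 < T \<longrightarrow> T \<le> \<rho> \<longrightarrow> dist z x \<le> T \<longrightarrow>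
    ennreal (norm (F (bump z T \<phi>))) \<le> ennreal C * ennreal_rpow (maximal_op (\<lambda>y. ennreal_rpow (radial_max \<rho> F y) q) x) (1 / q)"
proof -
  let ?n = "CARD('n)"
  obtain C where C: "C \<ge> 0" "\<And>(G :: 'n functional) h I. distribution G \<Longrightarrow> dominates q G R h I \<Longrightarrow> norm (G \<phi>) \<le> C * I powr (1 / q)"
    using grand_maximal_unit[OF q \<phi>] by blast
  define D where "D = (C + 1) * ((R + 6) ^ ?n) powr (1 / q)"
  have D: "D > 0" using C(1) R by (simp add: D_def)
  have "ennreal (norm (F (bump z T \<phi>))) \<le> ennreal D * ennreal_rpow (maximal_op (\<lambda>y. ennreal_rpow (radial_max \<rho> F y) q) x) (1 / q)"
    if F: "distribution F" and T: "0 < T" "T \<le> \<rho>" and d: "dist z x \<le> T" for F x z T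
  proof (cases "maximal_op (\<lambda>y. ennreal_rpow (radial_max \<rho> F y) q) x")
    case top
    then show ?thesis using D by (simp add: ennreal_mult_top)
  next
    case (real m)
    let ?H = "\<lambda>y. ennreal_rpow (radial_max \<rho> F y) q"
    have Hm[measurable]: "?H \<in> borel_measurable borel"
      by (rule measurable_ennreal_rpow[OF radial_max_measurable[OF F]])
    let ?I = "(R + 6) ^ ?n * m"
    have "dominates q (\<lambda>\<phi>. F (bump z T \<phi>)) R (\<lambda>w. ?H (z + T *\<^sub>R w)) ?I"
      unfolding dominates_def
    proof (intro conjI allI)
      show "(\<lambda>w. ?H (z + T *\<^sub>R w)) \<in> borel_measurable borel" by measurable
      show "?I \<ge> 0" using real R by simp
      show "ennreal (norm (F (bump z T (bump w ((1/2) ^ k) \<theta>))) powr q) \<le> ?H (z + T *\<^sub>R w)" for k w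
      proof -
        have "T * (1/2) ^ k \<le> \<rho>" 
        proof -
          have "T * (1/2) ^ k \<le> T * 1" using T by (intro mult_left_mono power_le_one) auto
          then show ?thesis using T by linarith
        qed
        then have "ennreal (norm (F (bump (z + T *\<^sub>R w) (T * (1/2) ^ k) \<theta>))) \<le> radial_max \<rho> F (z + T *\<^sub>R w)"
          using T by (intro radial_max_upper) auto
        from ennreal_rpow_mono[OF this, of q] show ?thesis
          using T q by (simp add: bump_bump ennreal_rpow_ennreal)
      qed
      have sub: "cball z (T * (R + 5)) \<subseteq> cball x (T * (R + 6))"
      proof
        fix y assume "y \<in> cball z (T * (R + 5))"
        then show "y \<in> cball x (T * (R + 6))"
          using d dist_triangle[of x y z] by (simp add: dist_commute algebra_simps)
      qed
      have "(\<integral>\<^sup>+w. ?H (z + T *\<^sub>R w) * indicator (cball 0 (R + 5)) w \<partial>lborel)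
          = ennreal ((1 / T) ^ ?n) * (\<integral>\<^sup>+y. ?H y * indicator (cball z (T * (R + 5))) y \<partial>lborel)"
        using nn_integral_cball_rescale[OF Hm T(1), of z "R + 5"] by simp
      also have "\<dots> \<le> ennreal ((1 / T) ^ ?n) * (\<integral>\<^sup>+y. ?H y * indicator (cball x (T * (R + 6))) y \<partial>lborel)"
        using sub by (intro mult_left_mono nn_integral_mono) (auto simp: indicator_def)
      also have "\<dots> \<le> ennreal ((1 / T) ^ ?n) * (ennreal ((T * (R + 6)) ^ ?n) * maximal_op ?H x)"
        using maximal_op_integral_le[of "T * (R + 6)" ?H x] T R by (intro mult_left_mono) auto
      also have "\<dots> = ennreal ?I"
        using real T R by (simp add: ennreal_mult[symmetric] power_mult_distrib power_divide)
      finally show "(\<integral>\<^sup>+w. ?H (z + T *\<^sub>R w) * indicator (cball 0 (R + 5)) w \<partial>lborel) \<le> ennreal ?I" .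
    qed
    from C(2)[OF distribution_bump[OF F T(1)] this]
    have "norm (F (bump z T \<phi>)) \<le> C * ?I powr (1 / q)" .
    also have "\<dots> \<le> D * m powr (1 / q)"
      using real R by (auto simp: D_def powr_mult mult.assoc intro!: mult_right_mono)
    finally have "ennreal (norm (F (bump z T \<phi>))) \<le> ennreal (D * m powr (1 / q))" by (rule ennreal_leI)
    also have "\<dots> = ennreal D * ennreal_rpow (maximal_op ?H x) (1 / q)"
      using D real by (simp add: ennreal_rpow_ennreal ennreal_mult)
    finally show ?thesis .
  qed
  then show ?thesis using D by (intro exI[of _ D]) auto
qed

end

section \<open>Passage between \<open>admissible\<close> and \<open>hajlasz\<close>\<close>

lemma nn_integral_lebesgue_eq: "(\<integral>\<^sup>+x. f x \<partial>lebesgue) = (\<integral>\<^sup>+x. f x \<partial>lborel)"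
  by (rule nn_integral_completion)

text \<open>\<open>g\<close> may be negative at some points and is merely Lebesgue measurable. The
  absolute value of a Borel representative has the same norm and still dominates; the null sets are
  enlarged to Borel ones.\<close>

lemma admissible_imp_hajlasz:
  assumes g: "g \<in> Lp p" and p: "p > 0" and adm: "admissible u g"
  shows "\<exists>g'. hajlasz 1 u g' \<and> pow_integral p g' < top \<and>
    ennreal_rpow (pow_integral p g') (1 / p) = Lp_norm p (\<lambda>x. ennreal \<bar>g x\<bar>)"
proof -
  have gm: "g \<in> borel_measurable lebesgue" and fin: "Lp_norm p (\<lambda>x. ennreal \<bar>g x\<bar>) < top" using g by (auto simp: Lp_def)
  obtain g1 where g1: "g1 \<in> borel_measurable lborel" "AE x in lborel. g x = g1 x"
    using completion_ex_borel_measurable_real[OF gm] by auto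
  then obtain N where N: "N \<in> null_sets lborel" "{x. g x \<noteq> g1 x} \<subseteq> N"
    unfolding eventually_ae_filter by auto
  obtain E0 where E0: "E0 \<in> null_sets lebesgue"
    "\<And>x y. x \<notin> E0 \<Longrightarrow> y \<notin> E0 \<Longrightarrow> norm (x - y) \<le> 1 \<Longrightarrow> norm (u x - u y) \<le> norm (x - y) * (g x + g y)"
    using adm unfolding admissible_def by blast
  obtain E where E: "E \<in> null_sets lborel" "E0 \<subseteq> E" using E0(1) unfolding null_sets_completion_iff2 by auto
  let ?g = "\<lambda>x. \<bar>g1 x\<bar>"
  have "hajlasz 1 u ?g"
    unfolding hajlasz_def
  proof (intro conjI allI bexI[of _ "E \<union> N"] impI)
    show "?g \<in> borel_measurable borel" using g1(1) by simp
    show "E \<union> N \<in> null_sets lborel" using E(1) N(1) by auto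
    fix x y assume x: "x \<notin> E \<union> N" and y: "y \<notin> E \<union> N" and d: "dist x y \<le> 1"
    have "norm (u x - u y) \<le> norm (x - y) * (g x + g y)" using x y d E by (intro E0(2)) (auto simp: dist_norm)
    also have "\<dots> \<le> norm (x - y) * (?g x + ?g y)"
    proof -
      have "g x = g1 x" "g y = g1 y" using x y N(2) by blast+
      then show ?thesis by (intro mult_left_mono add_mono) auto
    qed
    finally show "norm (u x - u y) \<le> dist x y * (?g x + ?g y)" by (simp add: dist_norm)
  qed simp
  moreover have eq: "pow_integral p ?g = (\<integral>\<^sup>+x. ennreal_rpow (ennreal \<bar>g x\<bar>) p \<partial>lebesgue)"
    unfolding nn_integral_lebesgue_eq
    by (intro nn_integral_cong_AE) (use g1(2) in \<open>auto elim!: eventually_mono simp: ennreal_rpow_ennreal\<close>)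
  ultimately show ?thesis using fin by (intro exI[of _ ?g]) (auto simp: Lp_norm_def)
qed

lemma hajlasz_imp_admissible:
  assumes "hajlasz 1 u g" "pow_integral p g < top"
  shows "admissible u g" "g \<in> Lp p" "Lp_norm p (\<lambda>x. ennreal \<bar>g x\<bar>) = ennreal_rpow (pow_integral p g) (1 / p)"
proof -
  have g: "g \<in> borel_measurable borel" "\<And>x. g x \<ge> 0" using assms by (auto simp: hajlasz_def)
  show n: "Lp_norm p (\<lambda>x. ennreal \<bar>g x\<bar>) = ennreal_rpow (pow_integral p g) (1 / p)"
    unfolding Lp_norm_def nn_integral_lebesgue_eq using g by (simp add: ennreal_rpow_ennreal)
  show "g \<in> Lp p" using n assms(2) g(1) by (simp add: Lp_def measurable_completion)
  show "admissible u g"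
    using assms(1) unfolding admissible_def hajlasz_def by (auto simp: dist_norm intro: null_sets_completionI)
qed

section \<open>From Hardy spaces to Hajlasz functions\<close>

lemma nn_integral_compact_finite:
  fixes h :: "'a::euclidean_space \<Rightarrow> ennreal"
  assumes [measurable]: "h \<in> borel_measurable borel" and r: "r > 0"
    and fin: "\<And>z. (\<integral>\<^sup>+x. h x * indicator (cball z r) x \<partial>lborel) < top" and K: "compact K"
  shows "(\<integral>\<^sup>+x. h x * indicator K x \<partial>lborel) < top"
proof -
  obtain Z where Z: "Z \<subseteq> K" "finite Z" "K \<subseteq> (\<Union>z\<in>Z. ball z r)"
    using compactE_image[OF K, of K "\<lambda>z. ball z r"] r by (metis UN_I centre_in_ball open_ball subsetI)
  have [measurable]: "cball z r \<in> sets borel" for z :: 'a by simp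
  have "(\<integral>\<^sup>+x. h x * indicator K x \<partial>lborel) \<le> (\<integral>\<^sup>+x. (\<Sum>z\<in>Z. h x * indicator (cball z r) x) \<partial>lborel)"
  proof (rule nn_integral_mono)
    fix x
    show "h x * indicator K x \<le> (\<Sum>z\<in>Z. h x * indicator (cball z r) x)"
    proof (cases "x \<in> K")
      case True
      then obtain z where z: "z \<in> Z" "x \<in> ball z r" using Z(3) by blast
      then have "h x * indicator K x \<le> h x * indicator (cball z r) x" using True by (simp add: less_imp_le)
      also have "\<dots> \<le> (\<Sum>z\<in>Z. h x * indicator (cball z r) x)" using z Z(2) by (intro member_le_sum) auto
      finally show ?thesis .
    qed simp
  qed
  also have "\<dots> = (\<Sum>z\<in>Z. \<integral>\<^sup>+x. h x * indicator (cball z r) x \<partial>lborel)"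
    by (rule nn_integral_sum) measurable
  also have "\<dots> < top" using Z(2) by (induction Z rule: finite_induct) (use fin in auto)
  finally show ?thesis .
qed

text \<open>For \<open>p < 1\<close> the function \<open>g\<close> need not be locally integrable,
  but \<open>g powr q \<le> 1 + g powr p\<close> makes its local \<open>q\<close>-integrals finite.
  The Poincare inequality then makes \<open>v\<close> minus a constant integrable on each small
  ball.\<close>

lemma hajlasz_locally_finite:
  fixes v :: "'a::euclidean_space \<Rightarrow> real"
  assumes q: "0 < q" "q < 1" "real DIM('a) / (real DIM('a) + 1) < q" "q \<le> p"
    and hj: "hajlasz s v g" and s: "s > 0" and fin: "pow_integral p g < top" and v: "\<And>x. v x \<ge> 0"
    and vm[measurable]: "v \<in> borel_measurable borel" and K: "compact K"
  shows "(\<integral>\<^sup>+x. ennreal (v x) * indicator K x \<partial>lborel) < top"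
proof -
  let ?n = "DIM('a)"
  define r where "r = s / 4"
  have r: "r > 0" "4 * r \<le> s" using s by (auto simp: r_def)
  have gm[measurable]: "g \<in> borel_measurable borel" and g: "\<And>x. g x \<ge> 0" using hj by (auto simp: hajlasz_def)
  obtain P where P: "P \<ge> 0" "\<And>s (v :: 'a \<Rightarrow> real) g z r J.
    hajlasz s v g \<Longrightarrow> 0 < r \<Longrightarrow> 4 * r \<le> s \<Longrightarrow> J \<ge> 0 \<Longrightarrow>
    (\<integral>\<^sup>+y. ennreal (g y powr q) * indicator (cball z (2 * r)) y \<partial>lborel) \<le> ennreal (r ^ ?n * J) \<Longrightarrow>
    (\<exists>c. (\<integral>\<^sup>+x. ennreal (norm (v x - c)) * indicator (cball z r) x \<partial>lborel) \<le> ennreal (P * (r * r ^ ?n) * J powr (1 / q)))"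
    using hajlasz_poincare[where ?'a = 'a and ?'b = real, OF q(1-3)] by auto
  have ball: "(\<integral>\<^sup>+x. ennreal (v x) * indicator (cball z r) x \<partial>lborel) < top" for z
  proof -
    have [measurable]: "cball z t \<in> sets borel" for t by simp
    let ?I = "\<integral>\<^sup>+y. ennreal (g y powr q) * indicator (cball z (2 * r)) y \<partial>lborel"
    have "?I \<le> (\<integral>\<^sup>+y. indicator (cball z (2 * r)) y + ennreal (g y powr p) \<partial>lborel)"
    proof (rule nn_integral_mono)
      fix y
      have "g y powr q \<le> 1 + g y powr p"
      proof (cases "g y \<le> 1")
        case True
        then have "g y powr q \<le> 1 powr q" using g q by (intro powr_mono2) auto
        then show ?thesis by (intro add_increasing2) simp_all
      next
        case False
        then have "g y powr q \<le> g y powr p" by (intro powr_mono q(4)) simp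
        then show ?thesis by linarith
      qed
      then have "ennreal (g y powr q) \<le> 1 + ennreal (g y powr p)"
        by (metis ennreal_1 ennreal_leI ennreal_plus powr_ge_zero zero_le_one)
      then show "ennreal (g y powr q) * indicator (cball z (2 * r)) y \<le> indicator (cball z (2 * r)) y + ennreal (g y powr p)"
        by (auto simp: indicator_def)
    qed
    also have "\<dots> = emeasure lborel (cball z (2 * r)) + pow_integral p g"
      by (subst nn_integral_add) auto
    also have "\<dots> < top" using fin r by (simp add: emeasure_cball)
    finally obtain i where i: "?I = ennreal i" "i \<ge> 0" by (cases ?I) auto
    then have "?I \<le> ennreal (r ^ ?n * (i / r ^ ?n))" using r by simp
    with P(2)[OF hj r, of "i / r ^ ?n" z] i r
    obtain c where c: "(\<integral>\<^sup>+x. ennreal (norm (v x - c)) * indicator (cball z r) x \<partial>lborel) \<le> ennreal (P * (r * r ^ ?n) * (i / r ^ ?n) powr (1 / q))"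
      by auto
    have "(\<integral>\<^sup>+x. ennreal (v x) * indicator (cball z r) x \<partial>lborel)
        \<le> (\<integral>\<^sup>+x. ennreal (norm (v x - c)) * indicator (cball z r) x + ennreal \<bar>c\<bar> * indicator (cball z r) x \<partial>lborel)"
    proof (rule nn_integral_mono)
      fix x
      have "ennreal (v x) \<le> ennreal (norm (v x - c) + \<bar>c\<bar>)" by (rule ennreal_leI) simp
      then show "ennreal (v x) * indicator (cball z r) x \<le> ennreal (norm (v x - c)) * indicator (cball z r) x + ennreal \<bar>c\<bar> * indicator (cball z r) x"
        by (auto simp: indicator_def)
    qed
    also have "\<dots> = (\<integral>\<^sup>+x. ennreal (norm (v x - c)) * indicator (cball z r) x \<partial>lborel) + ennreal \<bar>c\<bar> * emeasure lborel (cball z r)"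
      by (subst nn_integral_add) (auto simp: nn_integral_cmult_indicator)
    also have "\<dots> < top" using order_le_less_trans[OF c ennreal_less_top] r by (simp add: emeasure_cball ennreal_mult_less_top)
    finally show ?thesis .
  qed
  show ?thesis by (rule nn_integral_compact_finite[OF _ r(1) ball K]) simp
qed

context mollifier
begin

text \<open>The integral is \<open>f\<close> applied to the mollified test function, whose residual
  is of order \<open>t k\<close> in all derivatives that \<open>f\<close> sees.\<close>

lemma mollify_tendsto:
  fixes f :: "'n functional"
  assumes f: "distribution f" and \<phi>: "\<phi> \<in> test_in R" and t: "\<And>k. 0 < t k" "\<And>k. t k \<le> d" "t \<longlonglongrightarrow> 0"
  shows "(\<lambda>k. \<integral>w. \<phi> w * f (bump w (t k) \<theta>) \<partial>lborel) \<longlonglongrightarrow> f \<phi>"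
proof -
  obtain C m where C: "C \<ge> 0"
      "\<And>\<phi> A. \<phi> \<in> test_in (R + d) \<Longrightarrow> deriv_bound m A \<phi> \<Longrightarrow> norm (f \<phi>) \<le> C * A"
    using distribution_bound[OF f, of "R + d"] by metis
  obtain A where A: "A \<ge> 0" "deriv_bound (Suc m) A \<phi>" using deriv_bound_ex[OF \<phi>] .
  let ?D = "C * (\<theta>_norm * (real CARD('n) * A))"
  have le: "norm ((\<integral>w. \<phi> w * f (bump w (t k) \<theta>) \<partial>lborel) - f \<phi>) \<le> ?D * t k" for k
  proof -
    have b: "bump 0 (t k) \<theta> \<in> test_in (t k)" using bump_test_in[OF \<theta>_test t(1), of 0] by simp
    have cv: "conv (bump 0 (t k) \<theta>) \<phi> \<in> test_in (t k + R)" by (rule conv_test_in[OF b \<phi>])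
    have "(\<integral>w. \<phi> w * f (bump w (t k) \<theta>) \<partial>lborel) = f (conv (bump 0 (t k) \<theta>) \<phi>)"
      using distribution_conv[OF f b \<phi>] by (simp add: bump_bump)
    then have "norm ((\<integral>w. \<phi> w * f (bump w (t k) \<theta>) \<partial>lborel) - f \<phi>) = norm (f (\<lambda>z. \<phi> z - conv (bump 0 (t k) \<theta>) \<phi> z))"
      by (simp only: distribution_diff[OF f \<phi> cv] norm_minus_commute)
    also have "\<dots> \<le> C * (\<theta>_norm * (real CARD('n) * A * t k))"
      by (intro C(2) residual_gain[OF \<phi> t(1) A(2)] test_in_mono[OF residual_test_in[OF \<phi> t(1)]]) (use t(2) in simp)
    finally show ?thesis by (simp add: mult_ac)
  qed
  have "(\<lambda>k. ?D * t k) \<longlonglongrightarrow> ?D * 0" by (intro tendsto_intros t)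
  then have "(\<lambda>k. ?D * t k) \<longlonglongrightarrow> 0" by simp
  then have "(\<lambda>k. (\<integral>w. \<phi> w * f (bump w (t k) \<theta>) \<partial>lborel) - f \<phi>) \<longlonglongrightarrow> 0"
    by (rule Lim_null_comparison[rotated]) (rule always_eventually, rule allI, rule le)
  then show ?thesis by (rule LIM_zero_cancel)
qed

text \<open>The mollifications are Hajlasz functions uniformly in the scale, hence so is their supremum;
  its local integrability supplies the dominating function for passing to the limit.\<close>

lemma hajlasz_of_hardy:
  assumes q: "0 < q" "q < 1" "real CARD('n) / (real CARD('n) + 1) < q" "q < p" and \<rho>: "\<rho> > 0"
  shows "\<exists>C\<ge>0. \<forall>f :: 'n functional. distribution f \<longrightarrow>
    (\<forall>j. (\<integral>\<^sup>+x. ennreal_rpow (radial_max \<rho> (distr_deriv j f) x) p \<partial>lborel) < top) \<longrightarrow>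
    (\<exists>u g. given_by f u \<and> hajlasz \<rho> u g \<and> pow_integral p g
      \<le> ennreal C * (\<Sum>j\<in>UNIV. \<integral>\<^sup>+x. ennreal_rpow (radial_max \<rho> (distr_deriv j f) x) p \<partial>lborel))"
proof -
  let ?n = "CARD('n)"
  have p: "p > 0" using q by simp
  let ?M = "\<lambda>F x. ennreal_rpow (maximal_op (\<lambda>y. ennreal_rpow (radial_max \<rho> F y) q) x) (1 / q)"
  let ?N = "\<lambda>F. \<integral>\<^sup>+x. ennreal_rpow (radial_max \<rho> F x) p \<partial>lborel"
  \<comment> \<open>The gradient is controlled nontangentially, at any \<open>z\<close> within
    \<open>T\<close> of \<open>x\<close>; the scale derivative treated next is taken at
    \<open>x\<close> itself.\<close>
  obtain C0 where C0: "C0 \<ge> 0" "\<And>(F :: 'n functional) x z T. distribution F \<Longrightarrow> 0 < T \<Longrightarrow> T \<le> \<rho> \<Longrightarrow> dist z x \<le> T \<Longrightarrow>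
    ennreal (norm (F (bump z T \<theta>))) \<le> ennreal C0 * ?M F x"
    using grand_maximal[OF q(1,2) \<theta>_test zero_le_one, of \<rho>] by blast
  have "\<exists>C\<ge>0. \<forall>(F :: 'n functional) x T. distribution F \<longrightarrow> 0 < T \<longrightarrow> T \<le> \<rho> \<longrightarrow>
    ennreal (norm (F (bump x T (\<lambda>y. y $ j *\<^sub>R \<theta> y)))) \<le> ennreal C * ?M F x" for j
  proof -
    obtain C where "C \<ge> 0" "\<And>(F :: 'n functional) x z T. distribution F \<Longrightarrow> 0 < T \<Longrightarrow> T \<le> \<rho> \<Longrightarrow> dist z x \<le> T \<Longrightarrow>
      ennreal (norm (F (bump z T (\<lambda>y. y $ j *\<^sub>R \<theta> y)))) \<le> ennreal C * ?M F x"
      using grand_maximal[OF q(1,2) test_in_coordinate_mult[OF \<theta>_test, of j] zero_le_one, of \<rho>] by blast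
    then show ?thesis by (intro exI[of _ C]) simp
  qed
  from choice[OF allI[OF this]] obtain C1 where C1': "\<forall>j. C1 j \<ge> 0 \<and> (\<forall>(F :: 'n functional) x T. distribution F \<longrightarrow> 0 < T \<longrightarrow> T \<le> \<rho> \<longrightarrow>
    ennreal (norm (F (bump x T (\<lambda>y. y $ j *\<^sub>R \<theta> y)))) \<le> ennreal (C1 j) * ?M F x)" by (rule exE)
  have C1: "C1 j \<ge> 0" "distribution F \<Longrightarrow> 0 < T \<Longrightarrow> T \<le> \<rho> \<Longrightarrow>
    ennreal (norm (F (bump x T (\<lambda>y. y $ j *\<^sub>R \<theta> y)))) \<le> ennreal (C1 j) * ?M F x" for j F x T
    using C1'[rule_format, of j] by blast+
  obtain CM where CM: "CM \<ge> 0" "\<And>H :: real^'n \<Rightarrow> ennreal. H \<in> borel_measurable borel \<Longrightarrow>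
    (\<integral>\<^sup>+x. ennreal_rpow (ennreal_rpow (maximal_op (\<lambda>y. ennreal_rpow (H y) q) x) (1 / q)) p \<partial>lborel)
    \<le> ennreal CM * (\<integral>\<^sup>+x. ennreal_rpow (H x) p \<partial>lborel)"
    using pow_integral_maximal[OF q(1,4)] by blast
  define K where "K = C0 + (\<Sum>j\<in>UNIV. C1 j)"
  have K: "K \<ge> 0" "C0 \<le> K" "C1 j \<le> K" for j
    using C0(1) C1(1) member_le_sum[of j UNIV C1] by (auto simp: K_def sum_nonneg intro: add_increasing add_nonneg_nonneg)
  \<comment> \<open>\<open>real ?n * K\<close> pays for a move in space, the further
    \<open>K\<close> for a move in scale at an endpoint.\<close>
  define L where "L = (real ?n + 1) * K"
  have L: "L \<ge> 0" "K \<le> L" "real ?n * K \<le> L" using K by (auto simp: L_def distrib_right)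
  define D where "D = L powr p * (2 powr p) ^ ?n * CM"
  have "\<exists>u g. given_by f u \<and> hajlasz \<rho> u g \<and> pow_integral p g \<le> ennreal D * (\<Sum>j\<in>UNIV. ?N (distr_deriv j f))"
    if f: "distribution f" and fin: "\<And>j. ?N (distr_deriv j f) < top" for f :: "'n functional"
  proof -
    let ?F = "\<lambda>j. distr_deriv j f"
    have F: "distribution (?F j)" for j by (rule distribution_distr_deriv[OF f])
    define G where "G x = (\<Sum>j\<in>UNIV. ?M (?F j) x)" for x
    have Hm[measurable]: "radial_max \<rho> (?F j) \<in> borel_measurable borel" for j by (rule radial_max_measurable[OF F])
    have Gm[measurable]: "G \<in> borel_measurable borel" unfolding G_def by measurable
    have Gint: "(\<integral>\<^sup>+x. ennreal_rpow (G x) p \<partial>lborel) \<le> ennreal ((2 powr p) ^ ?n * CM) * (\<Sum>j\<in>UNIV. ?N (?F j))"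
    proof -
      have "(\<integral>\<^sup>+x. ennreal_rpow (G x) p \<partial>lborel) \<le> (\<integral>\<^sup>+x. ennreal ((2 powr p) ^ ?n) * (\<Sum>j\<in>UNIV. ennreal_rpow (?M (?F j) x) p) \<partial>lborel)"
        unfolding G_def using p by (intro nn_integral_mono ennreal_rpow_sum_le) auto
      also have "\<dots> = ennreal ((2 powr p) ^ ?n) * (\<Sum>j\<in>UNIV. \<integral>\<^sup>+x. ennreal_rpow (?M (?F j) x) p \<partial>lborel)"
        by (simp add: nn_integral_cmult nn_integral_sum)
      also have "\<dots> \<le> ennreal ((2 powr p) ^ ?n) * (\<Sum>j\<in>UNIV. ennreal CM * ?N (?F j))"
        by (intro mult_left_mono sum_mono CM(2)) auto
      also have "\<dots> = ennreal ((2 powr p) ^ ?n * CM) * (\<Sum>j\<in>UNIV. ?N (?F j))"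
        using CM(1) by (simp add: sum_distrib_left[symmetric] ennreal_mult mult.assoc)
      finally show ?thesis .
    qed
    also have "\<dots> < top" using fin by (simp add: ennreal_mult_less_top)
    finally have Gfin: "AE x in lborel. ennreal_rpow (G x) p \<noteq> \<infinity>" by (intro nn_integral_noteq_infinite) auto
    define E where "E = {x. G x = top}"
    have E: "E \<in> null_sets lborel"
    proof (rule AE_iff_null_sets[THEN iffD2])
      show "AE x in lborel. x \<notin> E" using Gfin by (auto simp: E_def elim!: eventually_mono)
      show "E \<in> sets lborel" unfolding E_def by simp
    qed
    define \<gamma> where "\<gamma> x = enn2real (G x)" for x
    have \<gamma>: "\<gamma> x \<ge> 0" for x by (simp add: \<gamma>_def)
    have G\<gamma>: "G x = ennreal (\<gamma> x)" if "x \<notin> E" for x using that by (simp add: \<gamma>_def E_def less_top)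
    let ?w = "\<lambda>t x. f (bump x t \<theta>)"
    have b0: "norm (?F j (bump z t \<theta>)) \<le> K * \<gamma> x" if "x \<notin> E" "0 < t" "t \<le> \<rho>" "dist z x \<le> t" for j x z t
    proof -
      have "ennreal (norm (?F j (bump z t \<theta>))) \<le> ennreal C0 * ?M (?F j) x" by (rule C0(2)[OF F that(2-4)])
      also have "\<dots> \<le> ennreal K * G x"
        unfolding G_def using K by (intro mult_mono ennreal_leI member_le_sum) auto
      also have "\<dots> = ennreal (K * \<gamma> x)" using G\<gamma>[OF that(1)] K(1) \<gamma> by (simp add: ennreal_mult)
      finally show ?thesis using K(1) \<gamma> by (simp add: ennreal_le_iff)
    qed
    have b1: "norm (\<Sum>j\<in>UNIV. ?F j (bump x t (\<lambda>y. y $ j *\<^sub>R \<theta> y))) \<le> K * \<gamma> x" if "x \<notin> E" "0 < t" "t \<le> \<rho>" for x t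
    proof -
      have "ennreal (norm (\<Sum>j\<in>UNIV. ?F j (bump x t (\<lambda>y. y $ j *\<^sub>R \<theta> y)))) \<le> ennreal (\<Sum>j\<in>UNIV. norm (?F j (bump x t (\<lambda>y. y $ j *\<^sub>R \<theta> y))))"
        by (intro ennreal_leI norm_sum)
      also have "\<dots> = (\<Sum>j\<in>UNIV. ennreal (norm (?F j (bump x t (\<lambda>y. y $ j *\<^sub>R \<theta> y)))))" by (rule sum_ennreal[symmetric]) simp
      also have "\<dots> \<le> (\<Sum>j\<in>UNIV. ennreal K * ?M (?F j) x)"
      proof (rule sum_mono)
        fix j
        have "ennreal (norm (?F j (bump x t (\<lambda>y. y $ j *\<^sub>R \<theta> y)))) \<le> ennreal (C1 j) * ?M (?F j) x"
          by (rule C1(2)[OF F that(2,3)])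
        also have "\<dots> \<le> ennreal K * ?M (?F j) x" using K(3) by (intro mult_right_mono ennreal_leI) auto
        finally show "ennreal (norm (?F j (bump x t (\<lambda>y. y $ j *\<^sub>R \<theta> y)))) \<le> ennreal K * ?M (?F j) x" .
      qed
      also have "\<dots> = ennreal (K * \<gamma> x)" using G\<gamma>[OF that(1)] K(1) \<gamma> by (simp add: ennreal_mult G_def flip: sum_distrib_left)
      finally show ?thesis using K(1) \<gamma> by (simp add: ennreal_le_iff)
    qed
    have scale: "norm (?w t x - ?w s x) \<le> K * \<gamma> x * norm (t - s)" if x: "x \<notin> E" and "0 < s" "s \<le> \<rho>" "0 < t" "t \<le> \<rho>" for x s t
    proof (rule differentiable_bound[where S = "{0<..\<rho>}"])
      fix \<tau> assume \<tau>: "\<tau> \<in> {0<..\<rho>}"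
      let ?v = "\<Sum>j\<in>UNIV. ?F j (bump x \<tau> (\<lambda>y. y $ j *\<^sub>R \<theta> y))"
      show "((\<lambda>t. ?w t x) has_derivative (\<lambda>h. h *\<^sub>R ?v)) (at \<tau> within {0<..\<rho>})"
        using distribution_dilate_derivative[OF f \<theta>_test, of \<tau> x] \<tau>
        unfolding has_vector_derivative_def by (simp add: has_derivative_at_withinI)
      have "onorm (\<lambda>h::real. h *\<^sub>R ?v) \<le> norm ?v" by (rule onorm_le) (simp add: mult.commute)
      also have "\<dots> \<le> K * \<gamma> x" using b1[OF x] \<tau> by simp
      finally show "onorm (\<lambda>h::real. h *\<^sub>R ?v) \<le> K * \<gamma> x" .
    qed (use that in auto)
    \<comment> \<open>Only \<open>x\<close> has to be a good point: the whole segment lies within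
      \<open>t\<close> of \<open>x\<close>, so the nontangential bound at \<open>x\<close> controls
      the gradient along it.\<close>
    have near: "norm (?w t x - ?w t y) \<le> real ?n * (K * \<gamma> x) * norm (x - y)"
      if x: "x \<notin> E" and t: "0 < t" "t \<le> \<rho>" and d: "dist x y \<le> t" for x y t
    proof (rule differentiable_bound[where S = "closed_segment x y"])
      fix z assume z: "z \<in> closed_segment x y"
      show "((\<lambda>z. ?w t z) has_derivative (\<lambda>h. \<Sum>j\<in>UNIV. h $ j *\<^sub>R ?F j (bump z t \<theta>))) (at z within closed_segment x y)"
        by (rule has_derivative_at_withinI[OF distribution_translate_derivative[OF f \<theta>_test t(1)]])
      have "dist z x \<le> t" using segment_bound(1)[OF z] d by (simp add: dist_norm norm_minus_commute)
      then show "onorm (\<lambda>h. \<Sum>j\<in>UNIV. h $ j *\<^sub>R ?F j (bump z t \<theta>)) \<le> real ?n * (K * \<gamma> x)"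
        by (intro onorm_partials_le b0[OF x t])
    qed auto
    define g where "g x = L * \<gamma> x" for x
    have g: "g x \<ge> 0" for x using L \<gamma> by (simp add: g_def)
    have gm[measurable]: "g \<in> borel_measurable borel" unfolding g_def \<gamma>_def by measurable
    \<comment> \<open>If the distance exceeds the scale \<open>t\<close>, the path rises in scale
      from \<open>t\<close> to that distance at \<open>x\<close>, crosses over at this scale, and
      descends again at \<open>y\<close>; otherwise it crosses directly.\<close>
    have unif: "norm (?w t x - ?w t y) \<le> dist x y * (g x + g y)"
      if x: "x \<notin> E" and y: "y \<notin> E" and d: "dist x y \<le> \<rho>" and t: "0 < t" "t \<le> \<rho>" for x y t
    proof -
      let ?d = "dist x y"
      have nb: "norm (?w s x - ?w s y) \<le> ?d * (real ?n * (K * \<gamma> x))" if "0 < s" "s \<le> \<rho>" "?d \<le> s" for s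
        using near[OF x that] by (simp add: dist_norm mult.commute)
      have gx: "real ?n * (K * \<gamma> x) \<le> g x"
        unfolding g_def mult.assoc[symmetric] using L(3) \<gamma> by (intro mult_right_mono) auto
      show ?thesis
      proof (cases "?d \<le> t")
        case True
        have "norm (?w t x - ?w t y) \<le> ?d * (real ?n * (K * \<gamma> x))" by (rule nb[OF t True])
        also have "\<dots> \<le> ?d * (g x + g y)" using gx g[of y] by (intro mult_left_mono) auto
        finally show ?thesis .
      next
        case False
        then have d0: "0 < ?d" using t by linarith
        have ts: "norm (t - ?d) \<le> ?d" using False t by simp
        have "norm (?w t x - ?w t y) \<le> norm (?w t x - ?w ?d x) + norm (?w ?d x - ?w ?d y) + norm (?w t y - ?w ?d y)"
          using norm_triangle_ineq4[of "?w t x - ?w ?d x + (?w ?d x - ?w ?d y)" "?w t y - ?w ?d y"]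
            norm_triangle_ineq[of "?w t x - ?w ?d x" "?w ?d x - ?w ?d y"] by simp
        also have "\<dots> \<le> K * \<gamma> x * ?d + ?d * (real ?n * (K * \<gamma> x)) + K * \<gamma> y * ?d"
        proof (intro add_mono)
          show "norm (?w t x - ?w ?d x) \<le> K * \<gamma> x * ?d"
            using scale[OF x d0 d t] mult_left_mono[OF ts, of "K * \<gamma> x"] K(1) \<gamma>[of x] by fastforce
          show "norm (?w t y - ?w ?d y) \<le> K * \<gamma> y * ?d"
            using scale[OF y d0 d t] mult_left_mono[OF ts, of "K * \<gamma> y"] K(1) \<gamma>[of y] by fastforce
          show "norm (?w ?d x - ?w ?d y) \<le> ?d * (real ?n * (K * \<gamma> x))" by (rule nb[OF d0 d order_refl])
        qed
        also have "\<dots> = ?d * (g x + K * \<gamma> y)" by (simp add: g_def L_def algebra_simps)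
        also have "\<dots> \<le> ?d * (g x + g y)"
          using mult_right_mono[OF L(2) \<gamma>[of y]] by (intro mult_left_mono) (auto simp: g_def)
        finally show ?thesis .
      qed
    qed
    have gint: "pow_integral p g \<le> ennreal D * (\<Sum>j\<in>UNIV. ?N (?F j))"
    proof -
      have "pow_integral p g \<le> (\<integral>\<^sup>+x. ennreal (L powr p) * ennreal_rpow (G x) p \<partial>lborel)"
      proof (rule nn_integral_mono)
        fix x
        show "ennreal (g x powr p) \<le> ennreal (L powr p) * ennreal_rpow (G x) p"
        proof (cases "G x")
          case (real a)
          then show ?thesis using L by (simp add: g_def \<gamma>_def powr_mult ennreal_rpow_ennreal ennreal_mult)
        qed (simp add: g_def \<gamma>_def)
      qed
      also have "\<dots> = ennreal (L powr p) * (\<integral>\<^sup>+x. ennreal_rpow (G x) p \<partial>lborel)" by (rule nn_integral_cmult) measurable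
      also have "\<dots> \<le> ennreal (L powr p) * (ennreal ((2 powr p) ^ ?n * CM) * (\<Sum>j\<in>UNIV. ?N (?F j)))"
        by (intro mult_left_mono Gint) simp
      also have "\<dots> = ennreal D * (\<Sum>j\<in>UNIV. ?N (?F j))"
        using CM(1) by (simp add: D_def ennreal_mult mult.assoc)
      finally show ?thesis .
    qed
    have gfin: "pow_integral p g < top"
      using gint fin by (rule_tac order_le_less_trans[OF gint]) (simp add: ennreal_mult_less_top)
    \<comment> \<open>Off \<open>E\<close> this supremum is finite, because the bounded scale
      derivative keeps all values close to the one at scale \<open>\<rho>\<close>; at infinite
      values \<open>enn2real\<close> gives 0.\<close>
    define U where "U x = enn2real (radial_max \<rho> f x)" for x
    have Um[measurable]: "U \<in> borel_measurable borel"
      unfolding U_def using radial_max_measurable[OF f] by measurable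
    have U0: "U x \<ge> 0" for x by (simp add: U_def)
    have wU: "norm (?w t x) \<le> U x" if x: "x \<notin> E" and t: "0 < t" "t \<le> \<rho>" for t x
    proof -
      have "radial_max \<rho> f x \<le> ennreal (norm (?w \<rho> x) + K * \<gamma> x * \<rho>)"
        unfolding radial_max_def
      proof (rule SUP_least, rule ennreal_leI)
        fix s assume s: "s \<in> {0<..\<rho>}"
        have "norm (?w s x) \<le> norm (?w \<rho> x) + norm (?w s x - ?w \<rho> x)"
          using norm_triangle_ineq[of "?w \<rho> x" "?w s x - ?w \<rho> x"] by simp
        also have "norm (?w s x - ?w \<rho> x) \<le> K * \<gamma> x * norm (s - \<rho>)" using scale[OF x \<rho> order_refl, of s] s by simp
        also have "\<dots> \<le> K * \<gamma> x * \<rho>" using s K(1) \<gamma> by (intro mult_left_mono) auto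
        finally show "norm (?w s x) \<le> norm (?w \<rho> x) + K * \<gamma> x * \<rho>" by simp
      qed
      then have "radial_max \<rho> f x < top" using ennreal_less_top order_le_less_trans by blast
      then have "radial_max \<rho> f x = ennreal (U x)" by (simp add: U_def)
      then show ?thesis using radial_max_upper[OF t, of f x] U0[of x] by (simp add: ennreal_le_iff)
    qed
    have Ule: "U x \<le> B" if "\<And>t. 0 < t \<Longrightarrow> t \<le> \<rho> \<Longrightarrow> norm (?w t x) \<le> B" "B \<ge> 0" for x B
    proof -
      have "radial_max \<rho> f x \<le> ennreal B" unfolding radial_max_def by (rule SUP_least) (use that(1) in \<open>auto intro: ennreal_leI\<close>)
      then show ?thesis unfolding U_def using that(2) by (metis enn2real_leI)
    qed
    have "hajlasz \<rho> U g"
      unfolding hajlasz_def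
    proof (intro conjI allI bexI[OF _ E] impI gm g)
      have one: "U x \<le> U y + dist x y * (g x + g y)" if "x \<notin> E" "y \<notin> E" "dist x y \<le> \<rho>" for x y
      proof (rule Ule)
        fix t assume t: "0 < t" "t \<le> \<rho>"
        have "norm (?w t x) \<le> norm (?w t y) + norm (?w t x - ?w t y)"
          using norm_triangle_ineq[of "?w t y" "?w t x - ?w t y"] by simp
        also have "\<dots> \<le> U y + dist x y * (g x + g y)" by (intro add_mono wU unif that t)
        finally show "norm (?w t x) \<le> U y + dist x y * (g x + g y)" .
      qed (use U0 g in auto)
      fix x y assume "x \<notin> E" "y \<notin> E" "dist x y \<le> \<rho>"
      then show "norm (U x - U y) \<le> dist x y * (g x + g y)"
        using one[of x y] one[of y x] by (simp add: dist_commute abs_le_iff add.commute)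
    qed
    then have Uint: "(\<integral>\<^sup>+x. ennreal (U x) * indicator X x \<partial>lborel) < top" if "compact X" for X
      using that q by (intro hajlasz_locally_finite[of q p \<rho> U g] \<rho> gfin U0 Um) auto
    let ?t = "\<lambda>k. \<rho> * (1/2) ^ k"
    have t: "0 < ?t k" "?t k \<le> \<rho>" for k
    proof -
      show "0 < ?t k" using \<rho> by simp
      have "?t k \<le> \<rho> * 1" using \<rho> by (intro mult_left_mono power_le_one) auto
      then show "?t k \<le> \<rho>" by simp
    qed
    have tlim: "?t \<longlonglongrightarrow> 0"
      using tendsto_mult[OF tendsto_const LIMSEQ_power_zero[of "1/2::real"], of \<rho>] by simp
    \<comment> \<open>Off \<open>E\<close> the values are Lipschitz in the scale, so they converge
      along the dyadic scales; a countable sequence also gives measurability of the limit.\<close>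
    define u where "u x = lim (\<lambda>k. ?w (?t k) x)" for x
    have wc: "continuous_on UNIV (?w s)" if "s > 0" for s
      by (rule distribution_bump_continuous[OF f \<theta>_test that])
    have wm[measurable]: "?w (?t k) \<in> borel_measurable borel" for k
      by (rule borel_measurable_continuous_onI[OF wc[OF t(1)]])
    have um[measurable]: "u \<in> borel_measurable borel" unfolding u_def by measurable
    have lim: "(\<lambda>k. ?w (?t k) x) \<longlonglongrightarrow> u x" if x: "x \<notin> E" for x
    proof -
      have "Cauchy (\<lambda>k. ?w (?t k) x)"
      proof (rule metric_CauchyI)
        fix e :: real assume e: "e > 0"
        have "(\<lambda>k. K * \<gamma> x * ?t k) \<longlonglongrightarrow> K * \<gamma> x * 0" by (intro tendsto_intros tlim)
        then obtain k0 where k0: "\<And>k. k \<ge> k0 \<Longrightarrow> K * \<gamma> x * ?t k < e"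
          using e order_tendstoD(2)[of "\<lambda>k. K * \<gamma> x * ?t k" "K * \<gamma> x * 0" sequentially e]
          by (auto simp: eventually_sequentially)
        have "dist (?w (?t k) x) (?w (?t l) x) < e" if "k \<ge> k0" "l \<ge> k0" for k l
        proof -
          have "dist (?w (?t k) x) (?w (?t l) x) \<le> K * \<gamma> x * norm (?t k - ?t l)"
            unfolding dist_norm by (rule scale[OF x t t])
          also have "\<dots> \<le> K * \<gamma> x * max (?t k) (?t l)"
            using K(1) \<gamma> t(1)[of k] t(1)[of l] by (intro mult_left_mono) auto
          also have "\<dots> < e" using k0 that by (auto simp: max_def)
          finally show ?thesis .
        qed
        then show "\<exists>M. \<forall>m\<ge>M. \<forall>n\<ge>M. dist (?w (?t m) x) (?w (?t n) x) < e" by blast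
      qed
      then show ?thesis unfolding u_def by (simp add: Cauchy_convergent convergent_LIMSEQ_iff[symmetric])
    qed
    have uU: "norm (u x) \<le> U x" if "x \<notin> E" for x
      by (rule LIMSEQ_le_const2[OF tendsto_norm[OF lim[OF that]]]) (use wU[OF that t] in auto)
    have hu: "hajlasz \<rho> u g"
      unfolding hajlasz_def
    proof (intro conjI allI bexI[OF _ E] impI gm g)
      fix x y assume xy: "x \<notin> E" "y \<notin> E" "dist x y \<le> \<rho>"
      show "norm (u x - u y) \<le> dist x y * (g x + g y)"
        by (rule LIMSEQ_le_const2[OF tendsto_norm[OF tendsto_diff[OF lim[OF xy(1)] lim[OF xy(2)]]]]) (use unif[OF xy t] in auto)
    qed
    have ae: "AE x in lborel. x \<notin> E" using E by (rule AE_not_in)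
    have Ui: "integrable lborel (\<lambda>x. indicator X x * U x)" if X: "compact X" for X
    proof (rule integrableI_bounded)
      have [measurable]: "X \<in> sets borel" using X by (simp add: borel_compact)
      show "(\<lambda>x. indicator X x * U x) \<in> borel_measurable lborel" by measurable
      have "(\<integral>\<^sup>+x. ennreal (norm (indicator X x * U x)) \<partial>lborel) = (\<integral>\<^sup>+x. ennreal (U x) * indicator X x \<partial>lborel)"
        by (intro nn_integral_cong) (simp add: indicator_def U0)
      then show "(\<integral>\<^sup>+x. ennreal (norm (indicator X x * U x)) \<partial>lborel) < \<infinity>" using Uint[OF X] by simp
    qed
    have "locally_integrable u"
      unfolding locally_integrable_def set_integrable_def
    proof (intro allI impI)
      fix X :: "(real^'n) set" assume X: "compact X"
      have [measurable]: "X \<in> sets borel" using X by (simp add: borel_compact)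
      have "integrable lborel (\<lambda>x. indicator X x *\<^sub>R u x)"
        by (rule Bochner_Integration.integrable_bound[OF Ui[OF X]])
           (use ae in \<open>auto elim!: eventually_mono simp: indicator_def U0 intro: uU\<close>)
      then show "integrable lebesgue (\<lambda>x. indicator X x *\<^sub>R u x)" by (simp add: integrable_completion)
    qed
    moreover have "f \<phi> = (\<integral>x. u x * \<phi> x \<partial>lebesgue)" if \<phi>T: "\<phi> \<in> test_functions" for \<phi>
    proof -
      obtain R where \<phi>: "\<phi> \<in> test_in R" using test_functions_test_in[OF \<phi>T] by blast
      have [measurable]: "\<phi> \<in> borel_measurable borel" by (rule test_in_measurable[OF \<phi>])
      obtain B where B: "B \<ge> 0" "\<And>x. norm (\<phi> x) \<le> B" using test_in_bounded[OF \<phi>] by metis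
      have \<phi>B: "norm (\<phi> x) \<le> B * indicator (cball 0 R) x" for x
        using B(2) test_in_zero[OF \<phi>, of x] by (cases "norm x \<le> R") auto
      have "(\<lambda>k. \<integral>x. \<phi> x * ?w (?t k) x \<partial>lborel) \<longlonglongrightarrow> (\<integral>x. \<phi> x * u x \<partial>lborel)"
      proof (rule integral_dominated_convergence)
        show "integrable lborel (\<lambda>x. B * (indicator (cball 0 R) x * U x))" by (intro integrable_mult_right Ui compact_cball)
        show "AE x in lborel. (\<lambda>k. \<phi> x * ?w (?t k) x) \<longlonglongrightarrow> \<phi> x * u x"
          using ae by eventually_elim (intro tendsto_intros lim)
        show "AE x in lborel. norm (\<phi> x * ?w (?t k) x) \<le> B * (indicator (cball 0 R) x * U x)" for k
          using ae
        proof eventually_elim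
          case (elim x)
          then show ?case
            using mult_mono[OF \<phi>B[of x] wU[OF elim t(1) t(2), of k]] B(1) U0[of x]
            by (simp add: norm_mult mult.assoc)
        qed
      qed measurable
      moreover have "(\<lambda>k. \<integral>x. \<phi> x * ?w (?t k) x \<partial>lborel) \<longlonglongrightarrow> f \<phi>"
        by (rule mollify_tendsto[OF f \<phi> t tlim])
      ultimately have "(\<integral>x. \<phi> x * u x \<partial>lborel) = f \<phi>" by (rule LIMSEQ_unique)
      then have "f \<phi> = (\<integral>x. \<phi> x * u x \<partial>lborel)" by (rule sym)
      also have "\<dots> = (\<integral>x. \<phi> x * u x \<partial>lebesgue)" by (rule integral_completion[symmetric]) measurable
      finally show ?thesis by (simp add: mult.commute)
    qed
    ultimately have "given_by f u" by (simp add: given_by_def)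
    then show ?thesis using hu gint by blast
  qed
  moreover have "D \<ge> 0" using CM(1) by (simp add: D_def)
  ultimately show ?thesis by blast
qed

end

section \<open>The characterization\<close>

lemma differ_by_constant_sym:
  assumes "differ_by_constant f f'" shows "differ_by_constant f' f"
proof -
  obtain c where "\<And>\<phi>. \<phi> \<in> schwartz_functions \<Longrightarrow> f' \<phi> = f \<phi> + (LINT x|lebesgue. c * \<phi> x)"
    using assms unfolding differ_by_constant_def by blast
  then show ?thesis unfolding differ_by_constant_def by (intro exI[of _ "- c"]) simp
qed

lemma given_by_add_constant:
  assumes u: "given_by f u" and c: "\<And>\<phi>. \<phi> \<in> schwartz_functions \<Longrightarrow> f' \<phi> = f \<phi> + (LINT x|lebesgue. c * \<phi> x)"
  shows "given_by f' (\<lambda>x. u x + c)"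
  unfolding given_by_def
proof (intro conjI ballI)
  have "(\<lambda>x. u x + c) absolutely_integrable_on K" if K: "compact K" for K
  proof -
    have "u absolutely_integrable_on K" using u K by (auto simp: given_by_def locally_integrable_def)
    moreover have "(\<lambda>x. c) absolutely_integrable_on K"
      by (rule absolutely_integrable_on_const) (rule lmeasurable_compact[OF K])
    ultimately show ?thesis by (rule set_integral_add(1))
  qed
  then show "locally_integrable (\<lambda>x. u x + c)" by (simp add: locally_integrable_def)
  fix \<phi> :: "real^'a \<Rightarrow> complex" assume t: "\<phi> \<in> test_functions"
  then obtain R where \<phi>: "\<phi> \<in> test_in R" by (meson test_functions_test_in)
  have ci: "integrable lebesgue (\<lambda>x. c * \<phi> x)"
    using test_in_integrable[OF \<phi>] by (simp add: integrable_completion test_in_measurable[OF \<phi>])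
  have "f' \<phi> = (LINT x|lebesgue. u x * \<phi> x) + (LINT x|lebesgue. c * \<phi> x)"
    using c[OF test_in_schwartz[OF \<phi>]] u t by (simp add: given_by_def)
  also have "\<dots> = (LINT x|lebesgue. u x * \<phi> x + c * \<phi> x)"
    by (rule Bochner_Integration.integral_add[symmetric, OF given_by_integrable[OF u \<phi>] ci])
  finally show "f' \<phi> = (LINT x|lebesgue. (u x + c) * \<phi> x)" by (simp add: distrib_right)
qed

text \<open>Adding a constant to \<open>u\<close> leaves its differences unchanged, so both
  functionals have the same admissible \<open>g\<close>.\<close>

lemma pointwise_norm_differ_by_constant:
  assumes "differ_by_constant f f'" shows "pointwise_norm p f' = pointwise_norm p f"
proof -
  have "\<exists>u. given_by f' u \<and> admissible u g" if d: "differ_by_constant f f'" and u: "given_by f u" and adm: "admissible u g"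
    for f f' :: "'a::finite functional" and u g
  proof -
    obtain c where c: "\<And>\<phi>. \<phi> \<in> schwartz_functions \<Longrightarrow> f' \<phi> = f \<phi> + (LINT x|lebesgue. c * \<phi> x)"
      using d unfolding differ_by_constant_def by blast
    have "admissible (\<lambda>x. u x + c) g" using adm by (simp add: admissible_def)
    then show ?thesis using given_by_add_constant[OF u c] by blast
  qed
  then have "(\<exists>u. given_by f' u \<and> admissible u g) \<longleftrightarrow> (\<exists>u. given_by f u \<and> admissible u g)" for g
    using assms differ_by_constant_sym[OF assms] by blast
  then show ?thesis by (simp add: pointwise_norm_def)
qed

theorem theorem16:
  fixes \<psi> :: "real^'n::finite \<Rightarrow> complex" and \<rho> p :: real
  assumes "\<psi> \<in> test_functions"
    and "(LINT x|lebesgue. \<psi> x) = 1"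
    and "supp \<psi> \<subseteq> {x. norm x \<le> 1}"
    and "\<rho> > 0"
    and "real CARD('n) / (real CARD('n) + 1) < p" and "p \<le> 1"
  shows "(\<forall>f\<in>tempered_distributions.
            f \<in> local_hardy_sobolev \<psi> \<rho> p \<longleftrightarrow>
            (\<exists>u. given_by f u \<and> (\<exists>g\<in>Lp p. admissible u g))) \<and>
         (\<exists>C\<ge>1. \<forall>f\<in>local_hardy_sobolev \<psi> \<rho> p.
            ennreal (1 / C) * hardy_sobolev_norm \<psi> \<rho> p f \<le> pointwise_norm p f \<and>
            pointwise_norm p f \<le> ennreal C * hardy_sobolev_norm \<psi> \<rho> p f) \<and>
         (\<forall>f\<in>tempered_distributions. \<forall>f'\<in>tempered_distributions. differ_by_constant f f' \<longrightarrow>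
            hardy_sobolev_norm \<psi> \<rho> p f' = hardy_sobolev_norm \<psi> \<rho> p f \<and>
            pointwise_norm p f' = pointwise_norm p f)"
proof -
  let ?n = "real CARD('n)"
  obtain R where \<psi>R: "\<psi> \<in> test_in R" using test_functions_test_in[OF assms(1)] by blast
  have \<psi>0: "\<psi> x = 0" if "norm x > 1" for x
  proof (rule ccontr)
    assume "\<psi> x \<noteq> 0"
    then have "x \<in> supp \<psi>" using closure_subset[of "{x. \<psi> x \<noteq> 0}"] by (auto simp: supp_def)
    then show False using assms(3) that by auto
  qed
  \<comment> \<open>The reflection turns convolution with a dilate of \<open>\<psi>\<close> into
    testing against a bump of \<open>\<theta>\<close>.\<close>
  define \<theta> where "\<theta> y = \<psi> (- y)" for y
  interpret mollifier \<theta>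
  proof
    show "\<theta> \<in> test_in 1"
      using smooth_affine[OF test_in_smooth[OF \<psi>R], of "-1" 0] \<psi>0 by (simp add: test_in_def \<theta>_def[abs_def])
    have "(\<integral>x. \<psi> x \<partial>lborel) = (\<integral>x. \<theta> x \<partial>lborel)"
      by (subst integral_lborel_affine[where c = "-1" and t = 0]) (simp_all add: test_in_measurable[OF \<psi>R] \<theta>_def[abs_def])
    then show "(\<integral>x. \<theta> x \<partial>lborel) = 1" using assms(2) by (simp add: integral_lebesgue_test[OF \<psi>R])
  qed
  have p0: "p > 0" using assms(5) by (rule le_less_trans[rotated]) simp
  have "distr_convolution F (dilate t \<psi>) x = F (bump x t \<theta>)" for F :: "'n functional" and t x
  proof -
    have "(\<lambda>y. dilate t \<psi> (x - y)) = bump x t \<theta>"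
      by (simp add: dilate_def bump_def \<theta>_def fun_eq_iff power_one_over scaleR_diff_right)
    then show ?thesis by (simp add: distr_convolution_def)
  qed
  then have max_eq: "maximal_function \<psi> \<rho> F = radial_max \<rho> F" for F
    by (simp add: maximal_function_def radial_max_def fun_eq_iff)
  define N where "N F = (\<integral>\<^sup>+x. ennreal_rpow (radial_max \<rho> F x) p \<partial>lborel)" for F :: "'n functional"
  have hn: "hardy_norm \<psi> \<rho> p F = ennreal_rpow (N F) (1 / p)" for F
    by (simp add: hardy_norm_def Lp_norm_def max_eq nn_integral_lebesgue_eq N_def)
  have hs: "f \<in> local_hardy_sobolev \<psi> \<rho> p \<longleftrightarrow> (\<forall>j. N (distr_deriv j f) < top)" if f: "f \<in> tempered_distributions" for f
  proof -
    have "radial_max \<rho> (distr_deriv j f) \<in> borel_measurable lebesgue" for j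
      using radial_max_measurable[OF tempered_distribution[OF tempered_distr_deriv[OF f]]] by (simp add: measurable_completion)
    then show ?thesis using f tempered_distr_deriv[OF f]
      by (simp add: local_hardy_sobolev_def local_hardy_def max_eq hn)
  qed
  \<comment> \<open>The strict lower bound on \<open>p\<close> leaves room for \<open>q\<close>, and
    \<open>p \<le> 1\<close> gives \<open>q < 1\<close>.\<close>
  obtain q where q: "?n / (?n + 1) < q" "q < p" using dense[OF assms(5)] by blast
  have q': "0 < q" "q < 1" using q assms(6) le_less_trans[of 0 "?n / (?n + 1)" q] by auto
  obtain CA where CA: "CA \<ge> 0" "\<And>f u g j. given_by f u \<Longrightarrow> hajlasz (4 * \<rho>) u g \<Longrightarrow> pow_integral p g < top \<Longrightarrow>
      N (distr_deriv j f) \<le> ennreal CA * pow_integral p g"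
    using hardy_of_hajlasz[OF q' q, of \<rho>] unfolding N_def by blast
  obtain CB where CB: "CB \<ge> 0" "\<And>f. distribution f \<Longrightarrow> (\<And>j. N (distr_deriv j f) < top) \<Longrightarrow>
      (\<exists>u g. given_by f u \<and> hajlasz \<rho> u g \<and> pow_integral p g \<le> ennreal CB * (\<Sum>j\<in>UNIV. N (distr_deriv j f)))"
    using hajlasz_of_hardy[OF q' q assms(4)] unfolding N_def by blast
  \<comment> \<open>The ranges are adjusted from 1 to \<open>4 * \<rho>\<close> in one direction and
    from \<open>\<rho>\<close> to 1 in the other.\<close>
  obtain XA where XA: "XA \<ge> 0" "\<And>(v :: real^'n \<Rightarrow> complex) g. hajlasz 1 v g \<Longrightarrow> pow_integral p g < top \<Longrightarrow>
      (\<exists>g'. hajlasz (4 * \<rho>) v g' \<and> pow_integral p g' \<le> ennreal XA * pow_integral p g)"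
    using hajlasz_extend[OF q'(1) q(2), of 1 "4 * \<rho>"] by (metis zero_less_one)
  obtain XB where XB: "XB \<ge> 0" "\<And>(v :: real^'n \<Rightarrow> complex) g. hajlasz \<rho> v g \<Longrightarrow> pow_integral p g < top \<Longrightarrow>
      (\<exists>g'. hajlasz 1 v g' \<and> pow_integral p g' \<le> ennreal XB * pow_integral p g)"
    using hajlasz_extend[OF q'(1) q(2) assms(4), of 1] by metis
  have dirA: "N (distr_deriv j f) < top \<and> hardy_norm \<psi> \<rho> p (distr_deriv j f)
      \<le> ennreal ((CA * XA) powr (1 / p)) * Lp_norm p (\<lambda>x. ennreal \<bar>g x\<bar>)"
    if u: "given_by f u" and g: "g \<in> Lp p" and adm: "admissible u g" for f u g j
  proof -
    obtain g1 where g1: "hajlasz 1 u g1" "pow_integral p g1 < top"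
      "ennreal_rpow (pow_integral p g1) (1 / p) = Lp_norm p (\<lambda>x. ennreal \<bar>g x\<bar>)"
      using admissible_imp_hajlasz[OF g p0 adm] by blast
    obtain g2 where g2: "hajlasz (4 * \<rho>) u g2" "pow_integral p g2 \<le> ennreal XA * pow_integral p g1"
      using XA(2)[OF g1(1,2)] by blast
    have fin: "ennreal XA * pow_integral p g1 < top" using g1(2) by (simp add: ennreal_mult_less_top)
    have "N (distr_deriv j f) \<le> ennreal CA * pow_integral p g2"
      by (rule CA(2)[OF u g2(1) order_le_less_trans[OF g2(2) fin]])
    also have "\<dots> \<le> ennreal CA * (ennreal XA * pow_integral p g1)" by (rule mult_left_mono[OF g2(2)]) simp
    also have "\<dots> = ennreal (CA * XA) * pow_integral p g1" using CA(1) XA(1) by (simp add: ennreal_mult mult.assoc)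
    finally have le: "N (distr_deriv j f) \<le> ennreal (CA * XA) * pow_integral p g1" .
    have "ennreal_rpow (N (distr_deriv j f)) (1 / p) \<le> ennreal_rpow (ennreal (CA * XA) * pow_integral p g1) (1 / p)"
      using p0 by (intro ennreal_rpow_mono le) simp
    moreover have "ennreal (CA * XA) * pow_integral p g1 < top" using g1(2) by (simp add: ennreal_mult_less_top)
    ultimately show ?thesis
      using le CA(1) XA(1) g1(3) by (auto simp: hn ennreal_rpow_mult ennreal_rpow_ennreal intro: order_le_less_trans)
  qed
  \<comment> \<open>The power of 2 comes from moving the exponent \<open>1 / p\<close> inside the
    sum over the coordinates.\<close>
  define c2 where "c2 = (XB * CB) powr (1 / p) * (2 powr (1 / p)) ^ CARD('n)"
  have dirB: "\<exists>u g. given_by f u \<and> g \<in> Lp p \<and> admissible u g \<and>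
      Lp_norm p (\<lambda>x. ennreal \<bar>g x\<bar>) \<le> ennreal c2 * hardy_sobolev_norm \<psi> \<rho> p f"
    if f: "f \<in> tempered_distributions" and N: "\<And>j. N (distr_deriv j f) < top" for f
  proof -
    let ?S = "\<Sum>j\<in>UNIV. N (distr_deriv j f)"
    obtain u g where g: "given_by f u" "hajlasz \<rho> u g" "pow_integral p g \<le> ennreal CB * ?S"
      using CB(2)[OF tempered_distribution[OF f] N] by blast
    have "ennreal CB * ?S < top" using N by (simp add: ennreal_mult_less_top)
    then obtain g' where g': "hajlasz 1 u g'" "pow_integral p g' \<le> ennreal XB * pow_integral p g"
      using XB(2)[OF g(2) order_le_less_trans[OF g(3)]] by blast
    have "pow_integral p g' \<le> ennreal XB * (ennreal CB * ?S)" using g'(2) g(3) by (meson mult_left_mono order_trans zero_le)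
    also have "\<dots> = ennreal (XB * CB) * ?S" using XB(1) CB(1) by (simp add: ennreal_mult mult.assoc)
    finally have le: "pow_integral p g' \<le> ennreal (XB * CB) * ?S" .
    also have "\<dots> < top" using N by (simp add: ennreal_mult_less_top)
    finally have fin: "pow_integral p g' < top" .
    have "Lp_norm p (\<lambda>x. ennreal \<bar>g' x\<bar>) \<le> ennreal_rpow (ennreal (XB * CB) * ?S) (1 / p)"
      unfolding hajlasz_imp_admissible(3)[OF g'(1) fin] using p0 by (intro ennreal_rpow_mono le) simp
    also have "\<dots> = ennreal ((XB * CB) powr (1 / p)) * ennreal_rpow ?S (1 / p)"
      using XB(1) CB(1) by (simp add: ennreal_rpow_mult ennreal_rpow_ennreal)
    also have "\<dots> \<le> ennreal ((XB * CB) powr (1 / p)) * (ennreal ((2 powr (1 / p)) ^ CARD('n)) * (\<Sum>j\<in>UNIV. ennreal_rpow (N (distr_deriv j f)) (1 / p)))"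
      using p0 by (intro mult_left_mono ennreal_rpow_sum_le) auto
    also have "\<dots> = ennreal c2 * hardy_sobolev_norm \<psi> \<rho> p f"
      by (simp add: c2_def ennreal_mult hardy_sobolev_norm_def hn mult.assoc)
    finally show ?thesis using hajlasz_imp_admissible(1,2)[OF g'(1) fin] g(1) by blast
  qed
  have part1: "f \<in> local_hardy_sobolev \<psi> \<rho> p \<longleftrightarrow> (\<exists>u. given_by f u \<and> (\<exists>g\<in>Lp p. admissible u g))"
    if f: "f \<in> tempered_distributions" for f
    unfolding hs[OF f] using dirA dirB[OF f] by blast
  \<comment> \<open>The factor \<open>?n\<close> counts the coordinates: each derivative satisfies
    the same bound.\<close>
  define c1 where "c1 = ?n * (CA * XA) powr (1 / p)"
  define C where "C = 1 + c1 + c2"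
  have c: "c1 \<ge> 0" "c2 \<ge> 0" by (simp_all add: c1_def c2_def)
  have C: "C \<ge> 1" "c1 \<le> C" "c2 \<le> C" using c by (auto simp: C_def)
  have part2: "ennreal (1 / C) * hardy_sobolev_norm \<psi> \<rho> p f \<le> pointwise_norm p f \<and>
      pointwise_norm p f \<le> ennreal C * hardy_sobolev_norm \<psi> \<rho> p f" if f: "f \<in> local_hardy_sobolev \<psi> \<rho> p" for f
  proof
    have ft: "f \<in> tempered_distributions" using f by (simp add: local_hardy_sobolev_def)
    show "ennreal (1 / C) * hardy_sobolev_norm \<psi> \<rho> p f \<le> pointwise_norm p f"
      unfolding pointwise_norm_def
    proof (rule Inf_greatest, clarify)
      fix g u assume g: "g \<in> Lp p" and u: "given_by f u" "admissible u g"
      let ?g = "Lp_norm p (\<lambda>x. ennreal \<bar>g x\<bar>)"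
      have "hardy_sobolev_norm \<psi> \<rho> p f \<le> (\<Sum>j\<in>(UNIV :: 'n set). ennreal ((CA * XA) powr (1 / p)) * ?g)"
        unfolding hardy_sobolev_norm_def using dirA[OF u(1) g u(2)] by (intro sum_mono) blast
      also have "\<dots> = ennreal c1 * ?g" by (simp add: c1_def ennreal_mult ennreal_of_nat_eq_real_of_nat mult.assoc)
      finally have "ennreal (1 / C) * hardy_sobolev_norm \<psi> \<rho> p f \<le> ennreal (1 / C) * (ennreal c1 * ?g)"
        by (rule mult_left_mono) simp
      also have "\<dots> = ennreal (c1 / C) * ?g"
        using c C by (simp add: mult.assoc[symmetric] ennreal_mult[symmetric])
      also have "\<dots> \<le> 1 * ?g" using C by (intro mult_right_mono) (auto simp: divide_le_eq)
      finally show "ennreal (1 / C) * hardy_sobolev_norm \<psi> \<rho> p f \<le> ?g" by simp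
    qed
    obtain u g where g: "given_by f u" "g \<in> Lp p" "admissible u g"
      "Lp_norm p (\<lambda>x. ennreal \<bar>g x\<bar>) \<le> ennreal c2 * hardy_sobolev_norm \<psi> \<rho> p f"
      using dirB[OF ft] hs[OF ft] f by blast
    have "pointwise_norm p f \<le> Lp_norm p (\<lambda>x. ennreal \<bar>g x\<bar>)"
      unfolding pointwise_norm_def using g by (intro Inf_lower) blast
    also note g(4)
    also have "ennreal c2 * hardy_sobolev_norm \<psi> \<rho> p f \<le> ennreal C * hardy_sobolev_norm \<psi> \<rho> p f"
      using C by (intro mult_right_mono ennreal_leI) auto
    finally show "pointwise_norm p f \<le> ennreal C * hardy_sobolev_norm \<psi> \<rho> p f" .
  qed
  \<comment> \<open>Constants disappear because derivatives of bumps have integral zero, so the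
    radial maximal functions of the derivatives agree exactly.\<close>
  have part3: "hardy_sobolev_norm \<psi> \<rho> p f' = hardy_sobolev_norm \<psi> \<rho> p f" if d: "differ_by_constant f f'" for f f'
  proof -
    obtain c where c: "\<And>\<phi>. \<phi> \<in> schwartz_functions \<Longrightarrow> f' \<phi> = f \<phi> + (LINT x|lebesgue. c * \<phi> x)"
      using d unfolding differ_by_constant_def by blast
    have "distr_deriv j f' (bump x t \<theta>) = distr_deriv j f (bump x t \<theta>)" if "t > 0" for j x t
    proof -
      have b: "bump x t \<theta> \<in> test_in (norm x + t * 1)" by (rule bump_test_in[OF \<theta>_test that])
      have "(LINT y|lebesgue. c * partial_derivative j (bump x t \<theta>) y) = 0"
        using integral_partial_derivative[OF b, of j] by (simp add: integral_lebesgue_test[OF test_in_partial_derivative[OF b]])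
      then show ?thesis
        using c[OF test_in_schwartz[OF test_in_partial_derivative[OF b]], of j] by (simp add: distr_deriv_def)
    qed
    then have "radial_max \<rho> (distr_deriv j f') = radial_max \<rho> (distr_deriv j f)" for j
      by (auto simp: radial_max_def fun_eq_iff intro!: SUP_cong)
    then show ?thesis by (simp add: hardy_sobolev_norm_def hn N_def)
  qed
  show ?thesis
    using part1 part2 part3 pointwise_norm_differ_by_constant C(1) by blast
qed

end
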